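(* Let $a,\kappa\in\mathbb{C}$ with $a\neq0$, $a\ne-1$, $\kappa\neq-1$, $a\kappa\neq1$. On $M^{3|4}=\mathbb{C}^{3|4}(x_1,x_2,x_3|\xi_1,\xi_2,\xi_3,\xi_4)$ the vector fields $u_1^\pm,u_2^\pm,u_3^\pm,u_1^0,u_2^0,u_3^0$ (even) and $v_1^\pm,v_2^\pm,v_3^\pm,v_4^\pm$ (odd) listed in the context realize the Lie superalgebra $D\bigl(2,1;a(\kappa)\bigr)$ with parameter $a(\kappa)=\frac{a\kappa-1}{a+1}$ (that is, they span a Lie superalgebra of vector fields isomorphic to it) by symmetries of the space $M^{3|4}$ equipped with the distribution $$\mathcal{D}=\langle\,\partial_{x_1}+\xi_3\partial_{\xi_4},\ \ \partial_{x_2}+\xi_2\partial_{\xi_4},\ \ \partial_{\xi_1}+x_1\partial_{\xi_2}+x_2\partial_{\xi_3}+x_1x_2\partial_{\xi_4}+(\kappa x_1\xi_3+x_2\xi_2-(\kappa+1)\xi_4)\partial_{x_3}\rangle$$ naturally split into the sum of two even lines and one odd line as indicated by the generators.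
   Context: $x_i$ are even, $\xi_i$ odd coordinates. The vector fields are: $u^-_1=\partial_{x_1}+\xi_1\partial_{\xi_2}+\kappa\xi_1\xi_3\partial_{x_3}+x_2\xi_1\partial_{\xi_4}$, $u^-_2=\partial_{x_2}+\xi_1\partial_{\xi_3}+\xi_1\xi_2\partial_{x_3}+x_1\xi_1\partial_{\xi_4}$, $u^-_3=(\kappa+1)\partial_{x_3}$, $v^-_1=\partial_{\xi_1}$, $v^-_2=\partial_{\xi_2}+\kappa\xi_3\partial_{x_3}+x_2\partial_{\xi_4}$, $v^-_3=\partial_{\xi_3}+\xi_2\partial_{x_3}+x_1\partial_{\xi_4}$, $v^-_4=\partial_{\xi_4}+(\kappa+1)\xi_1\partial_{x_3}$; $u^0_1=x_1\partial_{x_1}+\xi_2\partial_{\xi_2}+\xi_4\partial_{\xi_4}+x_3\partial_{x_3}$, $u^0_2=x_2\partial_{x_2}+\xi_3\partial_{\xi_3}+\xi_4\partial_{\xi_4}+x_3\partial_{x_3}$, $u^0_3=\xi_1\partial_{\xi_1}+\xi_2\partial_{\xi_2}+\xi_3\partial_{\xi_3}+\xi_4\partial_{\xi_4}+2x_3\partial_{x_3}$; $u^+_1=x_1^2\partial_{x_1}-\xi_2\partial_{\xi_1}-(x_2\xi_2+x_1\xi_3-\xi_4)\partial_{\xi_3}-x_1(x_2\xi_2-\xi_4)\partial_{\xi_4}-\kappa\xi_2(x_1\xi_3-\xi_4)\partial_{x_3}$, $u^+_2=x_2^2\partial_{x_2}-\xi_3\partial_{\xi_1}-(x_2\xi_2+x_1\xi_3-\xi_4)\partial_{\xi_2}-x_2(x_1\xi_3-\xi_4)\partial_{\xi_4}-\xi_3(x_2\xi_2-\xi_4)\partial_{x_3}$,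 $v^+_1=(a+1)(x_1\xi_1-\xi_2)\partial_{x_1}+(a\kappa-1)(x_2\xi_1-\xi_3)\partial_{x_2}+(a+1)\xi_1\xi_2\partial_{\xi_2}+(a\kappa-1)\xi_1\xi_3\partial_{\xi_3}+(ax_3+a(\kappa+1)\xi_1\xi_4-\xi_2\xi_3)\partial_{\xi_4}+a(\kappa+1)x_3\xi_1\partial_{x_3}$, $v^+_2=-(a+1)x_1(x_1\xi_1-\xi_2)\partial_{x_1}+(a\kappa-1)(x_1\xi_3-\xi_4)\partial_{x_2}+(a+1)\xi_1\xi_2\partial_{\xi_1}+((a+1)\xi_1(x_2\xi_2+x_1\xi_3-\xi_4)-a(x_3+\xi_2\xi_3))\partial_{\xi_3}+x_1((a+1)\xi_1(x_2\xi_2-\xi_4)+\xi_2\xi_3-ax_3)\partial_{\xi_4}+((a+1)\kappa\xi_1(x_1\xi_2\xi_3-\xi_2\xi_4)-ax_3\xi_2)\partial_{x_3}$, $v^+_3=(a+1)(x_2\xi_2-\xi_4)\partial_{x_1}-(a\kappa-1)x_2(x_2\xi_1-\xi_3)\partial_{x_2}+(a\kappa-1)\xi_1\xi_3\partial_{\xi_1}+((a\kappa-1)\xi_1(x_2\xi_2+x_1\xi_3-\xi_4)+a(\kappa\xi_2\xi_3-x_3))\partial_{\xi_2}+x_2((a\kappa-1)\xi_1(x_1\xi_3-\xi_4)+\xi_2\xi_3-ax_3)\partial_{\xi_4}-((a\kappa-1)\xi_3(x_2\xi_1\xi_2-\xi_1\xi_4)+a\kappa x_3\xi_3)\partial_{x_3}$,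 $v^+_4=-(a+1)x_1(x_2\xi_2-\xi_4)\partial_{x_1}-(a\kappa-1)x_2(x_1\xi_3-\xi_4)\partial_{x_2}+(\xi_2\xi_3-ax_3)\partial_{\xi_1}-(a\kappa-1)\xi_2(x_1\xi_3-\xi_4)\partial_{\xi_2}-(a+1)\xi_3(x_2\xi_2-\xi_4)\partial_{\xi_3}-(\kappa+1)\xi_2\xi_3\xi_4\partial_{x_3}$, $u^+_3=a(a+1)(\kappa+1)(x_1x_2\xi_1\xi_2-x_1\xi_1\xi_4+\xi_2\xi_4)\partial_{x_1}+a(a\kappa-1)(\kappa+1)(x_1x_2\xi_1\xi_3-x_2\xi_1\xi_4+\xi_3\xi_4)\partial_{x_2}+a(\kappa+1)\xi_1(ax_3-\xi_2\xi_3)\partial_{\xi_1}+a(\kappa+1)((a\kappa-1)\xi_1\xi_2(x_1\xi_3-\xi_4)+ax_3\xi_2)\partial_{\xi_2}-a(\kappa+1)((a+1)\xi_1(x_2\xi_2\xi_3+\xi_3\xi_4)-ax_3\xi_3)\partial_{\xi_3}+a(\kappa+1)\xi_4(ax_3-\xi_2\xi_3)\partial_{\xi_4}+a(\kappa+1)((\kappa+1)\xi_1\xi_2\xi_3\xi_4+ax_3^2)\partial_{x_3}$. For $b\neq0,-1$, $D(2,1;b)=\Gamma(-1-b,1,b)$, where for $s_1+s_2+s_3=0$, $\Gamma(s_1,s_2,s_3)$ is the Lie superalgebra with even part $\mathfrak{sl}_2^{\oplus3}$ ($i$-th copy with standard basis $X_i,H_i,Y_i$), odd part $\mathbb{C}^2\boxtimes\mathbb{C}^2\boxtimes\mathbb{C}^2$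 (each $\mathbb{C}^2=\langle x,y\rangle$ standard: $X=x\partial_y$, $H=x\partial_x-y\partial_y$, $Y=y\partial_x$), and odd-odd bracket $[v_1v_2v_3,w_1w_2w_3]=s_1\varphi_1(v_1w_1)\eta_2(v_2,w_2)\eta_3(v_3,w_3)+s_2\eta_1(v_1,w_1)\varphi_2(v_2w_2)\eta_3(v_3,w_3)+s_3\eta_1(v_1,w_1)\eta_2(v_2,w_2)\varphi_3(v_3w_3)$, with $\eta_i$ skew, $\eta_i(x,y)=1$, $\varphi_i:x^2\mapsto X_i,\ -2xy\mapsto H_i,\ -y^2\mapsto Y_i$. *)

theory Defs
  imports "HOL-Analysis.Analysis" "HOL-Library.Function_Algebras"
begin

section \<open>The Grassmann algebra on four odd generators\<close>

text \<open>
  An element is given by its coefficients with respect to the monomials \<open>\<xi>\<^sub>S\<close>, where \<open>S\<close> ranges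
  over the subsets of the four-element index type \<open>4\<close> and \<open>\<xi>\<^sub>S\<close> is the product of the \<open>\<xi> j\<close>,
  \<open>j \<in> S\<close>, taken in increasing order of \<open>j\<close>. In the order of the type \<open>4\<close> the index \<open>4 = 0\<close>
  comes first; another order would only change the signs of the basis monomials.
\<close>

typedef grassmann = "UNIV :: (4 set \<Rightarrow> complex) set"
  morphisms gcoeff Grassmann ..

setup_lifting type_definition_grassmann

text \<open>The sign in \<open>\<xi>\<^sub>T * \<xi>\<^sub>U = shuffle_sign T U * \<xi>\<^sub>(\<^sub>T \<^sub>\<union> \<^sub>U\<^sub>)\<close> for disjoint \<open>T\<close> and \<open>U\<close>.\<close>

definition shuffle_sign :: "4 set \<Rightarrow> 4 set \<Rightarrow> complex" where
  "shuffle_sign T U = (\<Prod>i\<in>T. \<Prod>j\<in>U. if j < i then -1 else 1)"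

lemma shuffle_sign_union:
  "A \<inter> B = {} \<Longrightarrow> shuffle_sign (A \<union> B) C = shuffle_sign A C * shuffle_sign B C"
  "A \<inter> B = {} \<Longrightarrow> shuffle_sign C (A \<union> B) = shuffle_sign C A * shuffle_sign C B"
  by (simp_all add: shuffle_sign_def prod.union_disjoint prod.distrib)

instantiation grassmann :: ring_1
begin

lift_definition zero_grassmann :: grassmann is "\<lambda>S. 0" .
lift_definition one_grassmann :: grassmann is "\<lambda>S. if S = {} then 1 else 0" .
lift_definition plus_grassmann :: "grassmann \<Rightarrow> grassmann \<Rightarrow> grassmann" is "\<lambda>g h S. g S + h S" .
lift_definition minus_grassmann :: "grassmann \<Rightarrow> grassmann \<Rightarrow> grassmann" is "\<lambda>g h S. g S - h S" .
lift_definition uminus_grassmann :: "grassmann \<Rightarrow> grassmann" is "\<lambda>g S. - g S" .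
lift_definition times_grassmann :: "grassmann \<Rightarrow> grassmann \<Rightarrow> grassmann" is
  "\<lambda>g h S. \<Sum>T\<in>Pow S. shuffle_sign T (S - T) * g T * h (S - T)" .

instance
proof
  fix f g h :: grassmann
  show "f * g * h = f * (g * h)"
  proof (transfer, rule ext)
    fix f g h :: "4 set \<Rightarrow> complex" and S
    let ?s = shuffle_sign
    have "(\<Sum>T\<in>Pow S. ?s T (S - T) * (\<Sum>U\<in>Pow T. ?s U (T - U) * f U * g (T - U)) * h (S - T))
        = (\<Sum>(T, U)\<in>Sigma (Pow S) Pow. ?s T (S - T) * (?s U (T - U) * f U * g (T - U)) * h (S - T))"
      by (subst sum.Sigma [symmetric]) (auto simp: sum_distrib_left sum_distrib_right)
    also have "\<dots> = (\<Sum>(U, V)\<in>Sigma (Pow S) (\<lambda>U. Pow (S - U)).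
        ?s U (S - U) * f U * (?s V (S - U - V) * g V * h (S - U - V)))"
    proof (rule sum.reindex_bij_witness
        [where i = "\<lambda>(U, V). (U \<union> V, U)" and j = "\<lambda>(T, U). (U, T - U)"])
      fix p assume "p \<in> Sigma (Pow S) Pow"
      then obtain T U where p: "p = (T, U)" "T \<subseteq> S" "U \<subseteq> T" by auto
      let ?V = "T - U" and ?W = "S - T"
      have T: "T = U \<union> ?V" and W: "S - U = ?V \<union> ?W" "S - U - ?V = ?W" using p by auto
      have "?s T ?W = ?s U ?W * ?s ?V ?W"
        by (subst T, rule shuffle_sign_union) auto
      moreover have "?s U (S - U) = ?s U ?V * ?s U ?W"
        by (subst W(1), rule shuffle_sign_union) auto
      ultimately show "(case case p of (T, U) \<Rightarrow> (U, T - U) of (U, V) \<Rightarrow>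
            ?s U (S - U) * f U * (?s V (S - U - V) * g V * h (S - U - V)))
          = (case p of (T, U) \<Rightarrow> ?s T (S - T) * (?s U (T - U) * f U * g (T - U)) * h (S - T))"
        using W(2) by (simp add: p(1))
    qed auto
    also have "\<dots> = (\<Sum>U\<in>Pow S. ?s U (S - U) * f U *
        (\<Sum>V\<in>Pow (S - U). ?s V (S - U - V) * g V * h (S - U - V)))"
      by (subst sum.Sigma [symmetric]) (auto simp: sum_distrib_left)
    finally show "(\<Sum>T\<in>Pow S. ?s T (S - T) *
        (\<Sum>U\<in>Pow T. ?s U (T - U) * f U * g (T - U)) * h (S - T)) = \<dots>" .
  qed
  show "1 * f = f"
  proof (transfer, rule ext)
    fix f :: "4 set \<Rightarrow> complex" and S
    have "(\<Sum>T\<in>Pow S. shuffle_sign T (S - T) * (if T = {} then 1 else 0) * f (S - T))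
        = (\<Sum>T\<in>{{} :: 4 set}. f S)"
      by (rule sum.mono_neutral_cong_right) (auto simp: shuffle_sign_def)
    then show "(\<Sum>T\<in>Pow S. shuffle_sign T (S - T) * (if T = {} then 1 else 0) * f (S - T)) = f S"
      by simp
  qed
  show "f * 1 = f"
  proof (transfer, rule ext)
    fix f :: "4 set \<Rightarrow> complex" and S
    have "(\<Sum>T\<in>Pow S. shuffle_sign T (S - T) * f T * (if S - T = {} then 1 else 0))
        = (\<Sum>T\<in>{S}. f S)"
      by (rule sum.mono_neutral_cong_right) (auto simp: shuffle_sign_def)
    then show "(\<Sum>T\<in>Pow S. shuffle_sign T (S - T) * f T * (if S - T = {} then 1 else 0)) = f S"
      by simp
  qed
  show "(f + g) * h = f * h + g * h" "f * (g + h) = f * g + f * h"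
    by (transfer, simp add: algebra_simps sum.distrib)+
  show "(0::grassmann) \<noteq> 1"
    by transfer (metis zero_neq_one)
qed (transfer; simp add: algebra_simps)+

end

text \<open>Left derivative with respect to \<open>\<xi> j\<close>.\<close>

lift_definition g_deriv :: "4 \<Rightarrow> grassmann \<Rightarrow> grassmann" is
  "\<lambda>j g S. if j \<in> S then 0 else (\<Prod>i\<in>S. if i < j then -1 else 1) * g (insert j S)" .

text \<open>Parities are booleans: \<open>False\<close> is even and \<open>True\<close> is odd.\<close>

lift_definition g_part :: "bool \<Rightarrow> grassmann \<Rightarrow> grassmann" is
  "\<lambda>p g S. if odd (card S) = p then g S else 0" .

section \<open>Superfunctions and vector fields on \<open>\<complex>\<^sup>3\<^sup>|\<^sup>4\<close>\<close>

text \<open>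
  Superfunctions are the holomorphic maps from \<open>\<complex>\<^sup>3\<close> to the Grassmann algebra. The ambient type
  contains all maps, with pointwise operations; holomorphic ones are singled out by
  \<open>superfunctions\<close>. The even coordinates are indexed by the type \<open>3\<close>, the odd ones by the
  type \<open>4\<close>.
\<close>

type_synonym sfun = "complex^3 \<Rightarrow> grassmann"

definition superfunctions :: "sfun set" where
  "superfunctions = {F. \<forall>S p. \<exists>c::complex^3.
     ((\<lambda>q. gcoeff (F q) S) has_derivative (\<lambda>h. \<Sum>i\<in>UNIV. c $ i * h $ i)) (at p)}"

definition cst :: "complex \<Rightarrow> sfun" where
  "cst c = (\<lambda>p. Grassmann (\<lambda>S. if S = {} then c else 0))"

definition xc :: "3 \<Rightarrow> sfun" where
  "xc i = (\<lambda>p. Grassmann (\<lambda>S. if S = {} then p $ i else 0))"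

definition \<xi> :: "4 \<Rightarrow> sfun" where
  "\<xi> j = (\<lambda>p. Grassmann (\<lambda>S. if S = {j} then 1 else 0))"

type_synonym coord = "3 + 4"

fun pd :: "coord \<Rightarrow> sfun \<Rightarrow> sfun" where
  "pd (Inl i) F = (\<lambda>p. Grassmann (\<lambda>S.
     deriv (\<lambda>t. gcoeff (F (\<chi> l. if l = i then t else p $ l)) S) (p $ i)))"
| "pd (Inr j) F = (\<lambda>p. g_deriv j (F p))"

text \<open>A vector field \<open>\<Sum>k. X k * \<partial>\<^sub>k\<close> is represented by its components \<open>X k\<close>.\<close>

type_synonym vf = "coord \<Rightarrow> sfun"

definition vector_fields :: "vf set" where
  "vector_fields = {X. \<forall>k. X k \<in> superfunctions}"

definition vf_x :: "sfun \<Rightarrow> 3 \<Rightarrow> vf" ("_ \<partial>\<^sub>x _" [70, 1000] 69) where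
  "f \<partial>\<^sub>x i = (\<lambda>k. if k = Inl i then f else 0)"

definition vf_xi :: "sfun \<Rightarrow> 4 \<Rightarrow> vf" ("_ \<partial>\<^sub>\<xi> _" [70, 1000] 69) where
  "f \<partial>\<^sub>\<xi> j = (\<lambda>k. if k = Inr j then f else 0)"

definition vf_scale :: "sfun \<Rightarrow> vf \<Rightarrow> vf" where
  "vf_scale f X = (\<lambda>k. f * X k)"

definition vf_apply :: "vf \<Rightarrow> sfun \<Rightarrow> sfun" where
  "vf_apply X F = (\<Sum>k\<in>UNIV. X k * pd k F)"

fun coord_parity :: "coord \<Rightarrow> bool" where
  "coord_parity (Inl i) = False"
| "coord_parity (Inr j) = True"

definition vf_part :: "bool \<Rightarrow> vf \<Rightarrow> vf" where
  "vf_part p X = (\<lambda>k q. g_part (p \<noteq> coord_parity k) (X k q))"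

definition homogeneous_vector_fields :: "bool \<Rightarrow> vf set" where
  "homogeneous_vector_fields p = {X \<in> vector_fields. vf_part p X = X}"

text \<open>
  The supercommutator \<open>[X, Y] = X Y - (-1)\<^bsup>|X||Y|\<^esup> Y X\<close> of derivations, extended bilinearly from
  homogeneous vector fields. Its component at \<open>k\<close> is its value on the \<open>k\<close>-th coordinate
  function, and \<open>X k\<close> is the value of \<open>X\<close> on that function.
\<close>

definition vf_bracket :: "vf \<Rightarrow> vf \<Rightarrow> vf" where
  "vf_bracket X Y = (\<lambda>k. \<Sum>p\<in>UNIV. \<Sum>q\<in>UNIV.
     vf_apply (vf_part p X) (vf_part q Y k)
     - (if p \<and> q then -1 else 1) * vf_apply (vf_part q Y) (vf_part p X k))"

definition vf_span :: "vf set \<Rightarrow> vf set" where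
  "vf_span B = {\<Sum>X\<in>B. vf_scale (cst (c X)) X | c. True}"

section \<open>Lie superalgebras\<close>

text \<open>
  The underlying space is the sum of the two parts inside the ambient additive group \<open>'v\<close>; the
  bracket is given on arbitrary, not only on homogeneous, elements.
\<close>

record 'v superalg =
  even_part :: "'v set"
  odd_part :: "'v set"
  scal :: "complex \<Rightarrow> 'v \<Rightarrow> 'v"
  brk :: "'v \<Rightarrow> 'v \<Rightarrow> 'v"

definition sa_carrier :: "('v::ab_group_add) superalg \<Rightarrow> 'v set" where
  "sa_carrier L = {x + y | x y. x \<in> even_part L \<and> y \<in> odd_part L}"

definition superalg_iso ::
    "('v::ab_group_add \<Rightarrow> 'w::ab_group_add) \<Rightarrow> 'v superalg \<Rightarrow> 'w superalg \<Rightarrow> bool" where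
  "superalg_iso \<phi> L M \<longleftrightarrow>
     bij_betw \<phi> (sa_carrier L) (sa_carrier M) \<and>
     \<phi> ` even_part L = even_part M \<and>
     \<phi> ` odd_part L = odd_part M \<and>
     (\<forall>x\<in>sa_carrier L. \<forall>y\<in>sa_carrier L. \<phi> (x + y) = \<phi> x + \<phi> y) \<and>
     (\<forall>c. \<forall>x\<in>sa_carrier L. \<phi> (scal L c x) = scal M c (\<phi> x)) \<and>
     (\<forall>x\<in>sa_carrier L. \<forall>y\<in>sa_carrier L. \<phi> (brk L x y) = brk M (\<phi> x) (\<phi> y))"

definition superalg_isomorphic ::
    "('v::ab_group_add) superalg \<Rightarrow> ('w::ab_group_add) superalg \<Rightarrow> bool" where
  "superalg_isomorphic L M \<longleftrightarrow> (\<exists>\<phi>. superalg_iso \<phi> L M)"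

text \<open>
  Lie superalgebras of vector fields, i.e. graded subspaces of the Lie superalgebra of all vector
  fields that are closed under the bracket.
\<close>

definition vf_superalg :: "vf set \<Rightarrow> vf set \<Rightarrow> vf superalg" where
  "vf_superalg A B =
     \<lparr>even_part = A, odd_part = B, scal = \<lambda>c. vf_scale (cst c), brk = vf_bracket\<rparr>"

definition vf_subspace :: "vf set \<Rightarrow> bool" where
  "vf_subspace A \<longleftrightarrow> 0 \<in> A \<and> (\<forall>X\<in>A. \<forall>Y\<in>A. X + Y \<in> A) \<and> (\<forall>c. \<forall>X\<in>A. vf_scale (cst c) X \<in> A)"

definition lie_superalgebra_of_vector_fields :: "vf set \<Rightarrow> vf set \<Rightarrow> bool" where
  "lie_superalgebra_of_vector_fields A B \<longleftrightarrow>
     vf_subspace A \<and> A \<subseteq> homogeneous_vector_fields False \<and>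
     vf_subspace B \<and> B \<subseteq> homogeneous_vector_fields True \<and>
     (\<forall>X\<in>A. \<forall>Y\<in>A. vf_bracket X Y \<in> A) \<and>
     (\<forall>X\<in>A. \<forall>Y\<in>B. vf_bracket X Y \<in> B \<and> vf_bracket Y X \<in> B) \<and>
     (\<forall>X\<in>B. \<forall>Y\<in>B. vf_bracket X Y \<in> A)"

section \<open>The Lie superalgebras \<open>\<Gamma>(s\<^sub>1, s\<^sub>2, s\<^sub>3)\<close> and \<open>D(2, 1; b)\<close>\<close>

text \<open>
  The standard basis \<open>x, y\<close> of \<open>\<complex>\<^sup>2\<close> is \<open>axis 1 1\<close>, \<open>axis 2 1\<close>, so that \<open>X = x \<partial>\<^sub>y\<close>,
  \<open>H = x \<partial>\<^sub>x - y \<partial>\<^sub>y\<close> and \<open>Y = y \<partial>\<^sub>x\<close> act by the usual matrices. The even part consists of triples of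
  traceless matrices; an odd element \<open>t\<close> has \<open>t $ i $ j $ k\<close> as its coefficient at the tensor
  product of the basis vectors with indices \<open>i\<close>, \<open>j\<close>, \<open>k\<close>.
\<close>

type_synonym mat2 = "complex^2^2"
type_synonym tensor = "complex^2^2^2"
type_synonym gam = "(mat2^3) \<times> tensor"

definition slX :: mat2 where "slX = vector [vector [0, 1], vector [0, 0]]"
definition slH :: mat2 where "slH = vector [vector [1, 0], vector [0, -1]]"
definition slY :: mat2 where "slY = vector [vector [0, 0], vector [1, 0]]"

definition mscale :: "complex \<Rightarrow> mat2 \<Rightarrow> mat2" where
  "mscale c A = (\<chi> i j. c * A $ i $ j)"

definition \<eta> :: "complex^2 \<Rightarrow> complex^2 \<Rightarrow> complex" where
  "\<eta> v w = v $ 1 * w $ 2 - v $ 2 * w $ 1"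

text \<open>The value \<open>\<phi>(v w)\<close> on the product \<open>v w\<close> in the symmetric square of \<open>\<complex>\<^sup>2\<close>, where
  \<open>x\<^sup>2 \<mapsto> X\<close>, \<open>-2 x y \<mapsto> H\<close> and \<open>-y\<^sup>2 \<mapsto> Y\<close>.\<close>

definition \<phi>sym :: "complex^2 \<Rightarrow> complex^2 \<Rightarrow> mat2" where
  "\<phi>sym v w = mscale (v $ 1 * w $ 1) slX
     - mscale ((v $ 1 * w $ 2 + v $ 2 * w $ 1) / 2) slH
     - mscale (v $ 2 * w $ 2) slY"

definition simple_odd_bracket :: "complex \<Rightarrow> complex \<Rightarrow> complex \<Rightarrow>
    complex^2 \<Rightarrow> complex^2 \<Rightarrow> complex^2 \<Rightarrow> complex^2 \<Rightarrow> complex^2 \<Rightarrow> complex^2 \<Rightarrow> mat2^3" where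
  "simple_odd_bracket s1 s2 s3 v1 v2 v3 w1 w2 w3 = vector
     [mscale (s1 * \<eta> v2 w2 * \<eta> v3 w3) (\<phi>sym v1 w1),
      mscale (s2 * \<eta> v1 w1 * \<eta> v3 w3) (\<phi>sym v2 w2),
      mscale (s3 * \<eta> v1 w1 * \<eta> v2 w2) (\<phi>sym v3 w3)]"

definition tensor_product :: "complex^2 \<Rightarrow> complex^2 \<Rightarrow> complex^2 \<Rightarrow> tensor" where
  "tensor_product v1 v2 v3 = (\<chi> i j k. v1 $ i * v2 $ j * v3 $ k)"

definition odd_bracket :: "complex \<Rightarrow> complex \<Rightarrow> complex \<Rightarrow> tensor \<Rightarrow> tensor \<Rightarrow> mat2^3" where
  "odd_bracket s1 s2 s3 t u = (\<chi> r.
     \<Sum>i\<in>UNIV. \<Sum>j\<in>UNIV. \<Sum>k\<in>UNIV. \<Sum>l\<in>UNIV. \<Sum>m\<in>UNIV. \<Sum>n\<in>UNIV.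
       mscale (t $ i $ j $ k * u $ l $ m $ n)
         (simple_odd_bracket s1 s2 s3 (axis i 1) (axis j 1) (axis k 1)
            (axis l 1) (axis m 1) (axis n 1) $ r))"

lemma mscale_nth [simp]: "mscale c A $ i $ j = c * A $ i $ j"
  by (simp add: mscale_def)

text \<open>\<^const>\<open>odd_bracket\<close> is bilinear by construction, so it is determined by its values on simple
  tensors.\<close>

lemma odd_bracket_tensor_product:
  "odd_bracket s1 s2 s3 (tensor_product v1 v2 v3) (tensor_product w1 w2 w3) =
   simple_odd_bracket s1 s2 s3 v1 v2 v3 w1 w2 w3" (is "?L = ?R")
proof -
  have "?L $ r $ p $ q = ?R $ r $ p $ q" for r p q
    using exhaust_3[of r] exhaust_2[of p] exhaust_2[of q]
    apply (elim disjE; hypsubst)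
    apply (simp_all add: odd_bracket_def tensor_product_def simple_odd_bracket_def \<eta>_def
      \<phi>sym_def slX_def slH_def slY_def sum_2 axis_def)
    apply (simp_all add: field_simps)
    done
  then show ?thesis by (simp add: vec_eq_iff)
qed

definition even_action :: "mat2^3 \<Rightarrow> tensor \<Rightarrow> tensor" where
  "even_action A t = (\<chi> i j k.
     (\<Sum>l\<in>UNIV. A $ 1 $ i $ l * t $ l $ j $ k)
     + (\<Sum>l\<in>UNIV. A $ 2 $ j $ l * t $ i $ l $ k)
     + (\<Sum>l\<in>UNIV. A $ 3 $ k $ l * t $ i $ j $ l))"

fun \<Gamma>_bracket :: "complex \<Rightarrow> complex \<Rightarrow> complex \<Rightarrow> gam \<Rightarrow> gam \<Rightarrow> gam" where
  "\<Gamma>_bracket s1 s2 s3 (A, t) (B, u) =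
     ((\<chi> r. A $ r ** B $ r - B $ r ** A $ r) + odd_bracket s1 s2 s3 t u,
      even_action A u - even_action B t)"

fun \<Gamma>_scale :: "complex \<Rightarrow> gam \<Rightarrow> gam" where
  "\<Gamma>_scale c (A, t) = ((\<chi> r. mscale c (A $ r)), (\<chi> i. mscale c (t $ i)))"

text \<open>To be used for \<open>s1 + s2 + s3 = 0\<close> only: otherwise the Jacobi identity fails.\<close>

definition \<Gamma>_superalg :: "complex \<Rightarrow> complex \<Rightarrow> complex \<Rightarrow> gam superalg" where
  "\<Gamma>_superalg s1 s2 s3 =
     \<lparr>even_part = {(A, 0) | A. \<forall>r. trace (A $ r) = 0},
      odd_part = {(0, t) | t. True},
      scal = \<Gamma>_scale,
      brk = \<Gamma>_bracket s1 s2 s3\<rparr>"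

definition D21 :: "complex \<Rightarrow> gam superalg" where
  "D21 b = \<Gamma>_superalg (-1 - b) 1 b"

section \<open>Split distributions and their symmetries\<close>

text \<open>
  Here \<open>Y1\<close>, \<open>Y2\<close>, \<open>Y3\<close> are the generators of the lines; a distribution is identified with its
  module of global sections over the superfunctions.
\<close>

definition line_module :: "vf \<Rightarrow> vf set" where
  "line_module Y = {vf_scale f Y | f. f \<in> superfunctions}"

definition distribution :: "vf \<Rightarrow> vf \<Rightarrow> vf \<Rightarrow> vf set" where
  "distribution Y1 Y2 Y3 = {vf_scale f1 Y1 + vf_scale f2 Y2 + vf_scale f3 Y3 | f1 f2 f3.
     f1 \<in> superfunctions \<and> f2 \<in> superfunctions \<and> f3 \<in> superfunctions}"

definition splits_into_two_even_and_one_odd_line :: "vf \<Rightarrow> vf \<Rightarrow> vf \<Rightarrow> bool" where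
  "splits_into_two_even_and_one_odd_line Y1 Y2 Y3 \<longleftrightarrow>
     Y1 \<in> homogeneous_vector_fields False \<and> Y2 \<in> homogeneous_vector_fields False \<and>
     Y3 \<in> homogeneous_vector_fields True \<and>
     (\<forall>f1\<in>superfunctions. \<forall>f2\<in>superfunctions. \<forall>f3\<in>superfunctions.
        vf_scale f1 Y1 + vf_scale f2 Y2 + vf_scale f3 Y3 = 0 \<longrightarrow> f1 = 0 \<and> f2 = 0 \<and> f3 = 0)"

definition preserves :: "vf \<Rightarrow> vf set \<Rightarrow> bool" where
  "preserves X E \<longleftrightarrow> (\<forall>Y\<in>E. vf_bracket X Y \<in> E)"

definition split_symmetries :: "vf \<Rightarrow> vf \<Rightarrow> vf \<Rightarrow> vf set" where
  "split_symmetries Y1 Y2 Y3 = {X \<in> vector_fields.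
     preserves X (distribution Y1 Y2 Y3) \<and>
     preserves X (line_module Y1) \<and> preserves X (line_module Y2) \<and> preserves X (line_module Y3)}"

definition D1 :: vf where "D1 = 1 \<partial>\<^sub>x 1 + \<xi> 3 \<partial>\<^sub>\<xi> 4"

definition D2 :: vf where "D2 = 1 \<partial>\<^sub>x 2 + \<xi> 2 \<partial>\<^sub>\<xi> 4"

definition D3 :: "complex \<Rightarrow> vf" where
  "D3 \<kappa> = 1 \<partial>\<^sub>\<xi> 1 + xc 1 \<partial>\<^sub>\<xi> 2 + xc 2 \<partial>\<^sub>\<xi> 3 + xc 1 * xc 2 \<partial>\<^sub>\<xi> 4
    + (cst \<kappa> * xc 1 * \<xi> 3 + xc 2 * \<xi> 2 - cst (\<kappa> + 1) * \<xi> 4) \<partial>\<^sub>x 3"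

section \<open>The vector fields\<close>

text \<open>The suffixes \<open>m\<close>, \<open>z\<close>, \<open>p\<close> stand for the superscripts \<open>-\<close>, \<open>0\<close>, \<open>+\<close>.\<close>

definition u1m :: "complex \<Rightarrow> vf" where
  "u1m \<kappa> = 1 \<partial>\<^sub>x 1 + \<xi> 1 \<partial>\<^sub>\<xi> 2 + cst \<kappa> * \<xi> 1 * \<xi> 3 \<partial>\<^sub>x 3 + xc 2 * \<xi> 1 \<partial>\<^sub>\<xi> 4"

definition u2m :: vf where
  "u2m = 1 \<partial>\<^sub>x 2 + \<xi> 1 \<partial>\<^sub>\<xi> 3 + \<xi> 1 * \<xi> 2 \<partial>\<^sub>x 3 + xc 1 * \<xi> 1 \<partial>\<^sub>\<xi> 4"

definition u3m :: "complex \<Rightarrow> vf" where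
  "u3m \<kappa> = cst (\<kappa> + 1) \<partial>\<^sub>x 3"

definition v1m :: vf where
  "v1m = 1 \<partial>\<^sub>\<xi> 1"

definition v2m :: "complex \<Rightarrow> vf" where
  "v2m \<kappa> = 1 \<partial>\<^sub>\<xi> 2 + cst \<kappa> * \<xi> 3 \<partial>\<^sub>x 3 + xc 2 \<partial>\<^sub>\<xi> 4"

definition v3m :: vf where
  "v3m = 1 \<partial>\<^sub>\<xi> 3 + \<xi> 2 \<partial>\<^sub>x 3 + xc 1 \<partial>\<^sub>\<xi> 4"

definition v4m :: "complex \<Rightarrow> vf" where
  "v4m \<kappa> = 1 \<partial>\<^sub>\<xi> 4 + cst (\<kappa> + 1) * \<xi> 1 \<partial>\<^sub>x 3"

definition u1z :: vf where
  "u1z = xc 1 \<partial>\<^sub>x 1 + \<xi> 2 \<partial>\<^sub>\<xi> 2 + \<xi> 4 \<partial>\<^sub>\<xi> 4 + xc 3 \<partial>\<^sub>x 3"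

definition u2z :: vf where
  "u2z = xc 2 \<partial>\<^sub>x 2 + \<xi> 3 \<partial>\<^sub>\<xi> 3 + \<xi> 4 \<partial>\<^sub>\<xi> 4 + xc 3 \<partial>\<^sub>x 3"

definition u3z :: vf where
  "u3z = \<xi> 1 \<partial>\<^sub>\<xi> 1 + \<xi> 2 \<partial>\<^sub>\<xi> 2 + \<xi> 3 \<partial>\<^sub>\<xi> 3 + \<xi> 4 \<partial>\<^sub>\<xi> 4 + 2 * xc 3 \<partial>\<^sub>x 3"

definition u1p :: "complex \<Rightarrow> vf" where
  "u1p \<kappa> = xc 1 ^ 2 \<partial>\<^sub>x 1 - \<xi> 2 \<partial>\<^sub>\<xi> 1 - (xc 2 * \<xi> 2 + xc 1 * \<xi> 3 - \<xi> 4) \<partial>\<^sub>\<xi> 3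
    - xc 1 * (xc 2 * \<xi> 2 - \<xi> 4) \<partial>\<^sub>\<xi> 4 - cst \<kappa> * \<xi> 2 * (xc 1 * \<xi> 3 - \<xi> 4) \<partial>\<^sub>x 3"

definition u2p :: vf where
  "u2p = xc 2 ^ 2 \<partial>\<^sub>x 2 - \<xi> 3 \<partial>\<^sub>\<xi> 1 - (xc 2 * \<xi> 2 + xc 1 * \<xi> 3 - \<xi> 4) \<partial>\<^sub>\<xi> 2
    - xc 2 * (xc 1 * \<xi> 3 - \<xi> 4) \<partial>\<^sub>\<xi> 4 - \<xi> 3 * (xc 2 * \<xi> 2 - \<xi> 4) \<partial>\<^sub>x 3"

definition v1p :: "complex \<Rightarrow> complex \<Rightarrow> vf" where
  "v1p a \<kappa> = cst (a + 1) * (xc 1 * \<xi> 1 - \<xi> 2) \<partial>\<^sub>x 1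
    + cst (a * \<kappa> - 1) * (xc 2 * \<xi> 1 - \<xi> 3) \<partial>\<^sub>x 2
    + cst (a + 1) * \<xi> 1 * \<xi> 2 \<partial>\<^sub>\<xi> 2
    + cst (a * \<kappa> - 1) * \<xi> 1 * \<xi> 3 \<partial>\<^sub>\<xi> 3
    + (cst a * xc 3 + cst (a * (\<kappa> + 1)) * \<xi> 1 * \<xi> 4 - \<xi> 2 * \<xi> 3) \<partial>\<^sub>\<xi> 4
    + cst (a * (\<kappa> + 1)) * xc 3 * \<xi> 1 \<partial>\<^sub>x 3"

definition v2p :: "complex \<Rightarrow> complex \<Rightarrow> vf" where
  "v2p a \<kappa> = - (cst (a + 1) * xc 1 * (xc 1 * \<xi> 1 - \<xi> 2) \<partial>\<^sub>x 1)
    + cst (a * \<kappa> - 1) * (xc 1 * \<xi> 3 - \<xi> 4) \<partial>\<^sub>x 2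
    + cst (a + 1) * \<xi> 1 * \<xi> 2 \<partial>\<^sub>\<xi> 1
    + (cst (a + 1) * \<xi> 1 * (xc 2 * \<xi> 2 + xc 1 * \<xi> 3 - \<xi> 4) - cst a * (xc 3 + \<xi> 2 * \<xi> 3)) \<partial>\<^sub>\<xi> 3
    + xc 1 * (cst (a + 1) * \<xi> 1 * (xc 2 * \<xi> 2 - \<xi> 4) + \<xi> 2 * \<xi> 3 - cst a * xc 3) \<partial>\<^sub>\<xi> 4
    + (cst ((a + 1) * \<kappa>) * \<xi> 1 * (xc 1 * \<xi> 2 * \<xi> 3 - \<xi> 2 * \<xi> 4) - cst a * xc 3 * \<xi> 2) \<partial>\<^sub>x 3"

definition v3p :: "complex \<Rightarrow> complex \<Rightarrow> vf" where
  "v3p a \<kappa> = cst (a + 1) * (xc 2 * \<xi> 2 - \<xi> 4) \<partial>\<^sub>x 1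
    - cst (a * \<kappa> - 1) * xc 2 * (xc 2 * \<xi> 1 - \<xi> 3) \<partial>\<^sub>x 2
    + cst (a * \<kappa> - 1) * \<xi> 1 * \<xi> 3 \<partial>\<^sub>\<xi> 1
    + (cst (a * \<kappa> - 1) * \<xi> 1 * (xc 2 * \<xi> 2 + xc 1 * \<xi> 3 - \<xi> 4)
        + cst a * (cst \<kappa> * \<xi> 2 * \<xi> 3 - xc 3)) \<partial>\<^sub>\<xi> 2
    + xc 2 * (cst (a * \<kappa> - 1) * \<xi> 1 * (xc 1 * \<xi> 3 - \<xi> 4) + \<xi> 2 * \<xi> 3 - cst a * xc 3) \<partial>\<^sub>\<xi> 4
    - (cst (a * \<kappa> - 1) * \<xi> 3 * (xc 2 * \<xi> 1 * \<xi> 2 - \<xi> 1 * \<xi> 4)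
        + cst (a * \<kappa>) * xc 3 * \<xi> 3) \<partial>\<^sub>x 3"

definition v4p :: "complex \<Rightarrow> complex \<Rightarrow> vf" where
  "v4p a \<kappa> = - (cst (a + 1) * xc 1 * (xc 2 * \<xi> 2 - \<xi> 4) \<partial>\<^sub>x 1)
    - cst (a * \<kappa> - 1) * xc 2 * (xc 1 * \<xi> 3 - \<xi> 4) \<partial>\<^sub>x 2
    + (\<xi> 2 * \<xi> 3 - cst a * xc 3) \<partial>\<^sub>\<xi> 1
    - cst (a * \<kappa> - 1) * \<xi> 2 * (xc 1 * \<xi> 3 - \<xi> 4) \<partial>\<^sub>\<xi> 2
    - cst (a + 1) * \<xi> 3 * (xc 2 * \<xi> 2 - \<xi> 4) \<partial>\<^sub>\<xi> 3
    - cst (\<kappa> + 1) * \<xi> 2 * \<xi> 3 * \<xi> 4 \<partial>\<^sub>x 3"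

definition u3p :: "complex \<Rightarrow> complex \<Rightarrow> vf" where
  "u3p a \<kappa> =
    cst (a * (a + 1) * (\<kappa> + 1))
        * (xc 1 * xc 2 * \<xi> 1 * \<xi> 2 - xc 1 * \<xi> 1 * \<xi> 4 + \<xi> 2 * \<xi> 4) \<partial>\<^sub>x 1
    + cst (a * (a * \<kappa> - 1) * (\<kappa> + 1))
        * (xc 1 * xc 2 * \<xi> 1 * \<xi> 3 - xc 2 * \<xi> 1 * \<xi> 4 + \<xi> 3 * \<xi> 4) \<partial>\<^sub>x 2
    + cst (a * (\<kappa> + 1)) * \<xi> 1 * (cst a * xc 3 - \<xi> 2 * \<xi> 3) \<partial>\<^sub>\<xi> 1
    + cst (a * (\<kappa> + 1))
        * (cst (a * \<kappa> - 1) * \<xi> 1 * \<xi> 2 * (xc 1 * \<xi> 3 - \<xi> 4) + cst a * xc 3 * \<xi> 2) \<partial>\<^sub>\<xi> 2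
    - cst (a * (\<kappa> + 1))
        * (cst (a + 1) * \<xi> 1 * (xc 2 * \<xi> 2 * \<xi> 3 + \<xi> 3 * \<xi> 4) - cst a * xc 3 * \<xi> 3) \<partial>\<^sub>\<xi> 3
    + cst (a * (\<kappa> + 1)) * \<xi> 4 * (cst a * xc 3 - \<xi> 2 * \<xi> 3) \<partial>\<^sub>\<xi> 4
    + cst (a * (\<kappa> + 1))
        * (cst (\<kappa> + 1) * \<xi> 1 * \<xi> 2 * \<xi> 3 * \<xi> 4 + cst a * xc 3 ^ 2) \<partial>\<^sub>x 3"

definition u_fields :: "complex \<Rightarrow> complex \<Rightarrow> vf set" where
  "u_fields a \<kappa> = {u1m \<kappa>, u2m, u3m \<kappa>, u1z, u2z, u3z, u1p \<kappa>, u2p, u3p a \<kappa>}"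

definition v_fields :: "complex \<Rightarrow> complex \<Rightarrow> vf set" where
  "v_fields a \<kappa> = {v1m, v2m \<kappa>, v3m, v4m \<kappa>, v1p a \<kappa>, v2p a \<kappa>, v3p a \<kappa>, v4p a \<kappa>}"

end

theory Submission
  imports Defs "HOL-Complex_Analysis.Cauchy_Integral_Formula"
begin

text \<open>
  The components of the fields are polynomials in the coordinates, \<open>a\<close> and \<open>\<kappa>\<close> with integer
  coefficients. Hence, once \<open>u\<^sub>3\<^sup>+\<close> is divided by \<open>a(\<kappa> + 1)\<close>, the brackets of the fields with each other
  and with the generators of the distribution come down to identities between explicit polynomials,
  which are checked by rewriting. In the resulting table of structure constants the three copies
  of \<open>sl\<^sub>2\<close> are spanned by \<open>u\<^sub>3\<^sup>\<plusminus>, u\<^sub>3\<^sup>0\<close>, by \<open>u\<^sub>1\<^sup>\<plusminus>, 2u\<^sub>1\<^sup>0 - u\<^sub>3\<^sup>0\<close> and by \<open>u\<^sub>2\<^sup>\<plusminus>, 2u\<^sub>2\<^sup>0 - u\<^sub>3\<^sup>0\<close>, and the odd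
  fields form the tensor product of their standard modules. The brackets of odd fields agree with those of
  \<open>D(2, 1; b)\<close>, \<open>b = (a\<kappa> - 1) / (a + 1)\<close>, up to the factor \<open>a + 1\<close>, which is absorbed by rescaling one
  basis vector of the first standard module.

  If \<open>[X, Y] = g Y\<close> for a generator \<open>Y\<close> of a line, then \<open>[X, f Y] = (X f \<plusminus> f g) Y\<close>, so \<open>X\<close> preserves the
  line. That \<open>X f\<close> is again a superfunction follows from Cauchy's integral formula for the partial
  derivatives.
\<close>

section \<open>The Grassmann algebra\<close>

text \<open>Sign rules hold only for homogeneous arguments, while \<open>vf_bracket\<close> and the
  line modules also involve inhomogeneous ones; hence the recurring splitting into parities. The
  identities must hold for all a and \<kappa>, so both parameters enter the symbolic calculus as
  even variables that are never differentiated, and one integer computation serves all their values.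
  The calculus is used in one direction: a difference that reduces to the empty list has value zero.
  The factor a + 1 appears because (a + 1)(-1 - b, 1, b) = (-a(\<kappa> + 1), a + 1, a\<kappa> - 1),
  and these are, up to sign, the weights of the three copies of sl2 in the brackets of the v^- with
  the v^+. Injectivity of the realization requires the 17 fields to be linearly independent. This is
  seen at the origin: suitable Taylor coefficients of the components form a dual basis up to the
  factors 1, -1, \<kappa> + 1, a, -a and 2a. That the spans are closed under the bracket is not read
  off from the table, but transported from the algebra of matrices and tensors.\<close>

lemma grassmann_eqI: "(\<And>S. gcoeff f S = gcoeff g S) \<Longrightarrow> f = g"
  by (metis ext gcoeff_inject)

lemmas gcoeff_simps [simp] = zero_grassmann.rep_eq plus_grassmann.rep_eq
  minus_grassmann.rep_eq uminus_grassmann.rep_eq g_part.rep_eq Grassmann_inverse [OF UNIV_I]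

lemma gcoeff_mult: "gcoeff (f * g) S = (\<Sum>T\<in>Pow S. shuffle_sign T (S - T) * gcoeff f T * gcoeff g (S - T))"
  by (simp add: times_grassmann.rep_eq)

lemma shuffle_sign_square: "shuffle_sign T U * shuffle_sign T U = 1"
  by (simp add: shuffle_sign_def flip: prod.distrib) (simp add: prod.neutral)

text \<open>By disjointness exactly one of j < i and i < j holds for i in T and j in U, so each pair
  contributes one factor -1 to the product of the two signs.\<close>

lemma shuffle_sign_swap:
  assumes "T \<inter> U = {}"
  shows "shuffle_sign U T = (-1) ^ (card T * card U) * shuffle_sign T U"
proof -
  have "shuffle_sign U T = (\<Prod>i\<in>T. \<Prod>j\<in>U. if i < j then -1 else 1)"
    unfolding shuffle_sign_def by (rule prod.swap)
  then have "shuffle_sign T U * shuffle_sign U T =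
      (\<Prod>i\<in>T. \<Prod>j\<in>U. (if j < i then -1 else 1) * (if i < j then -1 else 1))"
    by (simp only: shuffle_sign_def [of T U] prod.distrib)
  also have "\<dots> = (\<Prod>i\<in>T. \<Prod>j\<in>U. -1)"
    using assms by (intro prod.cong refl) auto
  also have "\<dots> = (-1) ^ (card T * card U)"
    by (simp add: mult.commute flip: power_mult)
  finally show ?thesis
    using shuffle_sign_square [of T U] by (metis mult.assoc mult.commute mult_1)
qed

text \<open>After the substitution of S - T for T the two coefficient sums differ termwise by the
  sign of \<open>shuffle_sign_swap\<close>, and on nonzero terms that sign depends only on p and
  q.\<close>

lemma grassmann_supercommute:
  assumes f: "g_part p f = f" and g: "g_part q g = g"
  shows "g * f = (if p \<and> q then - (f * g) else f * g)"
proof (rule grassmann_eqI)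
  fix S
  have f0: "gcoeff f T = 0" if "odd (card T) \<noteq> p" for T
    using arg_cong [OF f, of "\<lambda>h. gcoeff h T"] that by (simp split: if_splits)
  have g0: "gcoeff g T = 0" if "odd (card T) \<noteq> q" for T
    using arg_cong [OF g, of "\<lambda>h. gcoeff h T"] that by (simp split: if_splits)
  have "gcoeff (g * f) S =
      (\<Sum>T\<in>Pow S. shuffle_sign (S - T) T * gcoeff g (S - T) * gcoeff f T)"
    unfolding gcoeff_mult
    by (rule sum.reindex_bij_witness [where i = "\<lambda>T. S - T" and j = "\<lambda>T. S - T"])
      (auto simp: double_diff)
  also have "\<dots> = (\<Sum>T\<in>Pow S. (if p \<and> q then -1 else 1) *
      (shuffle_sign T (S - T) * gcoeff f T * gcoeff g (S - T)))"
  proof (rule sum.cong [OF refl])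
    fix T
    show "shuffle_sign (S - T) T * gcoeff g (S - T) * gcoeff f T =
        (if p \<and> q then -1 else 1) * (shuffle_sign T (S - T) * gcoeff f T * gcoeff g (S - T))"
    proof (cases "odd (card T) = p \<and> odd (card (S - T)) = q")
      case True
      then have "(-1 :: complex) ^ (card T * card (S - T)) = (if p \<and> q then -1 else 1)"
        by (auto simp: minus_one_power_iff)
      then show ?thesis
        using shuffle_sign_swap [of T "S - T"] by auto
    next
      case False
      then show ?thesis using f0 g0 by auto
    qed
  qed
  also have "\<dots> = gcoeff (if p \<and> q then - (f * g) else f * g) S"
    by (simp add: gcoeff_mult sum_negf)
  finally show "gcoeff (g * f) S = gcoeff (if p \<and> q then - (f * g) else f * g) S" .
qed

lemma g_part_mult:
  assumes f: "g_part p f = f" and g: "g_part q g = g"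
  shows "g_part (p \<noteq> q) (f * g) = f * g"
proof (rule grassmann_eqI)
  fix S :: "4 set"
  have f0: "gcoeff f T = 0" if "odd (card T) \<noteq> p" for T
    using arg_cong [OF f, of "\<lambda>h. gcoeff h T"] that by (simp split: if_splits)
  have g0: "gcoeff g T = 0" if "odd (card T) \<noteq> q" for T
    using arg_cong [OF g, of "\<lambda>h. gcoeff h T"] that by (simp split: if_splits)
  have "gcoeff (f * g) S = 0" if "odd (card S) \<noteq> (p \<noteq> q)"
    unfolding gcoeff_mult
  proof (rule sum.neutral, rule ballI)
    fix T assume "T \<in> Pow S"
    then have "card S = card T + card (S - T)"
      by (metis PowD card_Diff_subset card_mono finite le_add_diff_inverse)
    then have "odd (card T) \<noteq> p \<or> odd (card (S - T)) \<noteq> q"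
      using that by auto
    then show "shuffle_sign T (S - T) * gcoeff f T * gcoeff g (S - T) = 0"
      using f0 g0 by auto
  qed
  then show "gcoeff (g_part (p \<noteq> q) (f * g)) S = gcoeff (f * g) S"
    by auto
qed

lemma g_deriv_add: "g_deriv j (f + g) = g_deriv j f + g_deriv j g"
  by (rule grassmann_eqI) (simp add: g_deriv.rep_eq algebra_simps)

lemma g_deriv_shuffle_sign:
  "gcoeff (g_deriv j g) S = (if j \<in> S then 0 else shuffle_sign {j} S * gcoeff g (insert j S))"
  by (simp add: g_deriv.rep_eq shuffle_sign_def)

lemma sum_Pow_insert:
  assumes "j \<notin> S" "finite S"
  shows "sum h (Pow (insert j S)) = sum h (Pow S) + (\<Sum>T\<in>Pow S. h (insert j T))"
proof -
  have "inj_on (insert j) (Pow S)"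
    using assms by (auto simp: inj_on_def)
  then show ?thesis
    unfolding Pow_insert using assms
    by (subst sum.union_disjoint) (auto simp: sum.reindex)
qed

text \<open>The sign arises from moving j past a set U: this costs (-1)^|U|, which is the parity
  sign of f whenever f has a nonzero coefficient at U.\<close>

lemma g_deriv_mult:
  assumes f: "g_part p f = f"
  shows "g_deriv j (f * g) = g_deriv j f * g + (if p then - (f * g_deriv j g) else f * g_deriv j g)"
    (is "_ = _ + ?h")
proof (rule grassmann_eqI)
  fix S
  let ?s = shuffle_sign
  let ?f = "gcoeff f" and ?g = "gcoeff g" and ?e = "if p then -1 else 1 :: complex"
  have f0: "?f T = 0" if "odd (card T) \<noteq> p" for T
    using arg_cong [OF f, of "\<lambda>h. gcoeff h T"] that by (simp split: if_splits)
  have h: "gcoeff ?h S = (\<Sum>T\<in>Pow S. ?s T (S - T) * (?e * ?f T) * gcoeff (g_deriv j g) (S - T))" for S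
    by (simp add: gcoeff_mult sum_negf)
  have swap: "?s U {j} * ?f U = ?e * ?s {j} U * ?f U" if "j \<notin> U" for U
  proof (cases "?f U = 0")
    case False
    then have "odd (card U) = p" using f0 by blast
    then show ?thesis using shuffle_sign_swap [of "{j}" U] that by (auto simp: minus_one_power_iff)
  qed simp
  \<comment> \<open>The rearrangement behind fact \<open>1\<close> below, with the signs as abstract
    factors: the sign B of j against U occurs twice and cancels.\<close>
  have alg: "A * (D * x * y) = F * (e * x) * (C * y)"
    if "A = B * C" "D = E * F" "E * x = e * B * x" "B * B = 1" for A B C D E F e x y :: complex
  proof -
    have "A * (D * x * y) = B * C * F * (E * x) * y" by (simp add: that(1,2))
    also have "\<dots> = (B * B) * (F * (e * x) * (C * y))" by (simp add: that(3))
    finally show ?thesis by (simp add: that(4))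
  qed
  show "gcoeff (g_deriv j (f * g)) S = gcoeff (g_deriv j f * g + ?h) S"
  proof (cases "j \<in> S")
    case False
    \<comment> \<open>The subsets of \<open>insert j S\<close> that index f are split by whether
      they contain j: fact \<open>1\<close> treats those without j, where the derivative falls on g,
      and fact \<open>2\<close> those with j, where it falls on f.\<close>
    have 1: "?s {j} S * (?s U (insert j S - U) * ?f U * ?g (insert j S - U)) =
        ?s U (S - U) * (?e * ?f U) * gcoeff (g_deriv j g) (S - U)" if "U \<subseteq> S" for U
    proof -
      have j: "j \<notin> U" using that False by auto
      have *: "insert j S - U = {j} \<union> (S - U)" "S = U \<union> (S - U)" using that False by auto
      have "?s {j} S = ?s {j} U * ?s {j} (S - U)"
        using shuffle_sign_union(2) [of U "S - U" "{j}"] *(2) by auto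
      moreover have "?s U (insert j S - U) = ?s U {j} * ?s U (S - U)"
        unfolding *(1) using False by (intro shuffle_sign_union(2)) auto
      ultimately have "?s {j} S * (?s U (insert j S - U) * ?f U * ?g (insert j S - U)) =
        ?s U (S - U) * (?e * ?f U) * (?s {j} (S - U) * ?g (insert j S - U))"
        using swap [OF j] shuffle_sign_square [of "{j}" U] by (rule alg)
      then show ?thesis
        using False *(1) that by (simp add: g_deriv_shuffle_sign subset_iff)
    qed
    have 2: "?s {j} S * (?s (insert j U) (insert j S - insert j U) * ?f (insert j U) * ?g (insert j S - insert j U)) =
        ?s U (S - U) * gcoeff (g_deriv j f) U * ?g (S - U)" if "U \<subseteq> S" for U
    proof -
      have j: "j \<notin> U" using that False by auto
      have *: "insert j S - insert j U = S - U" "S = U \<union> (S - U)" using that False by auto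
      have "?s {j} S = ?s {j} U * ?s {j} (S - U)"
        using shuffle_sign_union(2) [of U "S - U" "{j}"] *(2) by auto
      moreover have "?s (insert j U) (S - U) = ?s {j} (S - U) * ?s U (S - U)"
        using shuffle_sign_union(1) [of "{j}" U "S - U"] j by auto
      ultimately have "?s {j} S * (?s (insert j U) (insert j S - insert j U) * ?f (insert j U) * ?g (insert j S - insert j U)) =
        ?s {j} U * (?s {j} (S - U) * ?s {j} (S - U)) * ?s U (S - U) * ?f (insert j U) * ?g (S - U)"
        by (simp only: *(1) mult_ac)
      then show ?thesis
        using j by (simp add: g_deriv_shuffle_sign shuffle_sign_square mult_ac)
    qed
    have "gcoeff (g_deriv j (f * g)) S = ?s {j} S * gcoeff (f * g) (insert j S)"
      using False by (simp add: g_deriv_shuffle_sign)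
    also have "\<dots> = (\<Sum>U\<in>Pow S. ?s {j} S * (?s U (insert j S - U) * ?f U * ?g (insert j S - U))) +
       (\<Sum>U\<in>Pow S. ?s {j} S * (?s (insert j U) (insert j S - insert j U) * ?f (insert j U) * ?g (insert j S - insert j U)))"
      unfolding gcoeff_mult using False
      by (subst sum_Pow_insert) (auto simp: sum_distrib_left distrib_left)
    also have "\<dots> = gcoeff ?h S + gcoeff (g_deriv j f * g) S"
      unfolding h gcoeff_mult [of "g_deriv j f"]
      by (intro arg_cong2 [where f = "(+)"] sum.cong refl 1 2) auto
    finally show ?thesis by (simp add: add.commute)
  next
    case True
    \<comment> \<open>Now the left side has coefficient zero at S. On the right, the term of U in
      the first product cancels the term of \<open>insert j U\<close> in the second.\<close>
    define S' where "S' = S - {j}"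
    have S: "S = insert j S'" "j \<notin> S'" using True by (auto simp: S'_def)
    have "gcoeff (g_deriv j f * g) S = (\<Sum>U\<in>Pow S'. ?s U (S - U) * gcoeff (g_deriv j f) U * ?g (S - U))"
      unfolding gcoeff_mult S(1) using S(2)
      by (subst sum_Pow_insert) (auto simp: g_deriv_shuffle_sign)
    moreover have "gcoeff ?h S =
       (\<Sum>U\<in>Pow S'. ?s (insert j U) (S - insert j U) * (?e * ?f (insert j U)) * gcoeff (g_deriv j g) (S - insert j U))"
      unfolding h S(1) using S(2)
      by (subst sum_Pow_insert) (auto simp: g_deriv_shuffle_sign intro!: sum.neutral)
    moreover have "?s U (S - U) * gcoeff (g_deriv j f) U * ?g (S - U) +
       ?s (insert j U) (S - insert j U) * (?e * ?f (insert j U)) * gcoeff (g_deriv j g) (S - insert j U) = 0"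
      if "U \<subseteq> S'" for U
    proof -
      let ?W = "S' - U"
      have j: "j \<notin> U" "j \<notin> ?W" using that S by auto
      have W: "S - insert j U = ?W" "S - U = insert j ?W" using that S by auto
      have s1: "?s (insert j U) ?W = ?s {j} ?W * ?s U ?W"
        using shuffle_sign_union(1) [of "{j}" U ?W] j by auto
      have s2: "?s U (insert j ?W) = ?s U {j} * ?s U ?W"
        using shuffle_sign_union(2) [of "{j}" ?W U] j by auto
      have s3: "?s U {j} * ?f (insert j U) = - ?e * ?s {j} U * ?f (insert j U)"
      proof (cases "?f (insert j U) = 0")
        case False
        then have "odd (card (insert j U)) = p" using f0 by blast
        then show ?thesis using shuffle_sign_swap [of "{j}" U] j by (auto simp: minus_one_power_iff)
      qed simp
      have "?s U (S - U) * gcoeff (g_deriv j f) U * ?g (S - U) =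
          (?s {j} U * ?s U ?W * ?g (insert j ?W)) * (?s U {j} * ?f (insert j U))"
        using j by (simp add: g_deriv_shuffle_sign W s2)
      also have "\<dots> = (?s {j} U * ?s {j} U) * - (?e * ?f (insert j U) * ?s U ?W * ?g (insert j ?W))"
        by (simp add: s3)
      also have "\<dots> = - ((?s {j} ?W * ?s {j} ?W) * ?s U ?W * (?e * ?f (insert j U)) * ?g (insert j ?W))"
        by (simp add: shuffle_sign_square)
      also have "\<dots> = - (?s (insert j U) (S - insert j U) * (?e * ?f (insert j U)) * gcoeff (g_deriv j g) (S - insert j U))"
        using j by (simp add: g_deriv_shuffle_sign W s1)
      finally show ?thesis by simp
    qed
    ultimately have "gcoeff (g_deriv j f * g) S + gcoeff ?h S = 0"
      by (simp add: sum.neutral flip: sum.distrib)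
    then show ?thesis using True by (simp add: g_deriv_shuffle_sign)
  qed
qed

section \<open>Partial derivatives of holomorphic functions of three variables\<close>

text \<open>\<open>has_derivative\<close> is only real linear over the complex numbers; prescribing
  the derivative by a complex gradient makes it complex linear and so expresses holomorphy. This is
  the condition that \<open>superfunctions\<close> puts on each coefficient.\<close>

definition entire3 :: "(complex^3 \<Rightarrow> complex) \<Rightarrow> bool" where
  "entire3 f \<longleftrightarrow> (\<forall>p. \<exists>c::complex^3. (f has_derivative (\<lambda>h. \<Sum>i\<in>UNIV. c $ i * h $ i)) (at p))"

definition upd3 :: "complex^3 \<Rightarrow> 3 \<Rightarrow> complex \<Rightarrow> complex^3" where
  "upd3 p i t = (\<chi> l. if l = i then t else p $ l)"

definition partial3 :: "3 \<Rightarrow> (complex^3 \<Rightarrow> complex) \<Rightarrow> complex^3 \<Rightarrow> complex" where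
  "partial3 i f p = deriv (\<lambda>t. f (upd3 p i t)) (p $ i)"

lemma upd3_axis: "upd3 p i t = p + axis i (t - p $ i)"
  by (simp add: upd3_def vec_eq_iff axis_def)

lemma entire3_const [intro]: "entire3 (\<lambda>p. c)"
  unfolding entire3_def by (intro allI exI [of _ 0]) simp

lemma entire3_nth [intro]: "entire3 (\<lambda>p. p $ i)"
proof -
  have "(\<lambda>h. \<Sum>l\<in>UNIV. axis i 1 $ l * h $ l) = (\<lambda>h :: complex^3. h $ i)"
    by (simp add: axis_def if_distrib [of "\<lambda>x. x * _"] cong: if_cong)
  then show ?thesis
    unfolding entire3_def
    by (intro allI exI [of _ "axis i 1"]) (simp add: bounded_linear_vec_nth bounded_linear_imp_has_derivative)
qed

lemma entire3_add [intro]: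
  assumes "entire3 f" "entire3 g"
  shows "entire3 (\<lambda>p. f p + g p)"
  unfolding entire3_def
proof
  fix p
  obtain c d :: "complex^3" where
    "(f has_derivative (\<lambda>h. \<Sum>i\<in>UNIV. c $ i * h $ i)) (at p)"
    "(g has_derivative (\<lambda>h. \<Sum>i\<in>UNIV. d $ i * h $ i)) (at p)"
    using assms unfolding entire3_def by blast
  from has_derivative_add [OF this]
  show "\<exists>c::complex^3. ((\<lambda>p. f p + g p) has_derivative (\<lambda>h. \<Sum>i\<in>UNIV. c $ i * h $ i)) (at p)"
    by (intro exI [of _ "c + d"]) (simp add: algebra_simps sum.distrib)
qed

lemma entire3_mult [intro]:
  assumes "entire3 f" "entire3 g"
  shows "entire3 (\<lambda>p. f p * g p)"
  unfolding entire3_def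
proof
  fix p
  obtain c d :: "complex^3" where
    "(f has_derivative (\<lambda>h. \<Sum>i\<in>UNIV. c $ i * h $ i)) (at p)"
    "(g has_derivative (\<lambda>h. \<Sum>i\<in>UNIV. d $ i * h $ i)) (at p)"
    using assms unfolding entire3_def by blast
  from has_derivative_mult [OF this]
  show "\<exists>c::complex^3. ((\<lambda>p. f p * g p) has_derivative (\<lambda>h. \<Sum>i\<in>UNIV. c $ i * h $ i)) (at p)"
    by (intro exI [of _ "\<chi> i. f p * d $ i + c $ i * g p"])
      (simp add: algebra_simps sum.distrib sum_distrib_left)
qed

lemma entire3_sum [intro]: "(\<And>x. x \<in> X \<Longrightarrow> entire3 (f x)) \<Longrightarrow> entire3 (\<lambda>p. \<Sum>x\<in>X. f x p)"
  by (induction X rule: infinite_finite_induct) auto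

lemma entire3_cmult: "entire3 f \<Longrightarrow> entire3 (\<lambda>p. c * f p)"
  by (rule entire3_mult [OF entire3_const])

lemma entire3_DERIV:
  assumes f: "(f has_derivative (\<lambda>h. \<Sum>j\<in>UNIV. c $ j * h $ j)) (at (upd3 p i t))"
  shows "((\<lambda>t. f (upd3 p i t)) has_field_derivative c $ i) (at t)"
proof -
  have "bounded_linear (axis i :: complex \<Rightarrow> complex^3)"
    by (intro linear_conv_bounded_linear [THEN iffD1] linearI) (auto simp: axis_def vec_eq_iff)
  then have "((\<lambda>t. p + (axis i t - axis i (p $ i))) has_derivative (\<lambda>t. 0 + (axis i t - 0))) (at t)"
    by (intro has_derivative_add has_derivative_diff has_derivative_const bounded_linear_imp_has_derivative)
  moreover have "(\<lambda>t. p + (axis i t - axis i (p $ i))) = upd3 p i"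
    by (simp add: fun_eq_iff vec_eq_iff upd3_def axis_def)
  ultimately have "(upd3 p i has_derivative axis i) (at t)" by simp
  from has_derivative_compose [OF this f]
  have "((\<lambda>t. f (upd3 p i t)) has_derivative (\<lambda>h. \<Sum>j\<in>UNIV. c $ j * axis i h $ j)) (at t)" .
  moreover have "(\<lambda>h. \<Sum>j\<in>UNIV. c $ j * axis i h $ j) = (*) (c $ i)"
    by (simp add: axis_def if_distrib [of "\<lambda>x. _ * x"] cong: if_cong)
  ultimately show ?thesis by (simp add: has_field_derivative_def)
qed

lemma upd3_nth [simp]: "upd3 p i (p $ i) = p"
  by (simp add: upd3_def vec_eq_iff)

lemma partial3_DERIV:
  assumes "entire3 f"
  shows "((\<lambda>t. f (upd3 p i t)) has_field_derivative partial3 i f p) (at (p $ i))"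
proof -
  obtain c :: "complex^3" where "(f has_derivative (\<lambda>h. \<Sum>j\<in>UNIV. c $ j * h $ j)) (at (upd3 p i (p $ i)))"
    using assms unfolding entire3_def by blast
  from entire3_DERIV [OF this] show ?thesis
    by (simp add: partial3_def DERIV_imp_deriv)
qed

lemma entire3_has_derivative:
  assumes "entire3 f"
  shows "(f has_derivative (\<lambda>h. \<Sum>j\<in>UNIV. partial3 j f p * h $ j)) (at p)"
proof -
  obtain c :: "complex^3" where c: "(f has_derivative (\<lambda>h. \<Sum>j\<in>UNIV. c $ j * h $ j)) (at p)"
    using assms unfolding entire3_def by blast
  have "partial3 j f p = c $ j" for j
    using entire3_DERIV [of f c p j "p $ j"] c
    by (simp add: partial3_def DERIV_imp_deriv)
  then show ?thesis using c by simp
qed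

lemma entire3_holomorphic:
  assumes "entire3 f"
  shows "(\<lambda>t. f (upd3 p i t)) holomorphic_on S"
  unfolding holomorphic_on_def
proof
  fix t
  obtain c :: "complex^3" where "(f has_derivative (\<lambda>h. \<Sum>j\<in>UNIV. c $ j * h $ j)) (at (upd3 p i t))"
    using assms unfolding entire3_def by blast
  from entire3_DERIV [OF this]
  show "(\<lambda>t. f (upd3 p i t)) field_differentiable (at t within S)"
    using has_field_derivative_at_within field_differentiable_def by blast
qed

lemma entire3_continuous_on: "entire3 f \<Longrightarrow> continuous_on S f"
  using entire3_has_derivative has_derivative_continuous
  by (blast intro: continuous_at_imp_continuous_on)

text \<open>Cauchy's formula for the first derivative on the unit circle about \<open>p $ i\<close>;
  one power of the denominator cancels against the derivative of the path. The interval of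
  integration does not depend on p, so this is a parameter integral to which the theorems on
  continuity and differentiation under the integral apply.\<close>

lemma partial3_integral:
  assumes f: "entire3 f"
  shows "((\<lambda>t. f (p + axis i (cis (2 * pi * t))) / cis (2 * pi * t)) has_integral partial3 i f p) (cbox 0 1)"
proof -
  let ?g = "\<lambda>z. f (upd3 p i z)"
  have hol: "?g holomorphic_on S" for S by (rule entire3_holomorphic [OF f])
  have "((\<lambda>u. ?g u / (u - p $ i) ^ Suc 1) has_contour_integral
      ((2 * pi * \<i>) / fact 1 * (deriv ^^ 1) ?g (p $ i))) (circlepath (p $ i) 1)"
    by (rule Cauchy_has_contour_integral_higher_derivative_circlepath)
      (auto intro: hol holomorphic_on_imp_continuous_on)
  then have "((\<lambda>t. ?g (circlepath (p $ i) 1 t) / (circlepath (p $ i) 1 t - p $ i) ^ 2 *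
      (2 * pi * \<i> * exp (2 * of_real pi * \<i> * t))) has_integral (2 * pi * \<i> * partial3 i f p)) {0..1}"
    unfolding has_contour_integral_def
    by (rule has_integral_eq_rhs [OF has_integral_eq, rotated])
      (auto simp: partial3_def vector_derivative_circlepath01 power2_eq_square)
  then have "((\<lambda>t. inverse (2 * pi * \<i>) * (?g (circlepath (p $ i) 1 t) / (circlepath (p $ i) 1 t - p $ i) ^ 2 *
      (2 * pi * \<i> * exp (2 * of_real pi * \<i> * t)))) has_integral
      (inverse (2 * pi * \<i>) * (2 * pi * \<i> * partial3 i f p))) {0..1}"
    by (rule has_integral_mult_right)
  moreover have "inverse (2 * pi * \<i>) * (?g (circlepath (p $ i) 1 t) / (circlepath (p $ i) 1 t - p $ i) ^ 2 *
      (2 * pi * \<i> * exp (2 * of_real pi * \<i> * t))) = f (p + axis i (cis (2 * pi * t))) / cis (2 * pi * t)" for t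
    by (simp add: circlepath upd3_axis cis_conv_exp power2_eq_square field_simps)
  moreover have "inverse (2 * pi * \<i>) * (2 * pi * \<i> * partial3 i f p) = partial3 i f p"
    by (simp add: field_simps)
  ultimately show ?thesis by (simp only: cbox_interval)
qed

lemma continuous_on_axis [continuous_intros]:
  "continuous_on S g \<Longrightarrow> continuous_on S (\<lambda>x. axis i (g x :: complex) :: complex^3)"
  unfolding continuous_on_componentwise axis_def
  by (intro continuous_on_vec_lambda, rename_tac l, case_tac "l = i") auto

lemma continuous_on_entire3_shift:
  assumes "continuous_on UNIV g"
  shows "continuous_on S (\<lambda>(p, t :: real). g (p + axis i (cis (2 * pi * t)) :: complex^3) / cis (2 * pi * t) :: complex)"
proof -
  have "continuous_on S (\<lambda>x. g (fst x + axis i (cis (2 * pi * snd x))) / cis (2 * pi * snd x))"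
    by (intro continuous_intros continuous_on_compose2 [OF assms]) auto
  then show ?thesis by (simp add: case_prod_unfold)
qed

text \<open>The integral formula needs only continuity of f itself. The result provides the
  continuity of the differentiated integrand that the Leibniz rule demands in
  \<open>entire3_partial3\<close>.\<close>

lemma continuous_on_partial3:
  assumes "entire3 f"
  shows "continuous_on UNIV (partial3 i f)"
proof -
  have "partial3 i f = (\<lambda>p. integral (cbox 0 1) (\<lambda>t. f (p + axis i (cis (2 * pi * t))) / cis (2 * pi * t)))"
    by (rule ext) (rule integral_unique [OF partial3_integral [OF assms], symmetric])
  then show ?thesis
    by (simp only:) (intro integral_continuous_on_param continuous_on_entire3_shift
        entire3_continuous_on assms)
qed

definition blinfun_coord :: "3 \<Rightarrow> ((complex^3) \<Rightarrow>\<^sub>L complex)" where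
  "blinfun_coord j = Blinfun (\<lambda>h. h $ j)"

lemma blinfun_coord_apply [simp]: "blinfun_apply (blinfun_coord j) h = h $ j"
  by (simp add: blinfun_coord_def bounded_linear_Blinfun_apply bounded_linear_vec_nth)

lemma sum_mult_axis: "(\<Sum>l\<in>UNIV. c l * axis j 1 $ l) = (c j :: complex)"
  by (simp add: axis_def if_distrib [of "\<lambda>x. _ * x"] cong: if_cong)

text \<open>Differentiation under the integral sign in \<open>partial3_integral\<close>. The Leibniz
  rule yields an integral of real bounded linear maps, from which the complex gradient has to be
  recovered.\<close>

lemma entire3_partial3:
  assumes "entire3 f"
  shows "entire3 (partial3 i f)"
  unfolding entire3_def
proof
  fix p
  let ?e = "\<lambda>t. cis (2 * pi * t)"
  \<comment> \<open>The derivative of the integrand with respect to p, packed as a bounded linear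
    map so that it can be integrated over t.\<close>
  define F where "F p t = (\<Sum>j\<in>UNIV. blinfun_mult_right (partial3 j f (p + axis i (?e t)) / ?e t) o\<^sub>L blinfun_coord j)"
    for p :: "complex^3" and t :: real
  have F: "((\<lambda>p. f (p + axis i (?e t)) / ?e t) has_derivative blinfun_apply (F p t)) (at p within UNIV)" for p t
  proof -
    have "((\<lambda>p. f (p + axis i (?e t))) has_derivative
        (\<lambda>h. \<Sum>j\<in>UNIV. partial3 j f (p + axis i (?e t)) * h $ j)) (at p)"
      by (rule has_derivative_compose [OF _ entire3_has_derivative [OF assms], of "\<lambda>p. p + axis i (?e t)" "\<lambda>h. h"])
        (auto intro!: derivative_eq_intros)
    from has_derivative_mult_left [OF this, of "inverse (?e t)"]
    have "((\<lambda>p. f (p + axis i (?e t)) * inverse (?e t)) has_derivative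
        (\<lambda>h. (\<Sum>j\<in>UNIV. partial3 j f (p + axis i (?e t)) * h $ j) * inverse (?e t))) (at p)" .
    moreover have "blinfun_apply (F p t) = (\<lambda>h. (\<Sum>j\<in>UNIV. partial3 j f (p + axis i (?e t)) * h $ j) * inverse (?e t))"
      by (rule ext) (simp add: F_def blinfun.sum_left sum_distrib_left sum_distrib_right divide_inverse mult_ac)
    ultimately show ?thesis by (simp add: divide_inverse)
  qed
  have contF: "continuous_on (UNIV \<times> cbox 0 1) (\<lambda>(p, t). F p t)"
  proof -
    have 1: "continuous_on (UNIV \<times> cbox 0 1) (\<lambda>x. case x of (p, t) \<Rightarrow> partial3 j f (p + axis i (?e t)) / ?e t)" for j
      by (intro continuous_on_entire3_shift continuous_on_partial3 assms)
    have "continuous_on (UNIV \<times> cbox 0 1) (\<lambda>x. \<Sum>j\<in>UNIV. blinfun_mult_right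
        (case x of (p, t) \<Rightarrow> partial3 j f (p + axis i (?e t)) / ?e t) o\<^sub>L blinfun_coord j)"
      by (intro continuous_intros bounded_linear.continuous_on [OF bounded_linear_blinfun_mult_right] 1
          bounded_bilinear.continuous_on [OF bounded_bilinear_blinfun_compose])
    then show ?thesis by (simp add: F_def case_prod_unfold)
  qed
  have "((\<lambda>p. integral (cbox 0 1) (\<lambda>t. f (p + axis i (?e t)) / ?e t)) has_derivative
      blinfun_apply (integral (cbox 0 1) (F p))) (at p within UNIV)"
    by (rule leibniz_rule [OF F has_integral_integrable [OF partial3_integral [OF assms]] contF]) auto
  moreover have "(\<lambda>p. integral (cbox 0 1) (\<lambda>t. f (p + axis i (?e t)) / ?e t)) = partial3 i f"
    by (rule ext) (rule integral_unique [OF partial3_integral [OF assms]])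
  \<comment> \<open>Evaluation at a vector commutes with the integral. Each \<open>F p t\<close> is
    determined complex linearly by its values on the unit vectors, and the integral inherits
    this.\<close>
  moreover have "blinfun_apply (integral (cbox 0 1) (F p)) =
      (\<lambda>h. \<Sum>j\<in>UNIV. (\<chi> j. blinfun_apply (integral (cbox 0 1) (F p)) (axis j 1)) $ j * h $ j)"
  proof (rule ext)
    fix h
    have "continuous_on (cbox 0 1) (F p)"
    proof -
      have "continuous_on (cbox 0 1) (\<lambda>t :: real. (p, t))" by (intro continuous_intros)
      from continuous_on_compose2 [OF contF this] show ?thesis by auto
    qed
    then have int: "F p integrable_on cbox 0 1" by (rule integrable_continuous)
    have ap: "blinfun_apply (integral (cbox 0 1) (F p)) v = integral (cbox 0 1) (\<lambda>t. blinfun_apply (F p t) v)"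
      and iv: "(\<lambda>t. blinfun_apply (F p t) v) integrable_on cbox 0 1" for v
      using integral_linear [OF int blinfun.bounded_linear_left, of v]
        integrable_linear [OF int blinfun.bounded_linear_left, of v] by (simp_all add: o_def)
    have 2: "blinfun_apply (F p t) h = (\<Sum>j\<in>UNIV. blinfun_apply (F p t) (axis j 1) * h $ j)" for t
    proof -
      have "blinfun_apply (F p t) v = (\<Sum>j\<in>UNIV. partial3 j f (p + axis i (?e t)) / ?e t * v $ j)" for v
        by (simp add: F_def blinfun.sum_left)
      then show ?thesis by (simp only: sum_mult_axis)
    qed
    have "blinfun_apply (integral (cbox 0 1) (F p)) h =
        integral (cbox 0 1) (\<lambda>t. \<Sum>j\<in>UNIV. blinfun_apply (F p t) (axis j 1) * h $ j)"
      unfolding ap [of h] 2 ..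
    also have "\<dots> = (\<Sum>j\<in>UNIV. integral (cbox 0 1) (\<lambda>t. blinfun_apply (F p t) (axis j 1) * h $ j))"
      by (rule integral_sum [OF finite integrable_on_mult_left [OF iv]])
    also have "\<dots> = (\<Sum>j\<in>UNIV. integral (cbox 0 1) (\<lambda>t. blinfun_apply (F p t) (axis j 1)) * h $ j)"
      by (rule sum.cong [OF refl integral_mult_left])
    finally show "blinfun_apply (integral (cbox 0 1) (F p)) h =
       (\<Sum>j\<in>UNIV. (\<chi> j. blinfun_apply (integral (cbox 0 1) (F p)) (axis j 1)) $ j * h $ j)"
      by (simp only: ap vec_lambda_beta)
  qed
  ultimately have "(partial3 i f has_derivative
      (\<lambda>h. \<Sum>j\<in>UNIV. (\<chi> j. blinfun_apply (integral (cbox 0 1) (F p)) (axis j 1)) $ j * h $ j)) (at p)"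
    by (simp only:)
  then show "\<exists>c::complex^3. (partial3 i f has_derivative (\<lambda>h. \<Sum>j\<in>UNIV. c $ j * h $ j)) (at p)"
    by (rule exI)
qed

section \<open>Superfunctions\<close>

lemma superfunctions_iff: "F \<in> superfunctions \<longleftrightarrow> (\<forall>S. entire3 (\<lambda>q. gcoeff (F q) S))"
  by (auto simp: superfunctions_def entire3_def)

lemma gcoeff_pd_Inl: "gcoeff (pd (Inl i) F p) S = partial3 i (\<lambda>q. gcoeff (F q) S) p"
  by (simp add: partial3_def upd3_def)

lemma sf_const: "(\<lambda>p. g) \<in> superfunctions"
  by (simp add: superfunctions_iff entire3_const)

lemma cst_superfunction [simp]: "cst c \<in> superfunctions"
  unfolding cst_def by (rule sf_const)

lemma xi_superfunction [simp]: "\<xi> j \<in> superfunctions"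
  unfolding \<xi>_def by (rule sf_const)

lemma xc_superfunction [simp]: "xc i \<in> superfunctions"
proof -
  have "entire3 (\<lambda>q. if S = {} then q $ i else 0)" for S :: "4 set"
    by (cases "S = {}") auto
  then show ?thesis by (simp add: superfunctions_iff xc_def)
qed

lemma sf_add [intro]: "F \<in> superfunctions \<Longrightarrow> G \<in> superfunctions \<Longrightarrow> F + G \<in> superfunctions"
  by (auto simp: superfunctions_iff)

lemma sf_mult [intro]: "F \<in> superfunctions \<Longrightarrow> G \<in> superfunctions \<Longrightarrow> F * G \<in> superfunctions"
  unfolding superfunctions_iff times_fun_def gcoeff_mult
  by (intro allI entire3_sum entire3_mult entire3_const) auto

lemma sf_zero [simp]: "0 \<in> superfunctions"
  unfolding zero_fun_def by (rule sf_const)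

lemma sf_one [simp]: "1 \<in> superfunctions"
  unfolding one_fun_def by (rule sf_const)

lemma sf_minus_iff [simp]: "- F \<in> superfunctions \<longleftrightarrow> F \<in> superfunctions"
proof -
  have "- F \<in> superfunctions" if "F \<in> superfunctions" for F
    using sf_mult [OF sf_const [of "-1"] that] by (simp add: times_fun_def fun_Compl_def)
  from this [of F] this [of "- F"] show ?thesis by auto
qed

lemma sf_diff [intro]: "F \<in> superfunctions \<Longrightarrow> G \<in> superfunctions \<Longrightarrow> F - G \<in> superfunctions"
  using sf_add [of F "- G"] by simp

lemma sf_sum [intro]: "(\<And>x. x \<in> X \<Longrightarrow> F x \<in> superfunctions) \<Longrightarrow> sum F X \<in> superfunctions"
  by (induction X rule: infinite_finite_induct) auto

lemma sf_pd [intro]: "F \<in> superfunctions \<Longrightarrow> pd k F \<in> superfunctions"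
proof (cases k)
  case (Inl i)
  assume "F \<in> superfunctions"
  then show ?thesis
    unfolding superfunctions_iff Inl gcoeff_pd_Inl by (auto intro: entire3_partial3)
next
  case (Inr j)
  assume F: "F \<in> superfunctions"
  have "entire3 (\<lambda>q. gcoeff (pd k F q) S)" for S
    using F by (cases "j \<in> S") (auto simp: superfunctions_iff Inr g_deriv_shuffle_sign intro: entire3_cmult)
  then show ?thesis by (simp add: superfunctions_iff)
qed

definition sf_part :: "bool \<Rightarrow> sfun \<Rightarrow> sfun" where
  "sf_part p F = (\<lambda>q. g_part p (F q))"

lemma sf_part_superfunction [intro]: "F \<in> superfunctions \<Longrightarrow> sf_part p F \<in> superfunctions"
  unfolding superfunctions_iff
proof
  fix S assume "\<forall>S. entire3 (\<lambda>q. gcoeff (F q) S)"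
  then show "entire3 (\<lambda>q. gcoeff (sf_part p F q) S)"
    by (cases "odd (card S) = p") (auto simp: sf_part_def)
qed

lemma sf_part_add: "sf_part p (F + G) = sf_part p F + sf_part p G"
  by (rule ext, rule grassmann_eqI) (simp add: sf_part_def)

lemma sf_part_zero [simp]: "sf_part p 0 = 0"
  by (rule ext, rule grassmann_eqI) (simp add: sf_part_def)

lemma sf_part_sf_part: "sf_part p (sf_part q F) = (if p = q then sf_part p F else 0)"
  by (rule ext, rule grassmann_eqI) (simp add: sf_part_def)

lemma sf_part_decompose: "F = sf_part False F + sf_part True F"
  by (rule ext, rule grassmann_eqI) (simp add: sf_part_def)

abbreviation homog :: "bool \<Rightarrow> sfun \<Rightarrow> bool" where
  "homog p F \<equiv> sf_part p F = F"

abbreviation sgn_if :: "bool \<Rightarrow> 'a::ring_1" where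
  "sgn_if b \<equiv> (if b then -1 else 1)"

lemma homog_iff: "homog p F \<longleftrightarrow> (\<forall>q. g_part p (F q) = F q)"
  by (auto simp: sf_part_def fun_eq_iff)

lemma homog_supercommute:
  "homog p F \<Longrightarrow> homog q G \<Longrightarrow> G * F = sgn_if (p \<and> q) * (F * G)"
  unfolding homog_iff by (rule ext) (simp add: grassmann_supercommute [of p _ q])

lemma homog_mult: "homog p F \<Longrightarrow> homog q G \<Longrightarrow> homog (p \<noteq> q) (F * G)"
  using g_part_mult unfolding homog_iff by simp

lemma homog_cst [simp]: "homog False (cst c)"
  by (auto simp: homog_iff cst_def intro!: grassmann_eqI)

lemma homog_xc [simp]: "homog False (xc i)"
  by (auto simp: homog_iff xc_def intro!: grassmann_eqI)

lemma homog_xi [simp]: "homog True (\<xi> j)"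
  by (auto simp: homog_iff \<xi>_def intro!: grassmann_eqI)

lemma gcoeff_cst_mult [simp]: "gcoeff ((cst c * F) p) S = c * gcoeff (F p) S"
proof -
  have "gcoeff ((cst c * F) p) S = (\<Sum>T\<in>{{} :: 4 set}. c * gcoeff (F p) S)"
    unfolding times_fun_def gcoeff_mult
    by (rule sum.mono_neutral_cong_right) (auto simp: cst_def shuffle_sign_def)
  then show ?thesis by simp
qed

lemma cst_add: "cst (c + d) = cst c + cst d"
  by (rule ext, rule grassmann_eqI) (simp add: cst_def)

lemma cst_minus: "cst (- c) = - cst c"
  by (rule ext, rule grassmann_eqI) (simp add: cst_def)

lemma cst_mult: "cst (c * d) = cst c * cst d"
  by (rule ext, rule grassmann_eqI) (simp only: gcoeff_cst_mult, simp add: cst_def)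

lemma cst_0 [simp]: "cst 0 = 0"
  by (rule ext, rule grassmann_eqI) (simp add: cst_def)

lemma cst_1 [simp]: "cst 1 = 1"
  by (rule ext, rule grassmann_eqI) (simp add: cst_def one_grassmann.rep_eq)

lemma cst_of_int: "cst (of_int n) = of_int n"
proof -
  have *: "cst (of_nat m) = of_nat m" for m by (induction m) (simp_all add: cst_add)
  show ?thesis by (cases n) (simp_all add: * cst_minus cst_add del: of_nat_Suc)
qed

text \<open>Supercommutation with an even factor has no sign for either parity of the other factor,
  so G may be split into its two parts.\<close>

lemma even_central:
  assumes "homog False F"
  shows "F * G = G * F"
proof -
  define G0 G1 where "G0 = sf_part False G" and "G1 = sf_part True G"
  then have "homog False G0" "homog True G1" by (simp_all add: sf_part_sf_part)
  then have "F * G0 = G0 * F" "F * G1 = G1 * F"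
    using homog_supercommute [OF _ assms] by force+
  moreover have "G = G0 + G1" unfolding G0_def G1_def by (rule sf_part_decompose)
  ultimately show ?thesis by (simp add: distrib_left distrib_right)
qed

lemma cst_commute: "F * cst c = cst c * F"
  by (rule even_central [OF homog_cst, symmetric])

lemma xi_square [simp]: "\<xi> j * \<xi> j = 0"
proof (rule ext, rule grassmann_eqI)
  fix p S
  have "\<xi> j * \<xi> j = - (\<xi> j * \<xi> j)"
    using homog_supercommute [of True "\<xi> j" True "\<xi> j"] by simp
  then have "gcoeff ((\<xi> j * \<xi> j) p) S = - gcoeff ((\<xi> j * \<xi> j) p) S"
    by (metis fun_Compl_def uminus_grassmann.rep_eq)
  then show "gcoeff ((\<xi> j * \<xi> j) p) S = gcoeff (0 p) S" by simp
qed

section \<open>Partial derivatives of superfunctions\<close>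

lemma pd_add:
  assumes "F \<in> superfunctions" "G \<in> superfunctions"
  shows "pd k (F + G) = pd k F + pd k G"
proof (cases k)
  case (Inl i)
  show ?thesis
  proof (rule ext, rule grassmann_eqI)
    fix p S
    have "((\<lambda>t. gcoeff (F (upd3 p i t)) S + gcoeff (G (upd3 p i t)) S) has_field_derivative
        partial3 i (\<lambda>q. gcoeff (F q) S) p + partial3 i (\<lambda>q. gcoeff (G q) S) p) (at (p $ i))"
      using assms by (intro DERIV_add) (auto simp: superfunctions_iff intro!: partial3_DERIV)
    then show "gcoeff (pd k (F + G) p) S = gcoeff ((pd k F + pd k G) p) S"
      by (simp add: Inl gcoeff_pd_Inl del: pd.simps) (simp add: partial3_def DERIV_imp_deriv)
  qed
next
  case (Inr j)
  then show ?thesis by (simp add: fun_eq_iff g_deriv_add)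
qed

text \<open>For an even coordinate this is the ordinary product rule in the coefficient sums, where
  holomorphy turns \<open>deriv\<close> into a true derivative. For an odd coordinate it is the
  algebraic rule \<open>g_deriv_mult\<close>.\<close>

lemma pd_mult:
  assumes F: "F \<in> superfunctions" "homog p F" and G: "G \<in> superfunctions"
  shows "pd k (F * G) = pd k F * G + sgn_if (coord_parity k \<and> p) * (F * pd k G)"
proof (cases k)
  case (Inl i)
  show ?thesis
  proof (rule ext, rule grassmann_eqI)
    fix q S
    let ?f = "\<lambda>T t. gcoeff (F (upd3 q i t)) T" and ?g = "\<lambda>T t. gcoeff (G (upd3 q i t)) T"
    have "((\<lambda>t. \<Sum>T\<in>Pow S. shuffle_sign T (S - T) * ?f T t * ?g (S - T) t) has_field_derivative
        (\<Sum>T\<in>Pow S. (shuffle_sign T (S - T) * partial3 i (\<lambda>q. gcoeff (F q) T) q) * gcoeff (G q) (S - T)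
          + partial3 i (\<lambda>q. gcoeff (G q) (S - T)) q * (shuffle_sign T (S - T) * gcoeff (F q) T))) (at (q $ i))"
    proof (intro DERIV_sum)
      fix T
      have "(?f T has_field_derivative partial3 i (\<lambda>q. gcoeff (F q) T) q) (at (q $ i))"
        "(?g (S - T) has_field_derivative partial3 i (\<lambda>q. gcoeff (G q) (S - T)) q) (at (q $ i))"
        using F G by (auto simp: superfunctions_iff intro!: partial3_DERIV)
      from DERIV_mult [OF DERIV_cmult [OF this(1)] this(2)]
      show "((\<lambda>t. shuffle_sign T (S - T) * ?f T t * ?g (S - T) t) has_field_derivative
          (shuffle_sign T (S - T) * partial3 i (\<lambda>q. gcoeff (F q) T) q) * gcoeff (G q) (S - T)
          + partial3 i (\<lambda>q. gcoeff (G q) (S - T)) q * (shuffle_sign T (S - T) * gcoeff (F q) T)) (at (q $ i))"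
        by simp
    qed
    from DERIV_imp_deriv [OF this]
    show "gcoeff (pd k (F * G) q) S =
        gcoeff ((pd k F * G + sgn_if (coord_parity k \<and> p) * (F * pd k G)) q) S"
      by (simp add: Inl gcoeff_pd_Inl gcoeff_mult del: pd.simps)
        (simp add: partial3_def gcoeff_mult sum.distrib mult_ac)
  qed
next
  case (Inr j)
  have "\<forall>q. g_part p (F q) = F q" using F(2) unfolding homog_iff .
  with Inr show ?thesis by (auto simp: fun_eq_iff g_deriv_mult [of p])
qed

lemma pd_cst [simp]: "pd k (cst c) = 0"
  by (cases k) (auto simp: fun_eq_iff cst_def g_deriv.rep_eq intro!: grassmann_eqI)

lemma pd_xc: "pd k (xc i) = (if k = Inl i then 1 else 0)"
proof (cases k)
  case (Inl l)
  have "partial3 l (\<lambda>q. if S = {} then q $ i else 0) p = (if S = {} \<and> l = i then 1 else 0)"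
    for S :: "4 set" and p
    by (cases "S = {}"; cases "l = i") (simp_all add: partial3_def upd3_def)
  then show ?thesis
    by (auto simp: Inl fun_eq_iff gcoeff_pd_Inl xc_def one_grassmann.rep_eq simp del: pd.simps
        intro!: grassmann_eqI)
next
  case (Inr j)
  then show ?thesis
    by (auto simp: fun_eq_iff xc_def g_deriv.rep_eq intro!: grassmann_eqI)
qed

lemma pd_xi: "pd k (\<xi> j) = (if k = Inr j then 1 else 0)"
  by (cases k) (auto simp: fun_eq_iff \<xi>_def g_deriv.rep_eq one_grassmann.rep_eq intro!: grassmann_eqI)

lemma pd_zero [simp]: "pd k 0 = 0"
  using pd_cst [of k 0] by simp

lemma pd_cst_mult: "F \<in> superfunctions \<Longrightarrow> pd k (cst c * F) = cst c * pd k F"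
  by (simp add: pd_mult [of _ False])

lemma pd_sum: "(\<And>x. x \<in> X \<Longrightarrow> F x \<in> superfunctions) \<Longrightarrow> pd k (sum F X) = (\<Sum>x\<in>X. pd k (F x))"
  by (induction X rule: infinite_finite_induct) (auto simp: pd_add sf_sum)

section \<open>Vector fields\<close>

lemma vf_part_eq: "vf_part p X = (\<lambda>k. sf_part (p \<noteq> coord_parity k) (X k))"
  by (simp add: vf_part_def sf_part_def)

lemma vf_scale_apply [simp]: "vf_scale f X k = f * X k"
  by (simp add: vf_scale_def)

lemma vector_fieldsD: "X \<in> vector_fields \<Longrightarrow> X k \<in> superfunctions"
  by (simp add: vector_fields_def)

lemma homogeneous_vector_fieldsD:
  assumes "X \<in> homogeneous_vector_fields p"
  shows "X \<in> vector_fields" "X k \<in> superfunctions" "homog (p \<noteq> coord_parity k) (X k)"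
proof -
  show "X \<in> vector_fields" and "X k \<in> superfunctions"
    using assms by (auto simp: homogeneous_vector_fields_def vector_fields_def)
  have "vf_part p X k = X k"
    using assms by (simp add: homogeneous_vector_fields_def)
  then show "homog (p \<noteq> coord_parity k) (X k)"
    by (simp add: vf_part_eq)
qed

lemma homogeneous_vector_fieldsI:
  assumes "\<And>k. X k \<in> superfunctions" "\<And>k. homog (p \<noteq> coord_parity k) (X k)"
  shows "X \<in> homogeneous_vector_fields p"
  using assms by (simp add: homogeneous_vector_fields_def vector_fields_def vf_part_eq)

lemma sf_part_cst_mult: "sf_part p (cst c * F) = cst c * sf_part p F"
  by (rule ext, rule grassmann_eqI) (simp only: sf_part_def g_part.rep_eq gcoeff_cst_mult, simp)

lemma vf_part_add: "vf_part p (X + Y) = vf_part p X + vf_part p Y"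
  by (simp add: vf_part_eq fun_eq_iff sf_part_add)

lemma vf_part_scale: "vf_part p (vf_scale (cst c) X) = vf_scale (cst c) (vf_part p X)"
  by (rule ext) (simp add: vf_part_eq sf_part_cst_mult)

lemma vf_part_zero [simp]: "vf_part p 0 = 0"
  by (rule ext) (simp add: vf_part_eq)

lemma vf_part_vector_field: "X \<in> vector_fields \<Longrightarrow> vf_part p X \<in> vector_fields"
  by (auto simp: vector_fields_def vf_part_eq)

lemma vf_part_other:
  assumes "X \<in> homogeneous_vector_fields p"
  shows "vf_part q X = (if p = q then X else 0)"
proof
  fix k
  have "vf_part q X k = sf_part (q \<noteq> coord_parity k) (sf_part (p \<noteq> coord_parity k) (X k))"
    using homogeneous_vector_fieldsD(3) [OF assms, of k] by (simp add: vf_part_eq)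
  then show "vf_part q X k = (if p = q then X else 0) k"
    using homogeneous_vector_fieldsD(3) [OF assms, of k]
    by (auto simp: sf_part_sf_part)
qed

lemma vf_apply_superfunction [intro]:
  "X \<in> vector_fields \<Longrightarrow> F \<in> superfunctions \<Longrightarrow> vf_apply X F \<in> superfunctions"
  unfolding vf_apply_def by (auto simp: vector_fields_def)

lemma vf_apply_add_left: "vf_apply (X + Y) F = vf_apply X F + vf_apply Y F"
  by (simp add: vf_apply_def distrib_right sum.distrib)

lemma vf_apply_scale_left: "vf_apply (vf_scale f X) F = f * vf_apply X F"
  by (simp add: vf_apply_def sum_distrib_left mult.assoc)

lemma vf_apply_zero_left [simp]: "vf_apply 0 F = 0"
  by (simp add: vf_apply_def)

lemma vf_apply_zero_right [simp]: "vf_apply X 0 = 0"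
  by (simp add: vf_apply_def)

lemma vf_apply_add_right:
  "F \<in> superfunctions \<Longrightarrow> G \<in> superfunctions \<Longrightarrow> vf_apply X (F + G) = vf_apply X F + vf_apply X G"
  by (simp add: vf_apply_def pd_add distrib_left sum.distrib)

lemma vf_apply_cst_mult:
  "F \<in> superfunctions \<Longrightarrow> vf_apply X (cst c * F) = cst c * vf_apply X F"
  unfolding vf_apply_def sum_distrib_left
proof (intro sum.cong refl)
  fix k assume "F \<in> superfunctions"
  then have "X k * pd k (cst c * F) = (X k * cst c) * pd k F"
    by (simp add: pd_cst_mult mult.assoc)
  then show "X k * pd k (cst c * F) = cst c * (X k * pd k F)"
    by (simp only: cst_commute [of "X k"] mult.assoc)
qed

lemma vf_apply_mult:
  assumes X: "X \<in> homogeneous_vector_fields p" and f: "f \<in> superfunctions" "homog r f"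
    and G: "G \<in> superfunctions"
  shows "vf_apply X (f * G) = vf_apply X f * G + sgn_if (p \<and> r) * (f * vf_apply X G)"
proof -
  have "X k * pd k (f * G) = X k * pd k f * G + sgn_if (p \<and> r) * (f * (X k * pd k G))" for k
  proof -
    \<comment> \<open>Writing |k| for the parity of the coordinate, moving f past \<open>X k\<close>
      has sign exponent r(p + |k|) and the product rule has r|k|; modulo 2 they add up to rp,
      whatever k is.\<close>
    have "X k * f = sgn_if (r \<and> (p \<noteq> coord_parity k)) * (f * X k)"
      by (rule homog_supercommute [OF f(2) homogeneous_vector_fieldsD(3) [OF X]])
    then have *: "X k * (f * pd k G) = sgn_if (r \<and> (p \<noteq> coord_parity k)) * (f * (X k * pd k G))"
      unfolding mult.assoc [of "X k" f, symmetric] by (simp add: mult.assoc)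
    have "X k * pd k (f * G) = X k * pd k f * G + sgn_if (coord_parity k \<and> r) * (X k * (f * pd k G))"
      by (simp add: pd_mult [OF f G] algebra_simps)
    then show ?thesis unfolding * by (auto split: if_splits)
  qed
  then show ?thesis
    by (simp add: vf_apply_def sum_distrib_left sum_distrib_right sum.distrib)
qed

lemma vf_bracket_add_left:
  assumes "X \<in> vector_fields" "Y \<in> vector_fields" "Z \<in> vector_fields"
  shows "vf_bracket (X + Y) Z = vf_bracket X Z + vf_bracket Y Z"
  by (rule ext) (simp add: vf_bracket_def vf_part_add vf_apply_add_left vf_apply_add_right
      vector_fieldsD vf_part_vector_field assms algebra_simps UNIV_bool)

lemma vf_bracket_add_right:
  assumes "X \<in> vector_fields" "Y \<in> vector_fields" "Z \<in> vector_fields"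
  shows "vf_bracket Z (X + Y) = vf_bracket Z X + vf_bracket Z Y"
  by (rule ext) (simp add: vf_bracket_def vf_part_add vf_apply_add_left vf_apply_add_right
      vector_fieldsD vf_part_vector_field assms algebra_simps UNIV_bool)

lemma vf_bracket_scale_left:
  assumes "X \<in> vector_fields" "Z \<in> vector_fields"
  shows "vf_bracket (vf_scale (cst c) X) Z = vf_scale (cst c) (vf_bracket X Z)"
  by (rule ext) (simp add: vf_bracket_def vf_part_scale vf_apply_scale_left vf_apply_cst_mult
      vector_fieldsD vf_part_vector_field assms algebra_simps UNIV_bool)

lemma vf_bracket_scale_right:
  assumes "X \<in> vector_fields" "Z \<in> vector_fields"
  shows "vf_bracket Z (vf_scale (cst c) X) = vf_scale (cst c) (vf_bracket Z X)"
  by (rule ext) (simp add: vf_bracket_def vf_part_scale vf_apply_scale_left vf_apply_cst_mult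
      vector_fieldsD vf_part_vector_field assms algebra_simps UNIV_bool)

lemma vf_bracket_zero [simp]: "vf_bracket 0 Z = 0" "vf_bracket Z 0 = 0"
  by (rule ext, simp add: vf_bracket_def)+

lemma vf_bracket_homogeneous:
  assumes "X \<in> homogeneous_vector_fields p" "Y \<in> homogeneous_vector_fields q"
  shows "vf_bracket X Y k = vf_apply X (Y k) - sgn_if (p \<and> q) * vf_apply Y (X k)"
  by (cases p; cases q) (simp_all add: vf_bracket_def vf_part_other [OF assms(1)]
      vf_part_other [OF assms(2)] UNIV_bool)

lemma vf_scale_homogeneous:
  assumes "f \<in> superfunctions" "homog r f" "Y \<in> homogeneous_vector_fields q"
  shows "vf_scale f Y \<in> homogeneous_vector_fields (r \<noteq> q)"
proof (rule homogeneous_vector_fieldsI)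
  fix k
  show "vf_scale f Y k \<in> superfunctions"
    using assms homogeneous_vector_fieldsD(2) by auto
  have "homog (r \<noteq> (q \<noteq> coord_parity k)) (f * Y k)"
    by (rule homog_mult [OF assms(2) homogeneous_vector_fieldsD(3) [OF assms(3)]])
  moreover have "(r \<noteq> (q \<noteq> coord_parity k)) = ((r \<noteq> q) \<noteq> coord_parity k)" by auto
  ultimately show "homog ((r \<noteq> q) \<noteq> coord_parity k) (vf_scale f Y k)" by simp
qed

text \<open>In the second half of the bracket f multiplies after Y has differentiated, so f is not
  differentiated there. The sign exponent p(r + q) of that half splits off the pr which also occurs
  in \<open>vf_apply_mult\<close>.\<close>

lemma vf_bracket_leibniz:
  assumes X: "X \<in> homogeneous_vector_fields p" and Y: "Y \<in> homogeneous_vector_fields q"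
    and f: "f \<in> superfunctions" "homog r f"
  shows "vf_bracket X (vf_scale f Y) = vf_scale (vf_apply X f) Y + vf_scale (sgn_if (p \<and> r) * f) (vf_bracket X Y)"
proof
  fix k
  have "vf_bracket X (vf_scale f Y) k =
      vf_apply X f * Y k + sgn_if (p \<and> r) * (f * vf_apply X (Y k)) - sgn_if (p \<and> (r \<noteq> q)) * (f * vf_apply Y (X k))"
    using homogeneous_vector_fieldsD(2) [OF Y]
    by (simp only: vf_bracket_homogeneous [OF X vf_scale_homogeneous [OF f Y]] vf_scale_apply
        vf_apply_mult [OF X f] vf_apply_scale_left)
  also have "\<dots> = vf_apply X f * Y k + sgn_if (p \<and> r) * f * vf_bracket X Y k"
    by (auto simp: vf_bracket_homogeneous [OF X Y] algebra_simps)
  finally show "vf_bracket X (vf_scale f Y) k =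
      (vf_scale (vf_apply X f) Y + vf_scale (sgn_if (p \<and> r) * f) (vf_bracket X Y)) k"
    by simp
qed

section \<open>Subspaces and spans of vector fields\<close>

lemma vf_subspaceI:
  assumes "0 \<in> A" "\<And>X Y. X \<in> A \<Longrightarrow> Y \<in> A \<Longrightarrow> X + Y \<in> A" "\<And>c X. X \<in> A \<Longrightarrow> vf_scale (cst c) X \<in> A"
  shows "vf_subspace A"
  using assms by (auto simp: vf_subspace_def)

lemma vf_scale_add_left: "vf_scale (f + g) X = vf_scale f X + vf_scale g X"
  by (rule ext) (simp add: distrib_right)

lemma vf_scale_add_right: "vf_scale f (X + Y) = vf_scale f X + vf_scale f Y"
  by (rule ext) (simp add: distrib_left)

lemma vf_scale_scale: "vf_scale f (vf_scale g X) = vf_scale (f * g) X"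
  by (rule ext) (simp add: mult.assoc)

lemma vf_scale_zero [simp]: "vf_scale 0 X = 0" "vf_scale f 0 = 0"
  by (rule ext, simp)+

lemma vf_scale_sum: "vf_scale f (\<Sum>i\<in>I. X i) = (\<Sum>i\<in>I. vf_scale f (X i))"
  using sum_comp_morphism [of "vf_scale f" X I, OF vf_scale_zero(2) vf_scale_add_right]
  unfolding o_def ..

lemma vf_subspace_sum:
  assumes "vf_subspace A" "\<And>i. i \<in> I \<Longrightarrow> X i \<in> A"
  shows "sum X I \<in> A"
  using assms(2)
  by (induction I rule: infinite_finite_induct) (use assms(1) in \<open>auto simp: vf_subspace_def\<close>)

lemma vf_span_least:
  assumes "vf_subspace A" "B \<subseteq> A"
  shows "vf_span B \<subseteq> A"
proof
  fix Z assume "Z \<in> vf_span B"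
  then obtain c where "Z = (\<Sum>X\<in>B. vf_scale (cst (c X)) X)" unfolding vf_span_def by blast
  moreover have "\<dots> \<in> A"
    using assms by (intro vf_subspace_sum) (auto simp: vf_subspace_def)
  ultimately show "Z \<in> A" by simp
qed

lemma vf_span_superset:
  assumes "finite B"
  shows "B \<subseteq> vf_span B"
proof
  fix Y assume "Y \<in> B"
  have "(\<Sum>X\<in>B. vf_scale (cst (if X = Y then 1 else 0)) X) = (\<Sum>X\<in>B. if X = Y then Y else 0)"
    by (intro sum.cong refl) (auto simp: fun_eq_iff)
  also have "\<dots> = Y" using assms \<open>Y \<in> B\<close> by simp
  finally show "Y \<in> vf_span B"
    unfolding vf_span_def by (intro CollectI exI [of _ "\<lambda>X. if X = Y then 1 else 0"]) simp
qed

lemma vf_subspace_vf_span: "vf_subspace (vf_span B)"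
proof (rule vf_subspaceI)
  have "0 = (\<Sum>X\<in>B. vf_scale (cst 0) X)" by simp
  then show "0 \<in> vf_span B" unfolding vf_span_def by (intro CollectI exI [of _ "\<lambda>_. 0"]) simp
next
  fix Y Z assume "Y \<in> vf_span B" "Z \<in> vf_span B"
  then obtain c d where "Y = (\<Sum>X\<in>B. vf_scale (cst (c X)) X)" "Z = (\<Sum>X\<in>B. vf_scale (cst (d X)) X)"
    unfolding vf_span_def by blast
  then have "Y + Z = (\<Sum>X\<in>B. vf_scale (cst (c X + d X)) X)"
    by (simp add: cst_add vf_scale_add_left sum.distrib)
  then show "Y + Z \<in> vf_span B"
    unfolding vf_span_def by (intro CollectI exI [of _ "\<lambda>X. c X + d X"]) simp
next
  fix e Y assume "Y \<in> vf_span B"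
  then obtain c where Y: "Y = (\<Sum>X\<in>B. vf_scale (cst (c X)) X)" unfolding vf_span_def by blast
  have "vf_scale (cst e) Y = (\<Sum>X\<in>B. vf_scale (cst (e * c X)) X)"
    by (simp only: Y vf_scale_sum vf_scale_scale cst_mult)
  then show "vf_scale (cst e) Y \<in> vf_span B"
    unfolding vf_span_def by (intro CollectI exI [of _ "\<lambda>X. e * c X"]) simp
qed

lemma vf_subspace_vector_fields: "vf_subspace vector_fields"
  by (rule vf_subspaceI) (auto simp: vector_fields_def)

lemma vf_subspace_homogeneous: "vf_subspace (homogeneous_vector_fields p)"
  using vf_subspace_vector_fields
  by (intro vf_subspaceI)
    (auto simp: vf_subspace_def homogeneous_vector_fields_def vf_part_add vf_part_scale)

section \<open>Line modules, distributions and their symmetries\<close>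

lemma vf_subspace_line_module: "vf_subspace (line_module Y)"
proof (rule vf_subspaceI)
  show "0 \<in> line_module Y"
    unfolding line_module_def by (intro CollectI exI [of _ 0]) simp
next
  fix X Z assume "X \<in> line_module Y" "Z \<in> line_module Y"
  then obtain f g where "X = vf_scale f Y" "Z = vf_scale g Y" "f \<in> superfunctions" "g \<in> superfunctions"
    unfolding line_module_def by blast
  then show "X + Z \<in> line_module Y"
    unfolding line_module_def by (intro CollectI exI [of _ "f + g"]) (auto simp: vf_scale_add_left)
next
  fix c X assume "X \<in> line_module Y"
  then obtain f where "X = vf_scale f Y" "f \<in> superfunctions"
    unfolding line_module_def by blast
  then show "vf_scale (cst c) X \<in> line_module Y"
    unfolding line_module_def by (intro CollectI exI [of _ "cst c * f"]) (auto simp: vf_scale_scale)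
qed

lemma distribution_eq:
  "distribution Y1 Y2 Y3 =
    {Z1 + Z2 + Z3 | Z1 Z2 Z3. Z1 \<in> line_module Y1 \<and> Z2 \<in> line_module Y2 \<and> Z3 \<in> line_module Y3}"
  unfolding distribution_def line_module_def by blast

lemma line_module_vector_field: "Y \<in> vector_fields \<Longrightarrow> Z \<in> line_module Y \<Longrightarrow> Z \<in> vector_fields"
  unfolding line_module_def vector_fields_def by (auto intro!: sf_mult)

text \<open>The distribution is the sum of its three line modules, so additivity of the bracket in
  its second argument suffices.\<close>

lemma preserves_distribution:
  assumes "X \<in> vector_fields" "Y1 \<in> vector_fields" "Y2 \<in> vector_fields" "Y3 \<in> vector_fields"
    and "preserves X (line_module Y1)" "preserves X (line_module Y2)" "preserves X (line_module Y3)"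
  shows "preserves X (distribution Y1 Y2 Y3)"
  unfolding preserves_def
proof
  fix Z assume "Z \<in> distribution Y1 Y2 Y3"
  then obtain Z1 Z2 Z3 where Z: "Z = Z1 + Z2 + Z3"
    "Z1 \<in> line_module Y1" "Z2 \<in> line_module Y2" "Z3 \<in> line_module Y3"
    unfolding distribution_eq by blast
  then have v: "Z1 \<in> vector_fields" "Z2 \<in> vector_fields" "Z3 \<in> vector_fields"
    using assms(2-4) line_module_vector_field by auto
  moreover have "Z1 + Z2 \<in> vector_fields"
    using v vf_subspace_vector_fields by (simp add: vf_subspace_def)
  ultimately have "vf_bracket X Z = vf_bracket X Z1 + vf_bracket X Z2 + vf_bracket X Z3"
    using assms(1) by (simp add: Z(1) vf_bracket_add_right)
  then show "vf_bracket X Z \<in> distribution Y1 Y2 Y3"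
    using Z(2-4) assms(5-7) unfolding distribution_eq preserves_def by blast
qed

lemma preserves_subspace:
  assumes "vf_subspace E" "E \<subseteq> vector_fields"
  shows "vf_subspace {X \<in> vector_fields. preserves X E}"
proof (rule vf_subspaceI)
  show "0 \<in> {X \<in> vector_fields. preserves X E}"
    using assms by (auto simp: preserves_def vector_fields_def vf_subspace_def)
next
  fix X Z assume "X \<in> {X \<in> vector_fields. preserves X E}" "Z \<in> {X \<in> vector_fields. preserves X E}"
  then show "X + Z \<in> {X \<in> vector_fields. preserves X E}"
    using assms vf_subspace_vector_fields
    by (auto simp: preserves_def vf_subspace_def subset_iff vf_bracket_add_left)
next
  fix c X assume "X \<in> {X \<in> vector_fields. preserves X E}"
  then show "vf_scale (cst c) X \<in> {X \<in> vector_fields. preserves X E}"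
    using assms vf_subspace_vector_fields
    by (auto simp: preserves_def vf_subspace_def subset_iff vf_bracket_scale_left)
qed

text \<open>By \<open>preserves_distribution\<close> the set is the intersection of three
  conditions, one per line, each of which is linear in X.\<close>

lemma split_symmetries_subspace:
  assumes "Y1 \<in> vector_fields" "Y2 \<in> vector_fields" "Y3 \<in> vector_fields"
  shows "vf_subspace (split_symmetries Y1 Y2 Y3)"
proof -
  let ?P = "\<lambda>Y. {X \<in> vector_fields. preserves X (line_module Y)}"
  have "split_symmetries Y1 Y2 Y3 = ?P Y1 \<inter> ?P Y2 \<inter> ?P Y3"
    unfolding split_symmetries_def using preserves_distribution assms by blast
  moreover have "vf_subspace (?P Y)" if "Y \<in> vector_fields" for Y
    using that by (intro preserves_subspace vf_subspace_line_module)
      (auto intro: line_module_vector_field)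
  ultimately show ?thesis
    using assms by (simp add: vf_subspace_def)
qed

lemma preserves_line_module:
  assumes X: "X \<in> homogeneous_vector_fields p" and Y: "Y \<in> homogeneous_vector_fields q"
    and g: "g \<in> superfunctions" "vf_bracket X Y = vf_scale g Y"
  shows "preserves X (line_module Y)"
  unfolding preserves_def
proof
  fix Z assume "Z \<in> line_module Y"
  then obtain f where f: "f \<in> superfunctions" "Z = vf_scale f Y"
    unfolding line_module_def by blast
  \<comment> \<open>The coefficient f is arbitrary, but the Leibniz rule applies to homogeneous
    coefficients; the two parts are added up afterwards.\<close>
  have hom: "vf_bracket X (vf_scale (sf_part r f) Y) \<in> line_module Y" for r
  proof -
    let ?f = "sf_part r f"
    have sf: "?f \<in> superfunctions" "homog r ?f" using f by (auto simp: sf_part_sf_part)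
    have "vf_bracket X (vf_scale ?f Y) = vf_scale (vf_apply X ?f + sgn_if (p \<and> r) * ?f * g) Y"
      unfolding vf_bracket_leibniz [OF X Y sf] g(2) vf_scale_scale vf_scale_add_left ..
    moreover have "vf_apply X ?f + sgn_if (p \<and> r) * ?f * g \<in> superfunctions"
      using sf g homogeneous_vector_fieldsD(1) [OF X]
      by (cases "p \<and> r") (auto intro!: sf_add sf_diff sf_mult vf_apply_superfunction)
    ultimately show ?thesis unfolding line_module_def by blast
  qed
  have "Z = vf_scale (sf_part False f) Y + vf_scale (sf_part True f) Y"
    unfolding f(2) by (subst sf_part_decompose) (rule vf_scale_add_left)
  moreover have "vf_scale (sf_part r f) Y \<in> vector_fields" for r
    using f homogeneous_vector_fieldsD(2) [OF Y] by (auto simp: vector_fields_def)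
  ultimately have "vf_bracket X Z = vf_bracket X (vf_scale (sf_part False f) Y) + vf_bracket X (vf_scale (sf_part True f) Y)"
    using homogeneous_vector_fieldsD(1) [OF X] by (simp add: vf_bracket_add_right)
  then show "vf_bracket X Z \<in> line_module Y"
    using hom vf_subspace_line_module by (simp add: vf_subspace_def)
qed

section \<open>Polynomial superfunctions\<close>

text \<open>Syntax trees for components of vector fields, so that identities between superfunctions
  become computations on closed terms. \<open>Even 0\<close> and \<open>Even 1\<close> stand for a
  and \<kappa>, \<open>Even 2\<close> to \<open>Even 4\<close> for the even coordinates,
  \<open>Odd 0\<close> to \<open>Odd 3\<close> for the odd ones. The arithmetic instances below
  allow the usual notation.\<close>

datatype sexp = Even nat | Odd nat | Const int | Add sexp sexp | Sub sexp sexp | Mul sexp sexp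

instantiation sexp :: "{plus, minus, times, uminus, zero, one}"
begin
definition "plus_sexp = Add"
definition "minus_sexp = Sub"
definition "times_sexp = Mul"
definition "zero_sexp = Const 0"
definition "one_sexp = Const 1"
definition "uminus_sexp = Sub (Const 0)"
instance ..
end

text \<open>Exponents of the even variables, followed by the odd variables as an ordered
  product.\<close>

type_synonym monomial = "nat list \<times> nat list"
type_synonym poly_list = "(int \<times> monomial) list"

fun add_exponents :: "nat list \<Rightarrow> nat list \<Rightarrow> nat list" where
  "add_exponents [] ns = ns"
| "add_exponents (m # ms) [] = m # ms"
| "add_exponents (m # ms) (n # ns) = (m + n) # add_exponents ms ns"

text \<open>A sign \<open>0\<close> indicates that the monomial vanishes, whatever its list of variables.\<close>

fun insert_odd :: "nat \<Rightarrow> nat list \<Rightarrow> int \<times> nat list" where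
  "insert_odd v [] = (1, [v])"
| "insert_odd v (w # ws) = (if v < w then (1, v # w # ws)
     else if v = w then (0, [])
     else (case insert_odd v ws of (s, us) \<Rightarrow> (- s, w # us)))"

fun mul_odd :: "nat list \<Rightarrow> nat list \<Rightarrow> int \<times> nat list" where
  "mul_odd [] ws = (1, ws)"
| "mul_odd (v # vs) ws = (case mul_odd vs ws of (s, us) \<Rightarrow>
     if s = 0 then (0, []) else case insert_odd v us of (t, xs) \<Rightarrow> (s * t, xs))"

fun deriv_even :: "nat \<Rightarrow> nat list \<Rightarrow> nat \<times> nat list" where
  "deriv_even v [] = (0, [])"
| "deriv_even 0 (n # ns) = (n, (n - 1) # ns)"
| "deriv_even (Suc v) (n # ns) = (case deriv_even v ns of (s, us) \<Rightarrow> (s, n # us))"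

fun deriv_odd :: "nat \<Rightarrow> nat list \<Rightarrow> int \<times> nat list" where
  "deriv_odd v [] = (0, [])"
| "deriv_odd v (w # ws) = (if v = w then (if v \<in> set ws then (0, []) else (1, ws))
     else (case deriv_odd v ws of (s, us) \<Rightarrow> (- s, w # us)))"

text \<open>Like terms are merged and vanishing ones deleted, so that equality with the empty list
  can serve as the test for zero. Terms keep no particular order.\<close>

fun add_term :: "int \<times> monomial \<Rightarrow> poly_list \<Rightarrow> poly_list" where
  "add_term (c, m) [] = [(c, m)]"
| "add_term (c, m) ((d, n) # p) = (if m = n then (if c + d = 0 then p else (c + d, n) # p)
     else (d, n) # add_term (c, m) p)"

fun add_poly :: "poly_list \<Rightarrow> poly_list \<Rightarrow> poly_list" where
  "add_poly [] q = q"
| "add_poly (t # p) q = add_term t (add_poly p q)"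

definition neg_poly :: "poly_list \<Rightarrow> poly_list" where
  "neg_poly p = map (\<lambda>(c, m). (- c, m)) p"

text \<open>The third argument is an accumulator: the sums of products that make up a bracket are
  collected in a single list in which like terms cancel at once.\<close>

fun mul_term_add :: "int \<times> monomial \<Rightarrow> poly_list \<Rightarrow> poly_list \<Rightarrow> poly_list" where
  "mul_term_add t [] r = r"
| "mul_term_add (c, e, vs) ((d, f, ws) # q) r = (case mul_odd vs ws of (s, us) \<Rightarrow>
     if s = 0 then mul_term_add (c, e, vs) q r
     else add_term (s * c * d, add_exponents e f, us) (mul_term_add (c, e, vs) q r))"

fun mul_add :: "poly_list \<Rightarrow> poly_list \<Rightarrow> poly_list \<Rightarrow> poly_list" where
  "mul_add [] q r = r"
| "mul_add (t # p) q r = mul_term_add t q (mul_add p q r)"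

fun deriv_even_poly :: "nat \<Rightarrow> poly_list \<Rightarrow> poly_list" where
  "deriv_even_poly v [] = []"
| "deriv_even_poly v ((c, e, vs) # p) = (case deriv_even v e of (s, f) \<Rightarrow>
     if s = 0 then deriv_even_poly v p else (int s * c, f, vs) # deriv_even_poly v p)"

fun deriv_odd_poly :: "nat \<Rightarrow> poly_list \<Rightarrow> poly_list" where
  "deriv_odd_poly v [] = []"
| "deriv_odd_poly v ((c, e, vs) # p) = (case deriv_odd v vs of (s, ws) \<Rightarrow>
     if s = 0 then deriv_odd_poly v p else (s * c, e, ws) # deriv_odd_poly v p)"

text \<open>The even variables are \<open>a\<close>, \<open>\<kappa>\<close> and the three even coordinates, in this order.\<close>

definition deriv_poly :: "nat \<Rightarrow> poly_list \<Rightarrow> poly_list" where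
  "deriv_poly c p = (if c < 3 then deriv_even_poly (c + 2) p else deriv_odd_poly (c - 3) p)"

fun normalize :: "sexp \<Rightarrow> poly_list" where
  "normalize (Even v) = [(1, map (\<lambda>i. if i = v then 1 else 0) [0..<5], [])]"
| "normalize (Odd v) = [(1, [0, 0, 0, 0, 0], [v])]"
| "normalize (Const c) = (if c = 0 then [] else [(c, [0, 0, 0, 0, 0], [])])"
| "normalize (Add e f) = add_poly (normalize e) (normalize f)"
| "normalize (Sub e f) = add_poly (normalize e) (neg_poly (normalize f))"
| "normalize (Mul e f) = mul_add (normalize e) (normalize f) []"

fun apply_poly :: "nat \<Rightarrow> poly_list list \<Rightarrow> poly_list \<Rightarrow> poly_list \<Rightarrow> poly_list" where
  "apply_poly c [] f r = r"
| "apply_poly c (g # gs) f r = mul_add g (deriv_poly c f) (apply_poly (Suc c) gs f r)"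

text \<open>The flag s marks a pair of odd fields, for which the supercommutator is a sum.\<close>

definition bracket_poly :: "bool \<Rightarrow> poly_list list \<Rightarrow> poly_list list \<Rightarrow> nat \<Rightarrow> poly_list" where
  "bracket_poly s P Q c = apply_poly 0 P (Q ! c)
     (if s then apply_poly 0 Q (P ! c) [] else neg_poly (apply_poly 0 Q (P ! c) []))"

definition coords :: "coord list" where
  "coords = [Inl 1, Inl 2, Inl 3, Inr 1, Inr 2, Inr 3, Inr 4]"

fun coord_index :: "coord \<Rightarrow> nat" where
  "coord_index (Inl i) = (if i = 1 then 0 else if i = 2 then 1 else 2)"
| "coord_index (Inr j) = (if j = 1 then 3 else if j = 2 then 4 else if j = 3 then 5 else 6)"

lemmas fun_apply_simps =
  plus_fun_apply times_fun_apply zero_fun_apply one_fun_apply minus_apply uminus_apply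
  numeral_fun_apply of_nat_fun_apply

text \<open>As simplification rules these expand equations between superfunctions pointwise.\<close>

declare fun_apply_simps [simp del]

section \<open>Soundness of the symbolic calculus\<close>

lemma coord_index_less: "coord_index k < 7"
  by (cases k) auto

lemma less_7_cases: "c < 7 \<Longrightarrow> c = 0 \<or> c = 1 \<or> c = 2 \<or> c = 3 \<or> c = 4 \<or> c = 5 \<or> c = (6 :: nat)"
  by auto

lemma coords_nth: "coords ! coord_index k = k"
proof (cases k)
  case (Inl i)
  then show ?thesis using exhaust_3 [of i] by (auto simp: coords_def)
next
  case (Inr j)
  then show ?thesis using exhaust_4 [of j] by (auto simp: coords_def)
qed

lemma coord_index_nth: "c < 7 \<Longrightarrow> coord_index (coords ! c) = c"
  by (drule less_7_cases) (auto simp: coords_def)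

lemma sum_coord: "(\<Sum>k\<in>UNIV. f k) = (\<Sum>c<7. f (coords ! c))"
  by (rule sum.reindex_bij_witness [of _ "\<lambda>c. coords ! c" coord_index])
    (auto simp: coords_nth coord_index_nth coord_index_less)

lemma homog_one [simp]: "homog False 1"
  using homog_cst [of 1] by simp

lemma homog_power: "homog False F \<Longrightarrow> homog False (F ^ n)"
proof (induction n)
  case (Suc n)
  then show ?case using homog_mult [of False F False "F ^ n"] by simp
qed simp

lemma sf_power: "F \<in> superfunctions \<Longrightarrow> F ^ n \<in> superfunctions"
  by (induction n) (auto intro!: sf_mult)

lemma pd_one [simp]: "pd k 1 = 0"
  using pd_cst [of k 1] by simp

lemma pd_power:
  assumes "F \<in> superfunctions" "homog False F"
  shows "pd k (F ^ n) = of_nat n * F ^ (n - 1) * pd k F"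
proof (induction n)
  case (Suc n)
  have "pd k (F ^ Suc n) = pd k F * F ^ n + F * pd k (F ^ n)"
    using pd_mult [OF assms sf_power [OF assms(1)]] by simp
  also have "pd k F * F ^ n = F ^ n * pd k F"
    by (rule even_central [OF homog_power [OF assms(2)], symmetric])
  also have "F * pd k (F ^ n) = of_nat n * (F * F ^ (n - 1)) * pd k F"
    using mult_of_nat_commute [of n F] by (simp add: Suc flip: mult.assoc)
  also have "\<dots> = of_nat n * F ^ n * pd k F"
    by (cases n) simp_all
  finally show ?case by (simp add: distrib_right)
qed simp

text \<open>Index v stands for the odd coordinate with number v + 1. The default 0 is again odd,
  holomorphic and of square zero, so the sign rules hold for every index. Monomials are evaluated as
  products of these elements, hence independently of the order on the type \<open>4\<close>.\<close>

definition odd_gen :: "nat \<Rightarrow> sfun" where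
  "odd_gen v = (if v < 4 then \<xi> ([1, 2, 3, 4] ! v) else 0)"

definition val_odd :: "nat list \<Rightarrow> sfun" where
  "val_odd vs = prod_list (map odd_gen vs)"

text \<open>The default 1 treats missing exponents as zeros, in agreement with the padding in
  \<open>add_exponents\<close>.\<close>

fun val_even :: "sfun list \<Rightarrow> nat list \<Rightarrow> sfun" where
  "val_even (x # xs) (n # ns) = x ^ n * val_even xs ns"
| "val_even _ _ = 1"

lemma of_int_left_commute: "y * (of_int n * z) = of_int n * (y * z)" for y z :: "'a :: ring_1"
  by (metis mult.assoc mult_of_int_commute)

lemma odd_gen_homog: "homog True (odd_gen v)"
  by (simp add: odd_gen_def)

lemma odd_gen_superfunction: "odd_gen v \<in> superfunctions"
  by (simp add: odd_gen_def)

lemma odd_gen_anticommute: "odd_gen v * odd_gen w = - (odd_gen w * odd_gen v)"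
  using homog_supercommute [OF odd_gen_homog odd_gen_homog, of v w] by (simp add: equation_minus_iff)

lemma odd_gen_square: "odd_gen v * odd_gen v = 0"
  by (simp add: odd_gen_def)

lemma val_odd_simps [simp]: "val_odd [] = 1" "val_odd (v # vs) = odd_gen v * val_odd vs"
  by (simp_all add: val_odd_def)

lemma val_odd_superfunction: "val_odd vs \<in> superfunctions"
  by (induction vs) (auto intro: sf_mult odd_gen_superfunction)

lemma val_odd_homog: "homog (odd (length vs)) (val_odd vs)"
proof (induction vs)
  case (Cons v vs)
  from homog_mult [OF odd_gen_homog Cons, of v] show ?case by simp
qed simp

lemma val_insert_odd:
  "insert_odd v ws = (s, us) \<Longrightarrow> odd_gen v * val_odd ws = of_int s * val_odd us"
proof (induction v ws arbitrary: s us rule: insert_odd.induct)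
  case (2 v w ws)
  show ?case
  proof (cases "v < w \<or> v = w")
    case True
    then show ?thesis
      using 2(2) by (auto split: if_splits simp: odd_gen_square simp flip: mult.assoc)
  next
    case False
    obtain t xs where t: "insert_odd v ws = (t, xs)" by fastforce
    with False 2(2) have s: "s = - t" "us = w # xs" by auto
    have "odd_gen v * (odd_gen w * val_odd ws) = - (odd_gen w * (odd_gen v * val_odd ws))"
      by (metis mult.assoc minus_mult_left odd_gen_anticommute)
    also have "odd_gen v * val_odd ws = of_int t * val_odd xs"
      using 2(1) t False by auto
    also have "odd_gen w * (of_int t * val_odd xs) = of_int t * (odd_gen w * val_odd xs)"
      by (rule of_int_left_commute)
    finally show ?thesis by (simp add: s)
  qed
qed simp

lemma val_mul_odd:
  "mul_odd vs ws = (s, us) \<Longrightarrow> val_odd vs * val_odd ws = of_int s * val_odd us"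
proof (induction vs ws arbitrary: s us rule: mul_odd.induct)
  case (2 v vs ws)
  obtain t xs where t: "mul_odd vs ws = (t, xs)" by fastforce
  have "val_odd (v # vs) * val_odd ws = odd_gen v * (of_int t * val_odd xs)"
    using 2(1) [OF t] by (simp add: mult.assoc)
  also have "\<dots> = of_int t * (odd_gen v * val_odd xs)"
    by (rule of_int_left_commute)
  finally have *: "val_odd (v # vs) * val_odd ws = of_int t * (odd_gen v * val_odd xs)" .
  show ?case
  proof (cases "t = 0")
    case True
    then show ?thesis using * 2(2) t by simp
  next
    case False
    obtain r ys where r: "insert_odd v xs = (r, ys)" by fastforce
    have "s = t * r" "us = ys" using 2(2) t False r by auto
    then show ?thesis using * val_insert_odd [OF r] by (simp add: mult.assoc)
  qed
qed simp

text \<open>The shift by 3 skips the even coordinates, which come first in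
  \<open>coords\<close>.\<close>

lemma pd_odd_gen_Inr: "v < 4 \<Longrightarrow> pd (coords ! (v + 3)) (odd_gen w) = (if v = w then 1 else 0)"
proof -
  assume v: "v < 4"
  then have "coords ! (v + 3) = Inr ([1, 2, 3, 4] ! v)"
    using less_7_cases [of "v + 3"] by (auto simp: coords_def)
  moreover have "([1, 2, 3, 4 :: 4] ! v = [1, 2, 3, 4] ! w) = (v = w)" if "w < 4"
    by (rule nth_eq_iff_index_eq) (use that v in auto)
  ultimately show ?thesis using v by (auto simp: odd_gen_def pd_xi simp del: pd.simps)
qed

lemma pd_val_odd_zero:
  assumes "\<And>v. v \<in> set vs \<Longrightarrow> pd k (odd_gen v) = 0"
  shows "pd k (val_odd vs) = 0"
  using assms
  by (induction vs) (simp_all add: pd_mult [OF odd_gen_superfunction odd_gen_homog val_odd_superfunction])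

text \<open>A product with a repeated odd variable vanishes, which justifies the result 0 of
  \<open>deriv_odd\<close> on such lists.\<close>

lemma odd_gen_repeated: "v \<in> set ws \<Longrightarrow> odd_gen v * val_odd ws = 0"
proof (induction ws)
  case (Cons w ws)
  show ?case
  proof (cases "v = w")
    case False
    with Cons have "odd_gen v * val_odd ws = 0" by simp
    then have "odd_gen w * odd_gen v * val_odd ws = 0" by (simp add: mult.assoc)
    then show ?thesis by (simp add: odd_gen_anticommute [of v w] flip: mult.assoc)
  qed (simp add: odd_gen_square flip: mult.assoc)
qed simp

lemma coord_parity_coords: "c < 7 \<Longrightarrow> coord_parity (coords ! c) = (3 \<le> c)"
  by (drule less_7_cases) (auto simp: coords_def)

lemma val_deriv_odd:
  "deriv_odd v vs = (s, us) \<Longrightarrow> v < 4 \<Longrightarrow> pd (coords ! (v + 3)) (val_odd vs) = of_int s * val_odd us"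
proof (induction v vs arbitrary: s us rule: deriv_odd.induct)
  case (2 v w ws)
  let ?k = "coords ! (v + 3)"
  have "coord_parity ?k" using coord_parity_coords [of "v + 3"] 2(3) by simp
  then have pd: "pd ?k (val_odd (w # ws)) = (if v = w then 1 else 0) * val_odd ws - odd_gen w * pd ?k (val_odd ws)"
    using pd_mult [OF odd_gen_superfunction odd_gen_homog val_odd_superfunction, of ?k w ws]
      pd_odd_gen_Inr [OF 2(3)] by simp
  show ?case
  proof (cases "v = w")
    case True
    show ?thesis
    proof (cases "v \<in> set ws")
      case True
      then show ?thesis using 2(2) \<open>v = w\<close> odd_gen_repeated [OF True] by auto
    next
      case False
      then have "pd ?k (val_odd ws) = 0"
        by (intro pd_val_odd_zero) (auto simp: pd_odd_gen_Inr [OF 2(3)])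
      then show ?thesis using 2(2) True False pd by auto
    qed
  next
    case False
    obtain t xs where t: "deriv_odd v ws = (t, xs)" by fastforce
    have "pd ?k (val_odd ws) = of_int t * val_odd xs"
      using 2(1) [OF False t 2(3)] .
    then have "pd ?k (val_odd (w # ws)) = - (of_int t * (odd_gen w * val_odd xs))"
      using pd False by (simp add: of_int_left_commute)
    then show ?thesis using 2(2) False t by auto
  qed
qed simp

lemma val_even_Nil [simp]: "val_even xs [] = 1"
  by (cases xs) auto

lemma val_even_homog: "(\<And>x. x \<in> set xs \<Longrightarrow> homog False x) \<Longrightarrow> homog False (val_even xs ns)"
proof (induction xs ns rule: val_even.induct)
  case (1 x xs n ns)
  then show ?case
    using homog_mult [of False "x ^ n" False "val_even xs ns"] homog_power [of x n] by simp
qed simp_all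

lemma val_even_superfunction:
  "(\<And>x. x \<in> set xs \<Longrightarrow> x \<in> superfunctions) \<Longrightarrow> val_even xs ns \<in> superfunctions"
  by (induction xs ns rule: val_even.induct) (auto intro!: sf_mult sf_power)

lemma val_add_exponents:
  assumes "\<And>x. x \<in> set xs \<Longrightarrow> homog False x"
  shows "val_even xs (add_exponents ms ns) = val_even xs ms * val_even xs ns"
  using assms
proof (induction ms ns arbitrary: xs rule: add_exponents.induct)
  case (3 m ms n ns)
  show ?case
  proof (cases xs)
    case (Cons x ys)
    have "x ^ n * val_even ys ms = val_even ys ms * x ^ n"
      using 3(2) Cons by (intro even_central homog_power) auto
    then have "x ^ n * (val_even ys ms * z) = val_even ys ms * (x ^ n * z)" for z
      by (simp flip: mult.assoc)
    then show ?thesis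
      using 3 Cons by (simp add: power_add mult.assoc)
  qed simp
qed simp_all

lemma pd_val_even_zero:
  assumes "\<And>x. x \<in> set xs \<Longrightarrow> homog False x \<and> x \<in> superfunctions \<and> pd k x = 0"
  shows "pd k (val_even xs ns) = 0"
  using assms
proof (induction xs ns rule: val_even.induct)
  case (1 x xs n ns)
  have "x ^ n \<in> superfunctions" "homog False (x ^ n)" "val_even xs ns \<in> superfunctions"
    using 1(2) by (auto intro!: sf_power homog_power val_even_superfunction)
  then show ?case using 1 by (simp add: pd_mult [of _ False] pd_power)
qed simp_all

lemma val_deriv_even:
  assumes "\<And>x. x \<in> set xs \<Longrightarrow> homog False x \<and> x \<in> superfunctions"
    and "\<And>w. w < length xs \<Longrightarrow> pd k (xs ! w) = (if w = v then 1 else 0)" "v < length xs"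
    and "deriv_even v ns = (s, us)"
  shows "pd k (val_even xs ns) = of_nat s * val_even xs us"
  using assms
proof (induction v ns arbitrary: xs s us rule: deriv_even.induct)
  case (2 n ns)
  then obtain x ys where xs: "xs = x # ys" by (cases xs) auto
  have x: "pd k x = 1" using 2(2) [of 0] xs by simp
  have sf: "x \<in> superfunctions" "homog False x" "x ^ n \<in> superfunctions" "homog False (x ^ n)"
     "val_even ys ns \<in> superfunctions"
    using 2(1) xs by (auto intro!: sf_power homog_power val_even_superfunction)
  have ys: "pd k y = 0" if "y \<in> set ys" for y
  proof -
    from that obtain w where "w < length ys" "y = ys ! w" by (metis in_set_conv_nth)
    then show ?thesis using 2(2) [of "Suc w"] xs by simp
  qed
  have "pd k (val_even ys ns) = 0"
    using 2(1) xs ys by (intro pd_val_even_zero) auto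
  then have "pd k (val_even xs (n # ns)) = of_nat n * x ^ (n - 1) * val_even ys ns"
    using pd_mult [OF sf(3,4,5), of k] pd_power [OF sf(1,2), of k n] x xs by simp
  then show ?case
    using 2(4) xs by (auto simp: mult.assoc)
next
  case (3 v n ns)
  then obtain x ys where xs: "xs = x # ys" by (cases xs) auto
  obtain t ms where t: "deriv_even v ns = (t, ms)" by fastforce
  have x: "pd k x = 0" using 3(3) [of 0] xs by simp
  have sf: "x \<in> superfunctions" "homog False x" "x ^ n \<in> superfunctions" "homog False (x ^ n)"
     "val_even ys ns \<in> superfunctions"
    using 3(2) xs by (auto intro!: sf_power homog_power val_even_superfunction)
  have "pd k (val_even ys ns) = of_nat t * val_even ys ms"
  proof (rule 3(1))
    show "pd k (ys ! w) = (if w = v then 1 else 0)" if "w < length ys" for w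
      using 3(3) [of "Suc w"] that xs by simp
  qed (use 3 xs t in auto)
  moreover have "x ^ n * (of_nat t * z) = of_nat t * (x ^ n * z)" for z
    by (metis mult.assoc mult_of_nat_commute)
  ultimately show ?case
    using 3(5) t xs sf x by (auto simp: pd_mult [of _ False] pd_power)
qed simp

section \<open>Values of polynomials at the parameters\<close>

text \<open>As constant even superfunctions the parameters are central and have zero derivatives, so
  they obey the same monomial rules as the coordinates.\<close>

definition even_gens :: "complex \<Rightarrow> complex \<Rightarrow> sfun list" where
  "even_gens a \<kappa> = [cst a, cst \<kappa>, xc 1, xc 2, xc 3]"

fun val_term :: "complex \<Rightarrow> complex \<Rightarrow> int \<times> monomial \<Rightarrow> sfun" where
  "val_term a \<kappa> (c, e, vs) = of_int c * (val_even (even_gens a \<kappa>) e * val_odd vs)"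

definition val_poly :: "complex \<Rightarrow> complex \<Rightarrow> poly_list \<Rightarrow> sfun" where
  "val_poly a \<kappa> p = sum_list (map (val_term a \<kappa>) p)"

text \<open>The value 1 of \<open>Even v\<close> for v beyond the five variables matches
  \<open>normalize\<close>, which assigns it the zero exponent vector.\<close>

fun val_exp :: "complex \<Rightarrow> complex \<Rightarrow> sexp \<Rightarrow> sfun" where
  "val_exp a \<kappa> (Even v) = (if v < 5 then even_gens a \<kappa> ! v else 1)"
| "val_exp a \<kappa> (Odd v) = odd_gen v"
| "val_exp a \<kappa> (Const c) = of_int c"
| "val_exp a \<kappa> (Add e f) = val_exp a \<kappa> e + val_exp a \<kappa> f"
| "val_exp a \<kappa> (Sub e f) = val_exp a \<kappa> e - val_exp a \<kappa> f"
| "val_exp a \<kappa> (Mul e f) = val_exp a \<kappa> e * val_exp a \<kappa> f"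

definition val_field :: "complex \<Rightarrow> complex \<Rightarrow> poly_list list \<Rightarrow> vf" where
  "val_field a \<kappa> P = (\<lambda>k. val_poly a \<kappa> (P ! coord_index k))"

context
  fixes a \<kappa> :: complex
begin

lemma even_gens_good: "x \<in> set (even_gens a \<kappa>) \<Longrightarrow> homog False x \<and> x \<in> superfunctions"
  by (auto simp: even_gens_def)

lemma val_poly_simps [simp]: "val_poly a \<kappa> [] = 0" "val_poly a \<kappa> (t # p) = val_term a \<kappa> t + val_poly a \<kappa> p"
  by (simp_all add: val_poly_def)

lemma val_gens_superfunction: "val_even (even_gens a \<kappa>) e \<in> superfunctions"
  by (rule val_even_superfunction) (use even_gens_good in blast)

lemma val_gens_homog: "homog False (val_even (even_gens a \<kappa>) e)"
  by (rule val_even_homog) (use even_gens_good in blast)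

lemma of_int_superfunction: "of_int c \<in> superfunctions"
  by (metis cst_of_int cst_superfunction)

lemma homog_of_int: "homog False (of_int c)"
  by (metis cst_of_int homog_cst)

lemma pd_of_int_mult: "F \<in> superfunctions \<Longrightarrow> pd k (of_int c * F) = of_int c * pd k F"
  by (metis cst_of_int pd_cst_mult)

lemma val_term_superfunction: "val_term a \<kappa> t \<in> superfunctions"
  by (cases t) (auto intro!: sf_mult of_int_superfunction val_gens_superfunction val_odd_superfunction)

lemma val_poly_superfunction: "val_poly a \<kappa> p \<in> superfunctions"
  by (induction p) (auto intro!: sf_add val_term_superfunction)

lemma val_term_zero: "val_term a \<kappa> (0, m) = 0"
  by (cases m) simp

lemma val_add_term: "val_poly a \<kappa> (add_term t p) = val_term a \<kappa> t + val_poly a \<kappa> p"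
proof (induction t p rule: add_term.induct)
  case (2 c m d n p)
  have "val_term a \<kappa> (c, m) + val_term a \<kappa> (d, m) = val_term a \<kappa> (c + d, m)"
    by (cases m) (simp add: distrib_right)
  then have *: "val_term a \<kappa> (c, m) + (val_term a \<kappa> (d, m) + val_poly a \<kappa> p) = val_term a \<kappa> (c + d, m) + val_poly a \<kappa> p"
    by (simp flip: add.assoc)
  then show ?case
    using 2 val_term_zero [of m] by (auto simp: add.left_commute)
qed simp

lemma val_add_poly: "val_poly a \<kappa> (add_poly p q) = val_poly a \<kappa> p + val_poly a \<kappa> q"
  by (induction p q rule: add_poly.induct) (simp_all add: val_add_term add.assoc)

lemma val_neg_poly: "val_poly a \<kappa> (neg_poly p) = - val_poly a \<kappa> p"
  by (induction p) (auto simp: neg_poly_def)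

text \<open>Even monomials are central, so the sign comes solely from reordering the odd
  variables.\<close>

lemma val_term_mult:
  assumes "mul_odd vs ws = (s, us)"
  shows "val_term a \<kappa> (c, e, vs) * val_term a \<kappa> (d, f, ws) = val_term a \<kappa> (s * c * d, add_exponents e f, us)"
proof -
  let ?E = "val_even (even_gens a \<kappa>) e" and ?F = "val_even (even_gens a \<kappa>) f"
  have F: "val_odd vs * (?F * z) = ?F * (val_odd vs * z)" for z
    using even_central [OF val_gens_homog, of f "val_odd vs"] by (metis mult.assoc)
  have i: "?E * (of_int n * z) = of_int n * (?E * z)" "?F * (of_int n * z) = of_int n * (?F * z)"
      "val_odd vs * (of_int n * z) = of_int n * (val_odd vs * z)" for n and z :: sfun
    by (rule of_int_left_commute)+
  have "val_term a \<kappa> (c, e, vs) * val_term a \<kappa> (d, f, ws) =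
      of_int c * (of_int d * (?E * (?F * (val_odd vs * val_odd ws))))"
    by (simp add: mult.assoc F i)
  also have "\<dots> = of_int c * (of_int d * (of_int s * (?E * (?F * val_odd us))))"
    using val_mul_odd [OF assms] by (simp add: i)
  also have "\<dots> = of_int (c * d * s) * ((?E * ?F) * val_odd us)"
    by (simp add: mult.assoc)
  also have "c * d * s = s * c * d" by simp
  also have "?E * ?F = val_even (even_gens a \<kappa>) (add_exponents e f)"
    using even_gens_good by (simp add: val_add_exponents)
  finally show ?thesis by simp
qed

lemma val_mul_term_add: "val_poly a \<kappa> (mul_term_add t q r) = val_term a \<kappa> t * val_poly a \<kappa> q + val_poly a \<kappa> r"
proof (induction t q r rule: mul_term_add.induct)
  case (2 c e vs d f ws q r)
  obtain s us where s: "mul_odd vs ws = (s, us)" by fastforce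
  then have "val_term a \<kappa> (c, e, vs) * val_term a \<kappa> (d, f, ws) = val_term a \<kappa> (s * c * d, add_exponents e f, us)"
    by (rule val_term_mult)
  with 2 s show ?case
    by (auto simp: val_add_term val_term_zero distrib_left add.assoc simp del: val_term.simps) 
qed simp

lemma val_mul_add: "val_poly a \<kappa> (mul_add p q r) = val_poly a \<kappa> p * val_poly a \<kappa> q + val_poly a \<kappa> r"
  by (induction p q r rule: mul_add.induct)
    (simp_all add: val_mul_term_add distrib_right add.assoc del: val_term.simps)

lemma val_normalize: "val_poly a \<kappa> (normalize e) = val_exp a \<kappa> e"
proof (induction e)
  case (Even v)
  have "v = 0 \<or> v = 1 \<or> v = 2 \<or> v = 3 \<or> v = 4 \<or> \<not> v < 5" by auto
  then show ?case
    by (auto simp: even_gens_def upt_conv_Cons)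
qed (simp_all add: val_add_poly val_neg_poly val_mul_add even_gens_def)

lemma val_deriv_even_poly:
  assumes "c < 3"
  shows "pd (coords ! c) (val_poly a \<kappa> p) = val_poly a \<kappa> (deriv_even_poly (c + 2) p)"
proof -
  let ?k = "coords ! c"
  obtain i where k: "?k = Inl i"
    using assms by (auto simp: coords_def less_Suc_eq numeral_eq_Suc)
  \<comment> \<open>The parameters occupy positions 0 and 1 of \<open>even_gens\<close>, so
    coordinate c is generator c + 2.\<close>
  have pd_gens: "pd ?k ((even_gens a \<kappa>) ! w) = (if w = c + 2 then 1 else 0)" if "w < length (even_gens a \<kappa>)" for w
    using that assms by (auto simp: coords_def even_gens_def less_Suc_eq numeral_eq_Suc pd_xc simp del: pd.simps)
  have odd: "pd ?k (val_odd vs) = 0" for vs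
    by (rule pd_val_odd_zero) (auto simp: k odd_gen_def pd_xi simp del: pd.simps)
  have *: "pd ?k (val_term a \<kappa> (d, e, vs)) = val_term a \<kappa> (int s * d, f, vs)"
    if "deriv_even (c + 2) e = (s, f)" for d e vs s f
  proof -
    have "pd ?k (val_even (even_gens a \<kappa>) e) = of_nat s * val_even (even_gens a \<kappa>) f"
      by (rule val_deriv_even [OF even_gens_good pd_gens _ that]) (use assms in \<open>auto simp: even_gens_def\<close>)
    then have "pd ?k (val_even (even_gens a \<kappa>) e * val_odd vs) = of_nat s * (val_even (even_gens a \<kappa>) f * val_odd vs)"
      using pd_mult [OF val_gens_superfunction val_gens_homog val_odd_superfunction, of ?k e vs] odd
      by (simp add: mult.assoc)
    then have "pd ?k (val_term a \<kappa> (d, e, vs)) = of_int (d * int s) * (val_even (even_gens a \<kappa>) f * val_odd vs)"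
      by (simp add: pd_of_int_mult sf_mult val_gens_superfunction val_odd_superfunction mult.assoc)
    also have "d * int s = int s * d" by simp
    finally show ?thesis by simp
  qed
  show ?thesis
  proof (induction p)
    case (Cons t p)
    obtain d e vs where t: "t = (d, e, vs)" by (cases t)
    obtain s f where s: "deriv_even (c + 2) e = (s, f)" by fastforce
    then show ?case
      using Cons * [OF s, of d vs] t
      by (auto simp: pd_add val_term_superfunction val_poly_superfunction val_term_zero simp del: val_term.simps)
  qed simp
qed

lemma val_deriv_odd_poly:
  assumes "c < 4"
  shows "pd (coords ! (c + 3)) (val_poly a \<kappa> p) = val_poly a \<kappa> (deriv_odd_poly c p)"
proof -
  let ?k = "coords ! (c + 3)"
  obtain j where k: "?k = Inr j"
    using assms by (auto simp: coords_def less_Suc_eq numeral_eq_Suc)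
  have even: "pd ?k (val_even (even_gens a \<kappa>) e) = 0" for e
    by (rule pd_val_even_zero) (auto simp: even_gens_good even_gens_def pd_xc k simp del: pd.simps)
  have *: "pd ?k (val_term a \<kappa> (d, e, vs)) = val_term a \<kappa> (s * d, e, ws)"
    if "deriv_odd c vs = (s, ws)" for d e vs s ws
  proof -
    have "val_even (even_gens a \<kappa>) e * (of_int s * val_odd ws) = of_int s * (val_even (even_gens a \<kappa>) e * val_odd ws)"
      by (rule of_int_left_commute)
    then have "pd ?k (val_even (even_gens a \<kappa>) e * val_odd vs) = of_int s * (val_even (even_gens a \<kappa>) e * val_odd ws)"
      using pd_mult [OF val_gens_superfunction val_gens_homog val_odd_superfunction, of ?k e vs]
        val_deriv_odd [OF that assms] even by simp
    then have "pd ?k (val_term a \<kappa> (d, e, vs)) = of_int (d * s) * (val_even (even_gens a \<kappa>) e * val_odd ws)"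
      by (simp add: pd_of_int_mult sf_mult val_gens_superfunction val_odd_superfunction mult.assoc)
    also have "d * s = s * d" by simp
    finally show ?thesis by simp
  qed
  show ?thesis
  proof (induction p)
    case (Cons t p)
    obtain d e vs where t: "t = (d, e, vs)" by (cases t)
    obtain s f where s: "deriv_odd c vs = (s, f)" by fastforce
    then show ?case
      using Cons * [OF s, of d e] t
      by (auto simp: pd_add val_term_superfunction val_poly_superfunction val_term_zero simp del: val_term.simps)
  qed simp
qed

lemma val_deriv_poly:
  assumes "c < 7"
  shows "pd (coords ! c) (val_poly a \<kappa> p) = val_poly a \<kappa> (deriv_poly c p)"
proof (cases "c < 3")
  case True
  then show ?thesis using val_deriv_even_poly by (simp only: deriv_poly_def if_True)
next
  case False
  then have "c - 3 < 4" "c - 3 + 3 = c" using assms by auto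
  with val_deriv_odd_poly [of "c - 3" p] False show ?thesis
    by (simp only: deriv_poly_def if_False)
qed

lemma val_apply_poly:
  assumes "c + length gs \<le> 7"
  shows "val_poly a \<kappa> (apply_poly c gs f r) = (\<Sum>i<length gs. val_poly a \<kappa> (gs ! i) * pd (coords ! (c + i)) (val_poly a \<kappa> f)) + val_poly a \<kappa> r"
  using assms
proof (induction c gs f r rule: apply_poly.induct)
  case (2 c g gs f r)
  then have IH: "val_poly a \<kappa> (apply_poly (Suc c) gs f r) =
      (\<Sum>i<length gs. val_poly a \<kappa> (gs ! i) * pd (coords ! (Suc c + i)) (val_poly a \<kappa> f)) + val_poly a \<kappa> r"
    by (intro 2(1)) (simp only: list.size add_Suc_right add_Suc)
  have "(\<Sum>i<length (g # gs). val_poly a \<kappa> ((g # gs) ! i) * pd (coords ! (c + i)) (val_poly a \<kappa> f)) =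
      val_poly a \<kappa> g * pd (coords ! c) (val_poly a \<kappa> f) + (\<Sum>i<length gs. val_poly a \<kappa> (gs ! i) * pd (coords ! (Suc c + i)) (val_poly a \<kappa> f))"
    unfolding length_Cons sum.lessThan_Suc_shift by simp
  moreover have "pd (coords ! c) (val_poly a \<kappa> f) = val_poly a \<kappa> (deriv_poly c f)"
    using 2(2) by (intro val_deriv_poly) simp
  ultimately show ?case
    using IH by (simp only: apply_poly.simps val_mul_add add.assoc)
qed simp

lemma val_field_coords: "c < 7 \<Longrightarrow> val_field a \<kappa> P (coords ! c) = val_poly a \<kappa> (P ! c)"
  by (simp add: val_field_def coord_index_nth)

lemma vf_apply_val_field:
  "length P = 7 \<Longrightarrow> vf_apply (val_field a \<kappa> P) (val_poly a \<kappa> f) = val_poly a \<kappa> (apply_poly 0 P f []) "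
  by (simp add: vf_apply_def sum_coord val_field_coords val_apply_poly)

text \<open>The bridge between the bracket of vector fields and the list computation. Homogeneity
  reduces the sum over parities in \<open>vf_bracket\<close> to a single term.\<close>

lemma val_bracket_poly:
  assumes "val_field a \<kappa> P \<in> homogeneous_vector_fields p" "val_field a \<kappa> Q \<in> homogeneous_vector_fields q"
    and "length P = 7" "length Q = 7" "c < 7"
  shows "vf_bracket (val_field a \<kappa> P) (val_field a \<kappa> Q) (coords ! c) = val_poly a \<kappa> (bracket_poly (p \<and> q) P Q c)"
proof -
  let ?S = "apply_poly 0 Q (P ! c) []"
  have "val_poly a \<kappa> (apply_poly 0 P (Q ! c) r) = val_poly a \<kappa> (apply_poly 0 P (Q ! c) []) + val_poly a \<kappa> r" for r
    using assms(3) by (simp add: val_apply_poly)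
  from this [of ?S] this [of "neg_poly ?S"]
  have "val_poly a \<kappa> (bracket_poly (p \<and> q) P Q c) =
      val_poly a \<kappa> (apply_poly 0 P (Q ! c) []) - sgn_if (p \<and> q) * val_poly a \<kappa> ?S"
    by (simp add: bracket_poly_def val_neg_poly)
  then show ?thesis
    by (simp only: vf_bracket_homogeneous [OF assms(1,2)] val_field_coords [OF assms(5)]
        vf_apply_val_field [OF assms(3)] vf_apply_val_field [OF assms(4)])
qed

end

definition poly_parity :: "bool \<Rightarrow> poly_list \<Rightarrow> bool" where
  "poly_parity p f \<longleftrightarrow> list_all (\<lambda>(c, e, vs). odd (length vs) = p) f"

definition field_parity :: "bool \<Rightarrow> poly_list list \<Rightarrow> bool" where
  "field_parity p P \<longleftrightarrow> length P = 7 \<and> list_all (\<lambda>c. poly_parity (p \<noteq> (3 \<le> c)) (P ! c)) [0..<7]"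

lemma homog_val_poly: "poly_parity p f \<Longrightarrow> homog p (val_poly a \<kappa> f)"
proof (induction f)
  case (Cons t f)
  obtain c e vs where t: "t = (c, e, vs)" by (cases t)
  with Cons have vs: "odd (length vs) = p" by (simp add: poly_parity_def)
  have "homog p (val_even (even_gens a \<kappa>) e * val_odd vs)"
    using homog_mult [OF val_gens_homog [of a \<kappa> e] val_odd_homog [of vs]] vs by simp
  from homog_mult [OF homog_of_int this, of c]
  have "homog p (val_term a \<kappa> t)" by (simp add: t)
  then show ?case
    using Cons by (simp add: sf_part_add poly_parity_def del: val_term.simps)
qed simp

lemma homogeneous_val_field:
  assumes "field_parity p P"
  shows "val_field a \<kappa> P \<in> homogeneous_vector_fields p"
proof (rule homogeneous_vector_fieldsI)
  fix k
  show "val_field a \<kappa> P k \<in> superfunctions"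
    by (simp add: val_field_def val_poly_superfunction)
  have "poly_parity (p \<noteq> (3 \<le> coord_index k)) (P ! coord_index k)"
    using assms coord_index_less [of k] by (auto simp: field_parity_def list_all_iff)
  moreover have "(3 \<le> coord_index k) = coord_parity k"
    using coord_parity_coords [OF coord_index_less, of k] by (simp add: coords_nth)
  ultimately show "homog (p \<noteq> coord_parity k) (val_field a \<kappa> P k)"
    unfolding val_field_def by (intro homog_val_poly) simp
qed

text \<open>The augmentation at the origin: a ring homomorphism to the complex numbers that kills
  all seven coordinates and fixes constants.\<close>

definition origin_value :: "sfun \<Rightarrow> complex" where
  "origin_value F = gcoeff (F 0) {}"

lemma origin_value_add [simp]: "origin_value (F + G) = origin_value F + origin_value G"
  by (simp add: origin_value_def fun_apply_simps)

lemma origin_value_mult [simp]: "origin_value (F * G) = origin_value F * origin_value G"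
  by (simp add: origin_value_def gcoeff_mult shuffle_sign_def fun_apply_simps)

lemma origin_value_gens [simp]:
  "origin_value 0 = 0" "origin_value 1 = 1" "origin_value (cst c) = c" "origin_value (xc i) = 0" "origin_value (odd_gen v) = 0"
  by (simp_all add: origin_value_def cst_def xc_def odd_gen_def \<xi>_def one_grassmann.rep_eq fun_apply_simps)

lemma origin_value_of_int [simp]: "origin_value (of_int n) = of_int n"
  using origin_value_gens(3) [of "of_int n"] by (simp only: cst_of_int)

lemma origin_value_power [simp]: "origin_value (F ^ n) = origin_value F ^ n"
  by (induction n) simp_all

text \<open>Selects the monomials that may survive at the origin. The first two exponents belong to
  a and \<kappa> and are unrestricted; exponent lists of any other length are kept as a safe
  default.\<close>

fun origin_term :: "int \<times> monomial \<Rightarrow> bool" where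
  "origin_term (c, e, v # vs) \<longleftrightarrow> False"
| "origin_term (c, [i, j, k, l, m], []) \<longleftrightarrow> k = 0 \<and> l = 0 \<and> m = 0"
| "origin_term (c, e, []) \<longleftrightarrow> True"

lemma origin_value_val_odd [simp]: "origin_value (val_odd (v # vs)) = 0"
  by simp

lemma origin_value_filter:
  "origin_value (val_poly a \<kappa> p) = origin_value (val_poly a \<kappa> (filter origin_term p))"
proof (induction p)
  case (Cons t p)
  have "origin_value (val_term a \<kappa> t) = 0" if "\<not> origin_term t"
    using that by (cases t rule: origin_term.cases) (auto simp: even_gens_def power_0_left)
  with Cons show ?case by (simp del: val_term.simps)
qed simp

section \<open>The vector fields as polynomials\<close>

text \<open>The ninth field is \<open>u\<^sub>3\<^sup>+\<close> divided by its overall factor \<open>a(\<kappa> + 1)\<close>; the components are listed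
  in the order of \<^const>\<open>coords\<close>.\<close>

definition fields :: "sexp list list" where
  "fields = (let A = Even 0; K = Even 1; X1 = Even 2; X2 = Even 3; X3 = Even 4;
      Q1 = Odd 0; Q2 = Odd 1; Q3 = Odd 2; Q4 = Odd 3 in
    [[1, 0, K * Q1 * Q3, 0, Q1, 0, X2 * Q1],
     [0, 1, Q1 * Q2, 0, 0, Q1, X1 * Q1],
     [0, 0, K + 1, 0, 0, 0, 0],
     [X1, 0, X3, 0, Q2, 0, Q4],
     [0, X2, X3, 0, 0, Q3, Q4],
     [0, 0, (1 + 1) * X3, Q1, Q2, Q3, Q4],
     [X1 * X1, 0, - (K * Q2 * (X1 * Q3 - Q4)), - Q2, 0, - (X2 * Q2 + X1 * Q3 - Q4),
      - (X1 * (X2 * Q2 - Q4))],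
     [0, X2 * X2, - (Q3 * (X2 * Q2 - Q4)), - Q3, - (X2 * Q2 + X1 * Q3 - Q4), 0,
      - (X2 * (X1 * Q3 - Q4))],
     [(A + 1) * (X1 * X2 * Q1 * Q2 - X1 * Q1 * Q4 + Q2 * Q4),
      (A * K - 1) * (X1 * X2 * Q1 * Q3 - X2 * Q1 * Q4 + Q3 * Q4),
      (K + 1) * Q1 * Q2 * Q3 * Q4 + A * (X3 * X3),
      Q1 * (A * X3 - Q2 * Q3),
      (A * K - 1) * Q1 * Q2 * (X1 * Q3 - Q4) + A * X3 * Q2,
      - ((A + 1) * Q1 * (X2 * Q2 * Q3 + Q3 * Q4) - A * X3 * Q3),
      Q4 * (A * X3 - Q2 * Q3)],
     [0, 0, 0, 1, 0, 0, 0],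
     [0, 0, K * Q3, 0, 1, 0, X2],
     [0, 0, Q2, 0, 0, 1, X1],
     [0, 0, (K + 1) * Q1, 0, 0, 0, 1],
     [(A + 1) * (X1 * Q1 - Q2), (A * K - 1) * (X2 * Q1 - Q3), A * (K + 1) * X3 * Q1,
      0, (A + 1) * Q1 * Q2, (A * K - 1) * Q1 * Q3, A * X3 + A * (K + 1) * Q1 * Q4 - Q2 * Q3],
     [- ((A + 1) * X1 * (X1 * Q1 - Q2)), (A * K - 1) * (X1 * Q3 - Q4),
      (A + 1) * K * Q1 * (X1 * Q2 * Q3 - Q2 * Q4) - A * X3 * Q2,
      (A + 1) * Q1 * Q2, 0,
      (A + 1) * Q1 * (X2 * Q2 + X1 * Q3 - Q4) - A * (X3 + Q2 * Q3),
      X1 * ((A + 1) * Q1 * (X2 * Q2 - Q4) + Q2 * Q3 - A * X3)],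
     [(A + 1) * (X2 * Q2 - Q4), - ((A * K - 1) * X2 * (X2 * Q1 - Q3)),
      - ((A * K - 1) * Q3 * (X2 * Q1 * Q2 - Q1 * Q4) + A * K * X3 * Q3),
      (A * K - 1) * Q1 * Q3,
      (A * K - 1) * Q1 * (X2 * Q2 + X1 * Q3 - Q4) + A * (K * Q2 * Q3 - X3), 0,
      X2 * ((A * K - 1) * Q1 * (X1 * Q3 - Q4) + Q2 * Q3 - A * X3)],
     [- ((A + 1) * X1 * (X2 * Q2 - Q4)), - ((A * K - 1) * X2 * (X1 * Q3 - Q4)),
      - ((K + 1) * Q2 * Q3 * Q4),
      Q2 * Q3 - A * X3, - ((A * K - 1) * Q2 * (X1 * Q3 - Q4)),
      - ((A + 1) * Q3 * (X2 * Q2 - Q4)), 0]])"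

text \<open>An entry \<open>(j, k, e)\<close> in row \<open>i\<close> is a term \<open>e F\<^sub>k\<close> of the bracket \<open>[F\<^sub>i, F\<^sub>j]\<close> of fields.\<close>

definition structure_constants :: "(nat \<times> nat \<times> sexp) list list" where
  "structure_constants = (let A = Even 0; K = Even 1 in
    [[(3, 0, 1), (6, 3, 1 + 1), (6, 5, - 1), (9, 10, - 1), (11, 12, 1), (14, 13, - 1),
       (16, 15, - 1)],
     [(4, 1, 1), (7, 4, 1 + 1), (7, 5, - 1), (9, 11, - 1), (10, 12, 1), (15, 13, - 1),
       (16, 14, - 1)],
     [(3, 2, 1), (4, 2, 1), (5, 2, 1 + 1), (8, 5, A * (K + 1)), (13, 12, A * (K + 1)),
       (14, 11, - (A * (K + 1))), (15, 10, - (A * (K + 1))), (16, 9, - (A * (K + 1)))],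
     [(0, 0, - 1), (2, 2, - 1), (6, 6, 1), (8, 8, 1), (10, 10, - 1), (12, 12, - 1), (14, 14, 1),
       (16, 16, 1)],
     [(1, 1, - 1), (2, 2, - 1), (7, 7, 1), (8, 8, 1), (11, 11, - 1), (12, 12, - 1), (15, 15, 1),
       (16, 16, 1)],
     [(2, 2, - (1 + 1)), (8, 8, 1 + 1), (9, 9, - 1), (10, 10, - 1), (11, 11, - 1),
       (12, 12, - 1), (13, 13, 1), (14, 14, 1), (15, 15, 1), (16, 16, 1)],
     [(0, 3, - (1 + 1)), (0, 5, 1), (3, 6, - 1), (10, 9, 1), (12, 11, - 1), (13, 14, 1),
       (15, 16, 1)],
     [(1, 4, - (1 + 1)), (1, 5, 1), (4, 7, - 1), (11, 9, 1), (12, 10, - 1), (13, 15, 1),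
       (14, 16, 1)],
     [(2, 5, - (A * (K + 1))), (3, 8, - 1), (4, 8, - 1), (5, 8, - (1 + 1)), (9, 16, 1),
       (10, 15, 1), (11, 14, 1), (12, 13, - 1)],
     [(0, 10, 1), (1, 11, 1), (5, 9, 1), (8, 16, - 1), (12, 2, 1), (13, 3, A + 1),
       (13, 4, A * K - 1), (14, 6, - (A + 1)), (15, 7, 1 - A * K)],
     [(1, 12, - 1), (3, 10, 1), (5, 10, 1), (6, 9, - 1), (8, 15, - 1), (11, 2, 1),
       (13, 0, - (A + 1)), (14, 3, A + 1), (14, 4, 1 - A * K), (14, 5, - (A + 1)),
       (16, 7, A * K - 1)],
     [(0, 12, - 1), (4, 11, 1), (5, 11, 1), (7, 9, - 1), (8, 14, - 1), (10, 2, 1),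
       (13, 1, 1 - A * K), (15, 3, - (A + 1)), (15, 4, A * K - 1), (15, 5, 1 - A * K),
       (16, 6, A + 1)],
     [(3, 12, 1), (4, 12, 1), (5, 12, 1), (6, 11, 1), (7, 10, 1), (8, 13, 1), (9, 2, 1),
       (14, 1, 1 - A * K), (15, 0, - (A + 1)), (16, 3, A + 1), (16, 4, A * K - 1),
       (16, 5, - (A * (K + 1)))],
     [(2, 12, - (A * (K + 1))), (5, 13, - 1), (6, 14, - 1), (7, 15, - 1), (9, 3, A + 1),
       (9, 4, A * K - 1), (10, 0, - (A + 1)), (11, 1, 1 - A * K), (16, 8, - (A * (K + 1)))],
     [(0, 13, 1), (2, 11, A * (K + 1)), (3, 14, - 1), (5, 14, - 1), (7, 16, - 1),
       (9, 6, - (A + 1)), (10, 3, A + 1), (10, 4, 1 - A * K), (10, 5, - (A + 1)),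
       (12, 1, 1 - A * K), (15, 8, A * (K + 1))],
     [(1, 13, 1), (2, 10, A * (K + 1)), (4, 15, - 1), (5, 15, - 1), (6, 16, - 1),
       (9, 7, 1 - A * K), (11, 3, - (A + 1)), (11, 4, A * K - 1), (11, 5, 1 - A * K),
       (12, 0, - (A + 1)), (14, 8, A * (K + 1))],
     [(0, 15, 1), (1, 14, 1), (2, 9, A * (K + 1)), (3, 16, - 1), (4, 16, - 1), (5, 16, - 1),
       (10, 7, A * K - 1), (11, 6, A + 1), (12, 3, A + 1), (12, 4, A * K - 1),
       (12, 5, - (A * (K + 1))), (13, 8, - (A * (K + 1)))]])"

definition dist_fields :: "sexp list list" where
  "dist_fields = (let K = Even 1; X1 = Even 2; X2 = Even 3;
      Q2 = Odd 1; Q3 = Odd 2; Q4 = Odd 3 in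
    [[1, 0, 0, 0, 0, 0, Q3],
     [0, 1, 0, 0, 0, 0, Q2],
     [0, 0, K * X1 * Q3 + X2 * Q2 - (K + 1) * Q4, 1, X1, X2, X1 * X2]])"

section \<open>Finite checks of parities, brackets and symmetries\<close>

definition field_poly :: "nat \<Rightarrow> poly_list list" where
  "field_poly i = map normalize (fields ! i)"

definition dist_poly :: "nat \<Rightarrow> poly_list list" where
  "dist_poly d = map normalize (dist_fields ! d)"

fun expected_bracket :: "(nat \<times> nat \<times> sexp) list \<Rightarrow> nat \<Rightarrow> nat \<Rightarrow> poly_list" where
  "expected_bracket [] j c = []"
| "expected_bracket ((j', k, e) # r) j c = (if j' = j
     then mul_add (normalize e) (field_poly k ! c) (expected_bracket r j c) else expected_bracket r j c)"

text \<open>Fields 0 to 8 are even and 9 to 16 odd, which explains the sign flag.\<close>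

fun bracket_ok :: "poly_list list \<Rightarrow> poly_list list \<Rightarrow> nat \<Rightarrow> nat \<Rightarrow> bool" where
  "bracket_ok P Q i j \<longleftrightarrow> list_all (\<lambda>c. add_poly (bracket_poly (9 \<le> i \<and> 9 \<le> j) P Q c)
     (neg_poly (expected_bracket (structure_constants ! i) j c)) = []) [0..<7]"

definition row_ok :: "nat \<Rightarrow> bool" where
  "row_ok i \<longleftrightarrow> list_all (\<lambda>j. bracket_ok (field_poly i) (field_poly j) i j) [0..<17]"

text \<open>If the generator Y has component 1 at position l, then the factor g in [X, Y] = g Y can
  only be component l of the bracket; proportionality with this factor is tested. The positions used
  are 0, 1 and 3, for the derivatives along x1, x2 and \<xi>1.\<close>

fun symmetry_ok :: "poly_list list \<Rightarrow> poly_list list \<Rightarrow> bool \<Rightarrow> nat \<Rightarrow> bool" where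
  "symmetry_ok P Q s l \<longleftrightarrow> list_all (\<lambda>c. add_poly (mul_add (bracket_poly s P Q l) (Q ! c) [])
     (neg_poly (bracket_poly s P Q c)) = []) [0..<7]"

lemma field_parity_fields: "list_all (\<lambda>i. field_parity (9 \<le> i) (field_poly i)) [0..<17]"
  by code_simp

lemma field_parity_dist_fields: "list_all (\<lambda>d. field_parity (d = 2) (dist_poly d)) [0..<3]"
  by code_simp

lemma symmetry_ok_0: "list_all (\<lambda>i. symmetry_ok (field_poly i) (dist_poly 0) False 0) [0..<17]"
  by code_simp

lemma symmetry_ok_1: "list_all (\<lambda>i. symmetry_ok (field_poly i) (dist_poly 1) False 1) [0..<17]"
  by code_simp

lemma symmetry_ok_2: "list_all (\<lambda>i. symmetry_ok (field_poly i) (dist_poly 2) (9 \<le> i) 3) [0..<17]"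
  by code_simp

lemma row_ok_0: "row_ok 0" by code_simp
lemma row_ok_1: "row_ok 1" by code_simp
lemma row_ok_2: "row_ok 2" by code_simp
lemma row_ok_3: "row_ok 3" by code_simp
lemma row_ok_4: "row_ok 4" by code_simp
lemma row_ok_5: "row_ok 5" by code_simp
lemma row_ok_6: "row_ok 6" by code_simp
lemma row_ok_7: "row_ok 7" by code_simp
lemma row_ok_8: "row_ok 8" by code_simp
lemma row_ok_9: "row_ok 9" by code_simp
lemma row_ok_10: "row_ok 10" by code_simp
lemma row_ok_11: "row_ok 11" by code_simp
lemma row_ok_12: "row_ok 12" by code_simp
lemma row_ok_13: "row_ok 13" by code_simp
lemma row_ok_14: "row_ok 14" by code_simp
lemma row_ok_15: "row_ok 15" by code_simp
lemma row_ok_16: "row_ok 16" by code_simp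

section \<open>Identification of the listed fields with their polynomial forms\<close>

lemma val_exp_ops [simp]:
  "val_exp a \<kappa> (e + f) = val_exp a \<kappa> e + val_exp a \<kappa> f"
  "val_exp a \<kappa> (e - f) = val_exp a \<kappa> e - val_exp a \<kappa> f"
  "val_exp a \<kappa> (e * f) = val_exp a \<kappa> e * val_exp a \<kappa> f"
  "val_exp a \<kappa> (- e) = - val_exp a \<kappa> e"
  "val_exp a \<kappa> 0 = 0"
  "val_exp a \<kappa> 1 = 1"
  by (simp_all add: plus_sexp_def minus_sexp_def times_sexp_def uminus_sexp_def zero_sexp_def one_sexp_def)

definition field :: "complex \<Rightarrow> complex \<Rightarrow> nat \<Rightarrow> vf" where
  "field a \<kappa> i = val_field a \<kappa> (field_poly i)"

lemma val_field_exp: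
  assumes "length es = 7"
  shows "val_field a \<kappa> (map normalize es) k = val_exp a \<kappa> (es ! coord_index k)"
  using assms coord_index_less [of k] by (simp add: val_field_def val_normalize)

lemma vf_eqI:
  assumes "length es = 7"
    and "\<forall>i. X (Inl i) = val_exp a \<kappa> (es ! coord_index (Inl i))"
    and "\<forall>j. X (Inr j) = val_exp a \<kappa> (es ! coord_index (Inr j))"
  shows "X = val_field a \<kappa> (map normalize es)"
proof
  fix k
  show "X k = val_field a \<kappa> (map normalize es) k"
    unfolding val_field_exp [OF assms(1)] using assms(2,3) by (cases k) (simp_all only:)
qed

lemma cst_diff: "cst (c - d) = cst c - cst d"
  using cst_add [of c "- d"] by (simp add: cst_minus)

lemma odd_gen_simps: "odd_gen 0 = \<xi> 1" "odd_gen (Suc 0) = \<xi> 2" "odd_gen 2 = \<xi> 3" "odd_gen 3 = \<xi> 4"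
  by (simp_all add: odd_gen_def)

lemma u3p_factor:
  "cst (a * (a + 1) * (\<kappa> + 1)) = cst (a * (\<kappa> + 1)) * cst (a + 1)"
  "cst (a * (a * \<kappa> - 1) * (\<kappa> + 1)) = cst (a * (\<kappa> + 1)) * cst (a * \<kappa> - 1)"
  by (simp_all add: mult_ac flip: cst_mult)

text \<open>In several of these equations a occurs only on the right, so it is fixed by
  instantiation where they are used for rewriting.\<close>

lemma field_eqs:
  "u1m \<kappa> = field a \<kappa> 0" "u2m = field a \<kappa> 1" "u3m \<kappa> = field a \<kappa> 2"
  "u1z = field a \<kappa> 3" "u2z = field a \<kappa> 4" "u3z = field a \<kappa> 5"
  "u1p \<kappa> = field a \<kappa> 6" "u2p = field a \<kappa> 7"
  "v1m = field a \<kappa> 9" "v2m \<kappa> = field a \<kappa> 10" "v3m = field a \<kappa> 11" "v4m \<kappa> = field a \<kappa> 12"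
  "v1p a \<kappa> = field a \<kappa> 13" "v2p a \<kappa> = field a \<kappa> 14" "v3p a \<kappa> = field a \<kappa> 15"
  "v4p a \<kappa> = field a \<kappa> 16"
  unfolding field_def field_poly_def
  by (rule vf_eqI;
      simp add: forall_3 forall_4 vf_x_def vf_xi_def fields_def even_gens_def odd_gen_simps Let_def
        cst_add cst_diff cst_mult power2_eq_square fun_apply_simps mult.assoc
        u1m_def u2m_def u3m_def u1z_def u2z_def u3z_def u1p_def u2p_def v1m_def v2m_def v3m_def
        v4m_def v1p_def v2p_def v3p_def v4p_def)+

lemma u3p_eq: "u3p a \<kappa> = vf_scale (cst (a * (\<kappa> + 1))) (field a \<kappa> 8)"
proof -
  let ?c = "cst (a * (\<kappa> + 1))"
  let ?es = "fields ! 8"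
  have l: "length ?es = 7" by (simp add: fields_def Let_def)
  \<comment> \<open>The restricted instances of \<open>cst_add\<close> and \<open>cst_mult\<close>
    leave the common factor \<open>cst (a * (\<kappa> + 1))\<close> intact, so that it can be
    matched on both sides.\<close>
  note simps = vf_x_def vf_xi_def fields_def even_gens_def odd_gen_simps Let_def
    cst_add [of a] cst_add [of \<kappa>] cst_diff cst_mult [of a \<kappa>] power2_eq_square fun_apply_simps mult.assoc
  have "\<forall>i. u3p a \<kappa> (Inl i) = ?c * val_exp a \<kappa> (?es ! coord_index (Inl i))"
    unfolding u3p_factor u3p_def by (simp add: forall_3 simps)
  moreover have "\<forall>j. u3p a \<kappa> (Inr j) = ?c * val_exp a \<kappa> (?es ! coord_index (Inr j))"
    unfolding u3p_factor u3p_def by (simp add: forall_4 simps flip: mult_minus_right)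
  ultimately have "u3p a \<kappa> k = ?c * val_exp a \<kappa> (?es ! coord_index k)" for k
    by (cases k) simp_all
  then show ?thesis
    by (intro ext) (simp only: field_def field_poly_def val_field_exp [OF l] vf_scale_apply)
qed

lemma dist_field_eqs:
  "D1 = val_field a \<kappa> (dist_poly 0)" "D2 = val_field a \<kappa> (dist_poly 1)" "D3 \<kappa> = val_field a \<kappa> (dist_poly 2)"
  unfolding dist_poly_def
  by (rule vf_eqI;
      simp add: forall_3 forall_4 vf_x_def vf_xi_def dist_fields_def even_gens_def odd_gen_simps Let_def
        cst_add cst_diff cst_mult power2_eq_square fun_apply_simps mult.assoc D1_def D2_def D3_def)+

lemma length_field_poly: "i < 17 \<Longrightarrow> length (field_poly i) = 7"
  using field_parity_fields by (auto simp: list_all_iff field_parity_def)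

lemma length_dist_poly: "d < 3 \<Longrightarrow> length (dist_poly d) = 7"
  using field_parity_dist_fields by (auto simp: list_all_iff field_parity_def)

lemma field_homogeneous: "i < 17 \<Longrightarrow> field a \<kappa> i \<in> homogeneous_vector_fields (9 \<le> i)"
  unfolding field_def
  by (rule homogeneous_val_field) (use field_parity_fields in \<open>auto simp: list_all_iff\<close>)

lemma field_vector_field: "i < 17 \<Longrightarrow> field a \<kappa> i \<in> vector_fields"
  using field_homogeneous homogeneous_vector_fieldsD(1) by blast

lemma dist_homogeneous: "d < 3 \<Longrightarrow> val_field a \<kappa> (dist_poly d) \<in> homogeneous_vector_fields (d = 2)"
  by (rule homogeneous_val_field) (use field_parity_dist_fields in \<open>auto simp: list_all_iff\<close>)

lemma vf_coords_eqI:
  assumes "\<And>c. c < 7 \<Longrightarrow> X (coords ! c) = Y (coords ! c)"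
  shows "X = (Y :: vf)"
proof
  fix k
  show "X k = Y k"
    using assms [OF coord_index_less [of k]] by (simp only: coords_nth)
qed

lemma val_poly_diff_zero: "add_poly p (neg_poly q) = [] \<Longrightarrow> val_poly a \<kappa> p = val_poly a \<kappa> q"
  using val_add_poly [of a \<kappa> p "neg_poly q"] by (simp add: val_neg_poly)

lemma symmetry_ok_bracket:
  assumes ok: "symmetry_ok (field_poly i) (dist_poly d) (9 \<le> i \<and> d = 2) l" and "i < 17" "d < 3"
  shows "\<exists>g\<in>superfunctions. vf_bracket (field a \<kappa> i) (val_field a \<kappa> (dist_poly d)) =
    vf_scale g (val_field a \<kappa> (dist_poly d))"
proof (intro bexI vf_coords_eqI)
  let ?P = "field_poly i" and ?Q = "dist_poly d"
  let ?b = "bracket_poly (9 \<le> i \<and> d = 2) ?P ?Q"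
  show "val_poly a \<kappa> (?b l) \<in> superfunctions" by (rule val_poly_superfunction)
  fix c :: nat assume c: "c < 7"
  have "val_poly a \<kappa> (mul_add (?b l) (?Q ! c) []) = val_poly a \<kappa> (?b c)"
    by (rule val_poly_diff_zero) (use ok c in \<open>auto simp: list_all_iff\<close>)
  then show "vf_bracket (field a \<kappa> i) (val_field a \<kappa> ?Q) (coords ! c) =
      vf_scale (val_poly a \<kappa> (?b l)) (val_field a \<kappa> ?Q) (coords ! c)"
    using val_bracket_poly [OF field_homogeneous [unfolded field_def, OF assms(2)] dist_homogeneous [OF assms(3)]
        length_field_poly [OF assms(2)] length_dist_poly [OF assms(3)] c, of a \<kappa>]
    by (simp add: field_def val_mul_add val_field_coords c)
qed

lemma field_symmetry:
  assumes "i < 17" "d < 3"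
  shows "preserves (field a \<kappa> i) (line_module (val_field a \<kappa> (dist_poly d)))"
proof -
  have "i \<in> set [0..<17]" using assms by simp
  then have "symmetry_ok (field_poly i) (dist_poly 0) False 0" "symmetry_ok (field_poly i) (dist_poly 1) False 1"
    "symmetry_ok (field_poly i) (dist_poly 2) (9 \<le> i) 3"
    using symmetry_ok_0 symmetry_ok_1 symmetry_ok_2 unfolding list_all_iff by blast+
  moreover have "d = 0 \<or> d = 1 \<or> d = 2" using assms by auto
  ultimately have "\<exists>l. symmetry_ok (field_poly i) (dist_poly d) (9 \<le> i \<and> d = 2) l"
    by (elim disjE) (simp_all del: symmetry_ok.simps, blast+)
  then obtain l where "symmetry_ok (field_poly i) (dist_poly d) (9 \<le> i \<and> d = 2) l" ..
  from symmetry_ok_bracket [OF this assms] obtain g where "g \<in> superfunctions"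
    "vf_bracket (field a \<kappa> i) (val_field a \<kappa> (dist_poly d)) = vf_scale g (val_field a \<kappa> (dist_poly d))" ..
  then show ?thesis
    by (rule preserves_line_module [OF field_homogeneous [OF assms(1)] dist_homogeneous [OF assms(2)]])
qed

lemma field_split_symmetry:
  assumes "i < 17"
  shows "field a \<kappa> i \<in> split_symmetries D1 D2 (D3 \<kappa>)"
proof -
  have D: "val_field a \<kappa> (dist_poly d) \<in> vector_fields" if "d < 3" for d
    using dist_homogeneous [OF that] by (rule homogeneous_vector_fieldsD(1))
  show ?thesis
    unfolding split_symmetries_def dist_field_eqs(1,2) [where a = a and \<kappa> = \<kappa>] dist_field_eqs(3) [where a = a]
    by (intro CollectI conjI preserves_distribution D field_vector_field field_symmetry assms) simp_all
qed

lemma distribution_splits: "splits_into_two_even_and_one_odd_line D1 D2 (D3 \<kappa>)"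
proof -
  have "f1 = 0 \<and> f2 = 0 \<and> f3 = 0"
    if *: "vf_scale f1 D1 + vf_scale f2 D2 + vf_scale f3 (D3 \<kappa>) = 0" for f1 f2 f3
  proof -
    have "(vf_scale f1 D1 + vf_scale f2 D2 + vf_scale f3 (D3 \<kappa>)) k = 0" for k
      unfolding * by (simp add: fun_apply_simps)
    \<comment> \<open>In the components along x1, x2 and \<xi>1 the three generators form the
      identity matrix.\<close>
    from this [of "Inl 1"] this [of "Inl 2"] this [of "Inr 1"] show ?thesis
      by (simp add: D1_def D2_def D3_def vf_x_def vf_xi_def fun_apply_simps)
  qed
  moreover have "D1 \<in> homogeneous_vector_fields False" "D2 \<in> homogeneous_vector_fields False"
    "D3 \<kappa> \<in> homogeneous_vector_fields True"
    using dist_homogeneous [of 0 0 \<kappa>] dist_homogeneous [of 1 0 \<kappa>] dist_homogeneous [of 2 0 \<kappa>]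
    by (simp_all add: dist_field_eqs(1,2) [where a = 0 and \<kappa> = \<kappa>] dist_field_eqs(3) [where a = 0])
  ultimately show ?thesis
    unfolding splits_into_two_even_and_one_odd_line_def by blast
qed

text \<open>A pair \<open>(c, ds)\<close> stands for the value at the origin of the component \<open>c\<close> after
  differentiating along the coordinates \<open>ds\<close>.\<close>

definition functionals :: "(nat \<times> nat list) list" where
  "functionals = [(0, []), (1, []), (2, []), (0, [0]), (1, [1]), (3, [3]), (3, [4]), (3, [5]), (2, [2, 2]),
     (3, []), (4, []), (5, []), (6, []), (6, [2]), (5, [2]), (4, [2]), (3, [2])]"

definition functional_diagonal :: "sexp list" where
  "functional_diagonal = (let A = Even 0; K = Even 1 in
     [1, 1, K + 1, 1, 1, 1, - 1, - 1, (1 + 1) * A, 1, 1, 1, 1, A, - A, - A, - A])"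

fun functional_poly :: "nat \<times> nat list \<Rightarrow> poly_list list \<Rightarrow> poly_list" where
  "functional_poly (c, ds) P = filter origin_term (foldr deriv_poly ds (P ! c))"

fun functional :: "nat \<times> nat list \<Rightarrow> vf \<Rightarrow> complex" where
  "functional (c, ds) X = origin_value (foldr (\<lambda>d. pd (coords ! d)) ds (X (coords ! c)))"

text \<open>Each functional reads off a Taylor coefficient that is nonzero in one field only. The
  pairing is therefore diagonal, and each coefficient of a linear combination is recovered by one
  division.\<close>

lemma functional_check:
  "list_all (\<lambda>n. list_all (\<lambda>m. add_poly (functional_poly (functionals ! n) (field_poly m))
     (neg_poly (if n = m then normalize (functional_diagonal ! n) else [])) = []) [0..<17]) [0..<17]"
  by code_simp

declare vf_scale_apply [simp del]

section \<open>Structure constants as complex numbers\<close>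

fun const_exp :: "sexp \<Rightarrow> bool" where
  "const_exp (Even v) \<longleftrightarrow> v < 2"
| "const_exp (Odd v) \<longleftrightarrow> False"
| "const_exp (Const c) \<longleftrightarrow> True"
| "const_exp (Add e f) \<longleftrightarrow> const_exp e \<and> const_exp f"
| "const_exp (Sub e f) \<longleftrightarrow> const_exp e \<and> const_exp f"
| "const_exp (Mul e f) \<longleftrightarrow> const_exp e \<and> const_exp f"

fun const_val :: "complex \<Rightarrow> complex \<Rightarrow> sexp \<Rightarrow> complex" where
  "const_val a \<kappa> (Even v) = (if v = 0 then a else \<kappa>)"
| "const_val a \<kappa> (Odd v) = 0"
| "const_val a \<kappa> (Const c) = of_int c"
| "const_val a \<kappa> (Add e f) = const_val a \<kappa> e + const_val a \<kappa> f"
| "const_val a \<kappa> (Sub e f) = const_val a \<kappa> e - const_val a \<kappa> f"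
| "const_val a \<kappa> (Mul e f) = const_val a \<kappa> e * const_val a \<kappa> f"

lemma const_val_ops [simp]:
  "const_val a \<kappa> (e + f) = const_val a \<kappa> e + const_val a \<kappa> f"
  "const_val a \<kappa> (e - f) = const_val a \<kappa> e - const_val a \<kappa> f"
  "const_val a \<kappa> (e * f) = const_val a \<kappa> e * const_val a \<kappa> f"
  "const_val a \<kappa> (- e) = - const_val a \<kappa> e"
  "const_val a \<kappa> 0 = 0"
  "const_val a \<kappa> 1 = 1"
  by (simp_all add: plus_sexp_def minus_sexp_def times_sexp_def uminus_sexp_def zero_sexp_def one_sexp_def)

lemma val_exp_const: "const_exp e \<Longrightarrow> val_exp a \<kappa> e = cst (const_val a \<kappa> e)"
proof (induction e)
  case (Even v)
  then have "v = 0 \<or> v = 1" by auto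
  then show ?case by (auto simp: even_gens_def)
qed (simp_all add: cst_add cst_diff cst_mult cst_of_int)

fun entry_ok :: "nat \<times> nat \<times> sexp \<Rightarrow> bool" where
  "entry_ok (j, k, e) \<longleftrightarrow> j < 17 \<and> k < 17 \<and> const_exp e"

lemma entries_ok: "list_all (\<lambda>i. list_all entry_ok (structure_constants ! i)) [0..<17]"
  by code_simp

lemma entry_okI: "i < 17 \<Longrightarrow> list_all entry_ok (structure_constants ! i)"
  using entries_ok by (simp only: list_all_iff set_upt atLeast0LessThan) blast

lemma functionals_ok:
  "list_all (\<lambda>(c, ds). c < 7 \<and> list_all (\<lambda>d. d < 7) ds) functionals \<and> length functionals = 17"
  by code_simp

lemma functional_diagonal_ok: "list_all const_exp functional_diagonal \<and> length functional_diagonal = 17"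
  by code_simp

lemma less_17_cases:
  "n < 17 \<Longrightarrow> n = 0 \<or> n = 1 \<or> n = 2 \<or> n = 3 \<or> n = 4 \<or> n = 5 \<or> n = 6 \<or> n = 7 \<or> n = 8 \<or> n = 9 \<or> n = 10 \<or>
    n = 11 \<or> n = 12 \<or> n = 13 \<or> n = 14 \<or> n = 15 \<or> n = (16 :: nat)"
  by presburger

lemma row_okI: "i < 17 \<Longrightarrow> row_ok i"
  by (drule less_17_cases, elim disjE) (simp_all only: row_ok_0 row_ok_1 row_ok_2 row_ok_3 row_ok_4
    row_ok_5 row_ok_6 row_ok_7 row_ok_8 row_ok_9 row_ok_10 row_ok_11 row_ok_12 row_ok_13 row_ok_14
    row_ok_15 row_ok_16)

definition entry_field :: "complex \<Rightarrow> complex \<Rightarrow> nat \<Rightarrow> nat \<times> nat \<times> sexp \<Rightarrow> vf" where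
  "entry_field a \<kappa> j = (\<lambda>(j', k, e). if j' = j then vf_scale (cst (const_val a \<kappa> e)) (field a \<kappa> k) else 0)"

lemma val_expected_bracket:
  assumes "list_all entry_ok r" "c < 7"
  shows "val_poly a \<kappa> (expected_bracket r j c) = sum_list (map (entry_field a \<kappa> j) r) (coords ! c)"
  using assms(1)
proof (induction r)
  case (Cons t r)
  obtain j' k e where t: "t = (j', k, e)" by (cases t)
  then show ?case
    using Cons assms(2)
    by (simp add: val_mul_add val_normalize val_exp_const entry_field_def field_def val_field_coords fun_apply_simps
        vf_scale_apply)
qed (simp add: fun_apply_simps)

lemma bracket_field:
  assumes "i < 17" "j < 17"
  shows "vf_bracket (field a \<kappa> i) (field a \<kappa> j) = sum_list (map (entry_field a \<kappa> j) (structure_constants ! i))"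
proof (rule vf_coords_eqI)
  fix c :: nat assume c: "c < 7"
  have "bracket_ok (field_poly i) (field_poly j) i j"
    using row_okI [OF assms(1)] assms(2) by (simp add: row_ok_def list_all_iff del: bracket_ok.simps)
  then have "val_poly a \<kappa> (bracket_poly (9 \<le> i \<and> 9 \<le> j) (field_poly i) (field_poly j) c) =
      val_poly a \<kappa> (expected_bracket (structure_constants ! i) j c)"
    using c by (intro val_poly_diff_zero) (simp add: list_all_iff)
  then show "vf_bracket (field a \<kappa> i) (field a \<kappa> j) (coords ! c) =
      sum_list (map (entry_field a \<kappa> j) (structure_constants ! i)) (coords ! c)"
    unfolding val_expected_bracket [OF entry_okI [OF assms(1)] c]
    using val_bracket_poly [OF field_homogeneous [unfolded field_def, OF assms(1)]
        field_homogeneous [unfolded field_def, OF assms(2)]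
        length_field_poly [OF assms(1)] length_field_poly [OF assms(2)] c, of a \<kappa>]
    by (simp add: field_def)
qed

section \<open>Linear combinations of the fields and their brackets\<close>

definition combination :: "complex \<Rightarrow> complex \<Rightarrow> (nat \<Rightarrow> complex) \<Rightarrow> vf" where
  "combination a \<kappa> \<alpha> = (\<Sum>i<17. vf_scale (cst (\<alpha> i)) (field a \<kappa> i))"

lemma vector_fields_sum: "(\<And>i. i \<in> I \<Longrightarrow> X i \<in> vector_fields) \<Longrightarrow> sum X I \<in> vector_fields"
  by (rule vf_subspace_sum [OF vf_subspace_vector_fields])

lemma vector_fields_scale: "X \<in> vector_fields \<Longrightarrow> vf_scale (cst c) X \<in> vector_fields"
  using vf_subspace_vector_fields by (simp add: vf_subspace_def)

lemma vf_bracket_sum_left: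
  assumes "\<And>i. i \<in> I \<Longrightarrow> X i \<in> vector_fields" "Z \<in> vector_fields"
  shows "vf_bracket (\<Sum>i\<in>I. X i) Z = (\<Sum>i\<in>I. vf_bracket (X i) Z)"
  using assms(1)
proof (induction I rule: infinite_finite_induct)
  case (insert i I)
  then show ?case
    using vf_bracket_add_left [of "X i" "sum X I" Z] vector_fields_sum [of I X] assms(2) by simp
qed simp_all

lemma vf_bracket_sum_right:
  assumes "\<And>i. i \<in> I \<Longrightarrow> X i \<in> vector_fields" "Z \<in> vector_fields"
  shows "vf_bracket Z (\<Sum>i\<in>I. X i) = (\<Sum>i\<in>I. vf_bracket Z (X i))"
  using assms(1)
proof (induction I rule: infinite_finite_induct)
  case (insert i I)
  then show ?case
    using vf_bracket_add_right [of "X i" "sum X I" Z] vector_fields_sum [of I X] assms(2) by simp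
qed simp_all

text \<open>The bilinear extension of the table of structure constants to coefficient
  vectors.\<close>

definition structure_product ::
    "complex \<Rightarrow> complex \<Rightarrow> (nat \<Rightarrow> complex) \<Rightarrow> (nat \<Rightarrow> complex) \<Rightarrow> nat \<Rightarrow> complex" where
  "structure_product a \<kappa> \<alpha> \<beta> k = (\<Sum>i<17. sum_list (map
     (\<lambda>(j, k', e). if k' = k then \<alpha> i * \<beta> j * const_val a \<kappa> e else 0) (structure_constants ! i)))"

lemma combination_add: "combination a \<kappa> (\<lambda>i. \<alpha> i + \<beta> i) = combination a \<kappa> \<alpha> + combination a \<kappa> \<beta>"
  by (simp add: combination_def cst_add vf_scale_add_left sum.distrib)

lemma combination_scale: "combination a \<kappa> (\<lambda>i. c * \<alpha> i) = vf_scale (cst c) (combination a \<kappa> \<alpha>)"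
  by (simp add: combination_def cst_mult vf_scale_sum vf_scale_scale)

lemma combination_zero: "combination a \<kappa> (\<lambda>i. 0) = 0"
  by (simp add: combination_def)

lemma combination_sum: "combination a \<kappa> (\<lambda>k. \<Sum>i\<in>I. \<alpha> i k) = (\<Sum>i\<in>I. combination a \<kappa> (\<alpha> i))"
  by (induction I rule: infinite_finite_induct) (simp_all add: combination_zero combination_add)

lemma combination_cong: "(\<And>i. i < 17 \<Longrightarrow> \<alpha> i = \<beta> i) \<Longrightarrow> combination a \<kappa> \<alpha> = combination a \<kappa> \<beta>"
  by (simp add: combination_def)

lemma combination_single:
  assumes "k < 17"
  shows "combination a \<kappa> (\<lambda>i. if k = i then c else 0) = vf_scale (cst c) (field a \<kappa> k)"
proof -
  have "combination a \<kappa> (\<lambda>i. if k = i then c else 0) = (\<Sum>i<17. if k = i then vf_scale (cst c) (field a \<kappa> k) else 0)"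
    unfolding combination_def by (intro sum.cong refl) auto
  then show ?thesis using assms by simp
qed

lemma combination_row:
  assumes "list_all entry_ok r"
  shows "(\<Sum>j<17. vf_scale (cst (c * \<beta> j)) (sum_list (map (entry_field a \<kappa> j) r))) =
    combination a \<kappa> (\<lambda>k. sum_list (map (\<lambda>(j, k', e). if k' = k then c * \<beta> j * const_val a \<kappa> e else 0) r))"
  using assms
proof (induction r)
  case Nil
  then show ?case by (simp add: combination_zero)
next
  case (Cons t r)
  obtain j k e where t: "t = (j, k, e)" by (cases t)
  then have jk: "j < 17" "k < 17" using Cons by auto
  have "(\<Sum>j'<17. vf_scale (cst (c * \<beta> j')) (entry_field a \<kappa> j' t)) =
      (\<Sum>j'<17. if j = j' then vf_scale (cst (c * \<beta> j * const_val a \<kappa> e)) (field a \<kappa> k) else 0)"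
    unfolding t entry_field_def
    by (intro sum.cong refl) (auto simp: vf_scale_scale cst_mult)
  also have "\<dots> = combination a \<kappa> (\<lambda>k'. if k = k' then c * \<beta> j * const_val a \<kappa> e else 0)"
    unfolding combination_single [OF jk(2)] using jk(1) by simp
  finally show ?case
    using Cons by (simp add: vf_scale_add_right sum.distrib t combination_add)
qed

lemma bracket_combination:
  "vf_bracket (combination a \<kappa> \<alpha>) (combination a \<kappa> \<beta>) = combination a \<kappa> (structure_product a \<kappa> \<alpha> \<beta>)"
proof -
  let ?F = "field a \<kappa>"
  have v: "vf_scale (cst c) (?F i) \<in> vector_fields" if "i < 17" for c i
    using that by (intro vector_fields_scale field_vector_field)
  have "vf_bracket (combination a \<kappa> \<alpha>) (combination a \<kappa> \<beta>) =
      (\<Sum>i<17. \<Sum>j<17. vf_bracket (vf_scale (cst (\<alpha> i)) (?F i)) (vf_scale (cst (\<beta> j)) (?F j)))"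
    unfolding combination_def using v
    by (subst vf_bracket_sum_left) (auto intro!: sum.cong vf_bracket_sum_right vector_fields_sum)
  also have "\<dots> = (\<Sum>i<17. \<Sum>j<17. vf_scale (cst (\<alpha> i * \<beta> j))
      (sum_list (map (entry_field a \<kappa> j) (structure_constants ! i))))"
    by (intro sum.cong refl)
      (simp add: vf_bracket_scale_left vf_bracket_scale_right vector_fields_scale field_vector_field
        bracket_field vf_scale_scale mult.commute flip: cst_mult)
  also have "\<dots> = (\<Sum>i<17. combination a \<kappa> (\<lambda>k. sum_list (map
      (\<lambda>(j, k', e). if k' = k then \<alpha> i * \<beta> j * const_val a \<kappa> e else 0) (structure_constants ! i))))"
    by (intro sum.cong refl combination_row entry_okI) simp
  also have "\<dots> = combination a \<kappa> (structure_product a \<kappa> \<alpha> \<beta>)"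
    unfolding structure_product_def [abs_def] combination_sum ..
  finally show ?thesis .
qed

section \<open>Linear independence of the fields\<close>

lemma functional_field:
  assumes "n < 17" "m < 17"
  shows "functional (functionals ! n) (field a \<kappa> m) =
    (if n = m then const_val a \<kappa> (functional_diagonal ! n) else 0)"
proof -
  obtain c ds where n: "functionals ! n = (c, ds)" by fastforce
  have "functionals ! n \<in> set functionals"
    using functionals_ok assms(1) by simp
  then have c: "c < 7" and ds: "list_all (\<lambda>d. d < 7) ds"
    using functionals_ok by (auto simp: n list_all_iff)
  have deriv: "foldr (\<lambda>d. pd (coords ! d)) ds (val_poly a \<kappa> p) = val_poly a \<kappa> (foldr deriv_poly ds p)" for p
    using ds by (induction ds) (simp_all add: val_deriv_poly)
  have "add_poly (functional_poly (functionals ! n) (field_poly m))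
     (neg_poly (if n = m then normalize (functional_diagonal ! n) else [])) = []"
    using functional_check assms by (simp add: list_all_iff del: functional_poly.simps)
  from val_poly_diff_zero [OF this]
  have "val_poly a \<kappa> (functional_poly (functionals ! n) (field_poly m)) =
      (if n = m then cst (const_val a \<kappa> (functional_diagonal ! n)) else 0)"
    using functional_diagonal_ok assms(1) by (simp add: val_normalize val_exp_const list_all_length)
  moreover have "functional (functionals ! n) (field a \<kappa> m) =
      origin_value (val_poly a \<kappa> (functional_poly (functionals ! n) (field_poly m)))"
    using c by (simp add: n field_def val_field_coords deriv origin_value_filter [symmetric])
  ultimately show ?thesis by simp
qed

lemma foldr_pd_sum:
  assumes "\<And>i. i \<in> I \<Longrightarrow> F i \<in> superfunctions"
  shows "foldr (\<lambda>d. pd (k d)) ds (\<Sum>i\<in>I. cst (c i) * F i) = (\<Sum>i\<in>I. cst (c i) * foldr (\<lambda>d. pd (k d)) ds (F i))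
    \<and> (\<forall>i\<in>I. foldr (\<lambda>d. pd (k d)) ds (F i) \<in> superfunctions)"
proof (induction ds)
  case (Cons d ds)
  then show ?case by (auto simp: pd_sum sf_mult pd_cst_mult sf_pd)
qed (use assms in simp)

lemma sum_vf_apply: "(\<Sum>i\<in>I. X i) k = (\<Sum>i\<in>I. X i k)" for X :: "nat \<Rightarrow> vf"
  by (induction I rule: infinite_finite_induct) (simp_all add: fun_apply_simps)

lemma functional_combination:
  assumes "n < 17"
  shows "functional (functionals ! n) (combination a \<kappa> \<alpha>) = \<alpha> n * const_val a \<kappa> (functional_diagonal ! n)"
proof -
  obtain c ds where n: "functionals ! n = (c, ds)" by fastforce
  have *: "origin_value (\<Sum>i\<in>I. F i) = (\<Sum>i\<in>I. origin_value (F i))" for F :: "nat \<Rightarrow> sfun" and I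
    by (induction I rule: infinite_finite_induct) simp_all
  have sf: "field a \<kappa> i (coords ! c) \<in> superfunctions" if "i \<in> {..<17}" for i
    using that by (auto intro: vector_fieldsD field_vector_field)
  have "functional (functionals ! n) (combination a \<kappa> \<alpha>) =
      (\<Sum>i<17. \<alpha> i * functional (functionals ! n) (field a \<kappa> i))"
    using foldr_pd_sum [of "{..<17}" "\<lambda>i. field a \<kappa> i (coords ! c)" "\<lambda>d. coords ! d" ds \<alpha>, OF sf]
    by (simp add: n combination_def sum_vf_apply vf_scale_apply *)
  also have "\<dots> = (\<Sum>i<17. if n = i then \<alpha> n * const_val a \<kappa> (functional_diagonal ! n) else 0)"
    by (intro sum.cong refl) (auto simp: functional_field [OF assms])
  finally show ?thesis using assms by simp
qed

text \<open>The conditions on a and \<kappa> make every entry of \<open>functional_diagonal\<close>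
  nonzero; the critical entries are \<kappa> + 1, 2a, a and -a.\<close>

lemma combination_inject:
  assumes "a \<noteq> 0" "\<kappa> \<noteq> -1" "combination a \<kappa> \<alpha> = combination a \<kappa> \<beta>" "n < 17"
  shows "\<alpha> n = \<beta> n"
proof -
  have "\<kappa> + 1 \<noteq> 0" using assms(2) by (metis add_eq_0_iff2)
  then have "const_val a \<kappa> (functional_diagonal ! n) \<noteq> 0"
    using less_17_cases [OF assms(4)] assms(1) by (elim disjE) (simp_all add: functional_diagonal_def Let_def)
  then show ?thesis
    using functional_combination [OF assms(4), of a \<kappa> \<alpha>] functional_combination [OF assms(4), of a \<kappa> \<beta>] assms(3)
    by simp
qed

section \<open>The isomorphism\<close>

text \<open>E, F and G contract two tensor factors of t and u with \<open>\<eta>\<close> and leave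
  the index pair of the remaining factor. Symmetrized by \<open>\<phi>sym\<close>, the pairs 11 and
  22 give multiples of X and -Y, the mixed ones of -H/2.\<close>

lemma odd_bracket_nth:
  fixes t u :: tensor
  defines "E \<equiv> \<lambda>i l. t $ i $ 1 $ 1 * u $ l $ 2 $ 2 - t $ i $ 1 $ 2 * u $ l $ 2 $ 1
      - t $ i $ 2 $ 1 * u $ l $ 1 $ 2 + t $ i $ 2 $ 2 * u $ l $ 1 $ 1"
    and "F \<equiv> \<lambda>j m. t $ 1 $ j $ 1 * u $ 2 $ m $ 2 - t $ 1 $ j $ 2 * u $ 2 $ m $ 1
      - t $ 2 $ j $ 1 * u $ 1 $ m $ 2 + t $ 2 $ j $ 2 * u $ 1 $ m $ 1"
    and "G \<equiv> \<lambda>k n. t $ 1 $ 1 $ k * u $ 2 $ 2 $ n - t $ 1 $ 2 $ k * u $ 2 $ 1 $ n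
      - t $ 2 $ 1 $ k * u $ 1 $ 2 $ n + t $ 2 $ 2 $ k * u $ 1 $ 1 $ n"
  shows "odd_bracket s1 s2 s3 t u $ 1 $ 1 $ 1 = - (s1 * (E 1 2 + E 2 1) / 2)"
    "odd_bracket s1 s2 s3 t u $ 1 $ 1 $ 2 = s1 * E 1 1"
    "odd_bracket s1 s2 s3 t u $ 1 $ 2 $ 1 = - (s1 * E 2 2)"
    "odd_bracket s1 s2 s3 t u $ 1 $ 2 $ 2 = s1 * (E 1 2 + E 2 1) / 2"
    "odd_bracket s1 s2 s3 t u $ 2 $ 1 $ 1 = - (s2 * (F 1 2 + F 2 1) / 2)"
    "odd_bracket s1 s2 s3 t u $ 2 $ 1 $ 2 = s2 * F 1 1"
    "odd_bracket s1 s2 s3 t u $ 2 $ 2 $ 1 = - (s2 * F 2 2)"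
    "odd_bracket s1 s2 s3 t u $ 2 $ 2 $ 2 = s2 * (F 1 2 + F 2 1) / 2"
    "odd_bracket s1 s2 s3 t u $ 3 $ 1 $ 1 = - (s3 * (G 1 2 + G 2 1) / 2)"
    "odd_bracket s1 s2 s3 t u $ 3 $ 1 $ 2 = s3 * G 1 1"
    "odd_bracket s1 s2 s3 t u $ 3 $ 2 $ 1 = - (s3 * G 2 2)"
    "odd_bracket s1 s2 s3 t u $ 3 $ 2 $ 2 = s3 * (G 1 2 + G 2 1) / 2"
  unfolding E_def F_def G_def
  by (simp_all add: odd_bracket_def simple_odd_bracket_def \<eta>_def \<phi>sym_def slX_def slH_def slY_def sum_2 axis_def
      del: fun_apply_simps) (simp_all add: field_simps)

text \<open>Coordinates of the isomorphism. It sends X_2, Y_2, H_2 to \<open>u1p\<close>,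
  -\<open>u1m\<close>, 2 \<open>u1z\<close> - \<open>u3z\<close>, and likewise the third copy to the
  fields with index 2. With F_i for \<open>field a \<kappa> i\<close>, it sends X_1, Y_1, H_1 to
  F_8/(a + 1), -(a + 1)/(a(\<kappa> + 1)) F_2, F_5. First tensor index 2 gives the v^-, index 1 the
  v^+ divided by a + 1: this is the rescaling of the first basis vector, under which X_1 and Y_1
  scale inversely to each other.\<close>

definition gam_coeffs :: "complex \<Rightarrow> complex \<Rightarrow> gam \<Rightarrow> nat \<Rightarrow> complex" where
  "gam_coeffs a \<kappa> z n = (case z of (A, t) \<Rightarrow>
    [- A $ 2 $ 2 $ 1, - A $ 3 $ 2 $ 1, - (a + 1) / (a * (\<kappa> + 1)) * A $ 1 $ 2 $ 1,
     2 * A $ 2 $ 1 $ 1, 2 * A $ 3 $ 1 $ 1, A $ 1 $ 1 $ 1 - A $ 2 $ 1 $ 1 - A $ 3 $ 1 $ 1,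
     A $ 2 $ 1 $ 2, A $ 3 $ 1 $ 2, A $ 1 $ 1 $ 2 / (a + 1),
     t $ 2 $ 1 $ 1, t $ 2 $ 2 $ 1, t $ 2 $ 1 $ 2, - t $ 2 $ 2 $ 2,
     t $ 1 $ 2 $ 2 / (a + 1), t $ 1 $ 1 $ 2 / (a + 1), t $ 1 $ 2 $ 1 / (a + 1), t $ 1 $ 1 $ 1 / (a + 1)] ! n)"

lemma sum_less_17: "(\<Sum>i<17. f i) = f 0 + f 1 + f 2 + f 3 + f 4 + f 5 + f 6 + f 7 + f 8 + f 9 + f 10 +
    f 11 + f 12 + f 13 + f 14 + f 15 + f (16 :: nat)"
  by (simp add: eval_nat_numeral)

lemma gam_coeffs_bracket:
  assumes "a \<noteq> 0" "a + 1 \<noteq> 0" "\<kappa> + 1 \<noteq> 0"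
    and tr: "\<And>r. A $ r $ 2 $ 2 = - A $ r $ 1 $ 1" "\<And>r. B $ r $ 2 $ 2 = - B $ r $ 1 $ 1"
    and b: "b = (a * \<kappa> - 1) / (a + 1)" and n: "n < 17"
  shows "gam_coeffs a \<kappa> (\<Gamma>_bracket (-1 - b) 1 b (A, t) (B, u)) n =
    structure_product a \<kappa> (gam_coeffs a \<kappa> (A, t)) (gam_coeffs a \<kappa> (B, u)) n"
proof -
  \<comment> \<open>In p and w the structure constants are linear: a\<kappa> - 1 becomes w - p, and
    (-1 - b, 1, b) becomes (-w, p, w - p)/p. Only p and w then occur in denominators.\<close>
  define p w where "p = a + 1" and "w = a * (\<kappa> + 1)"
  have pw: "a + 1 = p" "a * \<kappa> - 1 = w - p" "1 - a * \<kappa> = p - w" "a * (\<kappa> + 1) = w"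
    by (simp_all add: p_def w_def algebra_simps)
  have nz: "p \<noteq> 0" "w \<noteq> 0"
    using assms(1-3) by (auto simp: p_def w_def)
  have s: "b = (w - p) / p" "-1 - (w - p) / p = - w / p"
    using nz by (simp_all only: b pw) (simp add: field_simps)
  show ?thesis
    unfolding s
    apply (insert less_17_cases [OF n])
    apply (elim disjE; hypsubst)
    apply (simp_all add: gam_coeffs_def structure_product_def sum_less_17 structure_constants_def Let_def
      odd_bracket_nth even_action_def matrix_matrix_mult_def sum_2 tr pw del: fun_apply_simps)
    apply (simp_all add: field_simps nz)
    done
qed

definition realization :: "complex \<Rightarrow> complex \<Rightarrow> gam \<Rightarrow> vf" where
  "realization a \<kappa> z = combination a \<kappa> (gam_coeffs a \<kappa> z)"

lemma gam_coeffs_add: "n < 17 \<Longrightarrow> gam_coeffs a \<kappa> (z + w) n = gam_coeffs a \<kappa> z n + gam_coeffs a \<kappa> w n"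
  by (cases z; cases w; drule less_17_cases; elim disjE)
    (simp_all add: gam_coeffs_def distrib_left add_divide_distrib)

lemma gam_coeffs_scale: "n < 17 \<Longrightarrow> gam_coeffs a \<kappa> (\<Gamma>_scale c z) n = c * gam_coeffs a \<kappa> z n"
  by (cases z; drule less_17_cases; elim disjE)
    (simp_all add: gam_coeffs_def algebra_simps)

lemma realization_add: "realization a \<kappa> (z + w) = realization a \<kappa> z + realization a \<kappa> w"
  unfolding realization_def combination_add [symmetric] by (intro combination_cong gam_coeffs_add)

lemma realization_scale: "realization a \<kappa> (\<Gamma>_scale c z) = vf_scale (cst c) (realization a \<kappa> z)"
  unfolding realization_def combination_scale [symmetric] by (intro combination_cong gam_coeffs_scale)

lemma trace_mat2: "trace (M :: mat2) = M $ 1 $ 1 + M $ 2 $ 2"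
  by (simp add: trace_def sum_2)

lemma odd_bracket_zero: "odd_bracket s1 s2 s3 0 u = 0" "odd_bracket s1 s2 s3 t 0 = 0"
  by (simp_all add: odd_bracket_def vec_eq_iff)

lemma even_action_zero: "even_action 0 t = 0" "even_action A 0 = 0"
  by (simp_all add: even_action_def vec_eq_iff)

lemma trace_odd_bracket: "trace (odd_bracket s1 s2 s3 t u $ r) = 0"
  using exhaust_3 [of r] by (auto simp: trace_mat2 odd_bracket_nth)

lemma \<Gamma>_bracket_graded:
  "\<Gamma>_bracket s1 s2 s3 (A, 0) (B, 0) = ((\<chi> r. A $ r ** B $ r - B $ r ** A $ r), 0)"
  "\<Gamma>_bracket s1 s2 s3 (A, 0) (0, u) = (0, even_action A u)"
  "\<Gamma>_bracket s1 s2 s3 (0, t) (B, 0) = (0, - even_action B t)"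
  "\<Gamma>_bracket s1 s2 s3 (0, t) (0, u) = (odd_bracket s1 s2 s3 t u, 0)"
  by (simp_all add: odd_bracket_zero even_action_zero)
    (simp_all add: vec_eq_iff matrix_matrix_mult_def)

text \<open>Solves the equations of \<open>gam_coeffs\<close> for traceless matrices. The two halves
  added to \<open>\<alpha> 5\<close> compensate the diagonal entries of the second and third matrix
  that are subtracted in coefficient 5.\<close>

definition even_preimage :: "complex \<Rightarrow> complex \<Rightarrow> (nat \<Rightarrow> complex) \<Rightarrow> mat2^3" where
  "even_preimage a \<kappa> \<alpha> = (let h = (\<lambda>x. \<lambda>y. \<lambda>z. vector [vector [x, y], vector [z, - x]]) in
    vector [h (\<alpha> 5 + \<alpha> 3 / 2 + \<alpha> 4 / 2) ((a + 1) * \<alpha> 8) (- (a * (\<kappa> + 1)) / (a + 1) * \<alpha> 2),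
      h (\<alpha> 3 / 2) (\<alpha> 6) (- \<alpha> 0), h (\<alpha> 4 / 2) (\<alpha> 7) (- \<alpha> 1)])"

definition odd_preimage :: "complex \<Rightarrow> (nat \<Rightarrow> complex) \<Rightarrow> tensor" where
  "odd_preimage a \<alpha> = vector
    [vector [vector [(a + 1) * \<alpha> 16, (a + 1) * \<alpha> 14], vector [(a + 1) * \<alpha> 15, (a + 1) * \<alpha> 13]],
     vector [vector [\<alpha> 9, \<alpha> 11], vector [\<alpha> 10, - \<alpha> 12]]]"

lemma trace_even_preimage: "trace (even_preimage a \<kappa> \<alpha> $ r) = 0"
  using exhaust_3 [of r] by (auto simp: even_preimage_def Let_def trace_mat2)

lemma gam_coeffs_even_preimage:
  assumes "a \<noteq> 0" "a + 1 \<noteq> 0" "\<kappa> + 1 \<noteq> 0" "n < 17"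
  shows "gam_coeffs a \<kappa> (even_preimage a \<kappa> \<alpha>, 0) n = (if n < 9 then \<alpha> n else 0)"
proof -
  \<comment> \<open>Coefficient 2 is the only one with a(\<kappa> + 1) in a denominator; the
    cancellation is proved for abstract p and w first.\<close>
  have c: "- (a + 1) / (a * (\<kappa> + 1)) * (- (a * (\<kappa> + 1)) / (a + 1) * x) = x" for x
  proof -
    have "- p / w * (- w / p * x) = x" if "p \<noteq> 0" "w \<noteq> 0" for p w :: complex
      using that by simp
    from this [of "a + 1" "a * (\<kappa> + 1)"] show ?thesis using assms(1-3) by simp
  qed
  have "gam_coeffs a \<kappa> (even_preimage a \<kappa> \<alpha>, 0) 2 =
      - (a + 1) / (a * (\<kappa> + 1)) * even_preimage a \<kappa> \<alpha> $ 1 $ 2 $ 1"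
    by (simp add: gam_coeffs_def)
  also have "even_preimage a \<kappa> \<alpha> $ 1 $ 2 $ 1 = - (a * (\<kappa> + 1)) / (a + 1) * \<alpha> 2"
    by (simp add: even_preimage_def Let_def)
  finally have "gam_coeffs a \<kappa> (even_preimage a \<kappa> \<alpha>, 0) 2 = \<alpha> 2"
    unfolding c .
  moreover have "gam_coeffs a \<kappa> (even_preimage a \<kappa> \<alpha>, 0) n = (if n < 9 then \<alpha> n else 0)" if "n \<noteq> 2"
    using less_17_cases [OF assms(4)] that
    by (elim disjE) (simp_all add: gam_coeffs_def even_preimage_def Let_def assms(2))
  ultimately show ?thesis by (cases "n = 2") simp_all
qed

lemma gam_coeffs_odd_preimage:
  assumes "a + 1 \<noteq> 0" "n < 17"
  shows "gam_coeffs a \<kappa> (0, odd_preimage a \<alpha>) n = (if n < 9 then 0 else \<alpha> n)"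
  using less_17_cases [OF assms(2)]
  by (elim disjE) (simp_all add: gam_coeffs_def odd_preimage_def assms(1))

lemma gam_coeffs_even: "n < 17 \<Longrightarrow> 9 \<le> n \<Longrightarrow> gam_coeffs a \<kappa> (A, 0) n = 0"
  by (drule less_17_cases; elim disjE) (simp_all add: gam_coeffs_def)

lemma gam_coeffs_odd: "n < 9 \<Longrightarrow> gam_coeffs a \<kappa> (0, t) n = 0"
  using less_17_cases [of n] by (auto simp: gam_coeffs_def)

text \<open>The lower right entries of the matrices do not enter the coefficients; the trace
  condition determines them.\<close>

lemma gam_coeffs_inject:
  assumes "a \<noteq> 0" "a + 1 \<noteq> 0" "\<kappa> + 1 \<noteq> 0"
    and "\<And>r. A $ r $ 2 $ 2 = - A $ r $ 1 $ 1" "\<And>r. B $ r $ 2 $ 2 = - B $ r $ 1 $ 1"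
    and eq: "\<And>n. n < 17 \<Longrightarrow> gam_coeffs a \<kappa> (A, t) n = gam_coeffs a \<kappa> (B, u) n"
  shows "A = B \<and> t = u"
proof -
  have "- a \<noteq> 1" using assms(2) by (metis add.right_inverse minus_minus add.commute)
  then show ?thesis
  using eq [of 0] eq [of 1] eq [of 2] eq [of 3] eq [of 4] eq [of 5] eq [of 6] eq [of 7] eq [of 8]
    eq [of 9] eq [of 10] eq [of 11] eq [of 12] eq [of 13] eq [of 14] eq [of 15] eq [of 16]
  by (simp add: gam_coeffs_def vec_eq_iff forall_3 forall_2 assms)
qed

lemma field_combination: "i < 17 \<Longrightarrow> field a \<kappa> i = combination a \<kappa> (\<lambda>j. if i = j then 1 else 0)"
  by (simp add: combination_single) (simp add: fun_eq_iff vf_scale_apply)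

section \<open>The realization of D(2,1;b) by vector fields\<close>

context
  fixes a \<kappa> :: complex
  assumes nz: "a \<noteq> 0" "a + 1 \<noteq> 0" "\<kappa> + 1 \<noteq> 0"
begin

lemma field_8: "field a \<kappa> 8 = vf_scale (cst (inverse (a * (\<kappa> + 1)))) (u3p a \<kappa>)"
proof -
  have "inverse (a * (\<kappa> + 1)) * (a * (\<kappa> + 1)) = 1"
    by (rule left_inverse) (simp add: nz)
  then have "cst (inverse (a * (\<kappa> + 1))) * cst (a * (\<kappa> + 1)) = 1"
    by (simp only: cst_1 flip: cst_mult)
  then show ?thesis
    by (simp only: u3p_eq vf_scale_scale) (simp add: fun_eq_iff vf_scale_apply)
qed

text \<open>P marks the indices whose coefficients must vanish: the odd fields for the even part,
  the even fields for the odd part.\<close>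

lemma subspace_combinations: "vf_subspace {combination a \<kappa> \<alpha> | \<alpha>. \<forall>i<17. P i \<longrightarrow> \<alpha> i = 0}"
proof (rule vf_subspaceI)
  show "0 \<in> {combination a \<kappa> \<alpha> | \<alpha>. \<forall>i<17. P i \<longrightarrow> \<alpha> i = 0}"
    using combination_zero [of a \<kappa>] by (intro CollectI exI [of _ "\<lambda>_. 0"]) simp
next
  fix X Y
  assume "X \<in> {combination a \<kappa> \<alpha> | \<alpha>. \<forall>i<17. P i \<longrightarrow> \<alpha> i = 0}" "Y \<in> {combination a \<kappa> \<alpha> | \<alpha>. \<forall>i<17. P i \<longrightarrow> \<alpha> i = 0}"
  then obtain \<alpha> \<beta> where "X = combination a \<kappa> \<alpha>" "Y = combination a \<kappa> \<beta>"
    "\<forall>i<17. P i \<longrightarrow> \<alpha> i = 0" "\<forall>i<17. P i \<longrightarrow> \<beta> i = 0" by blast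
  then show "X + Y \<in> {combination a \<kappa> \<alpha> | \<alpha>. \<forall>i<17. P i \<longrightarrow> \<alpha> i = 0}"
    by (intro CollectI exI [of _ "\<lambda>i. \<alpha> i + \<beta> i"]) (simp add: combination_add)
next
  fix c X
  assume "X \<in> {combination a \<kappa> \<alpha> | \<alpha>. \<forall>i<17. P i \<longrightarrow> \<alpha> i = 0}"
  then obtain \<alpha> where "X = combination a \<kappa> \<alpha>" "\<forall>i<17. P i \<longrightarrow> \<alpha> i = 0" by blast
  then show "vf_scale (cst c) X \<in> {combination a \<kappa> \<alpha> | \<alpha>. \<forall>i<17. P i \<longrightarrow> \<alpha> i = 0}"
    by (intro CollectI exI [of _ "\<lambda>i. c * \<alpha> i"]) (simp add: combination_scale)
qed

text \<open>\<open>vf_span\<close> sums over a set of fields, \<open>combination\<close> over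
  indices and with the rescaled field 8; two inclusions between subspaces avoid any matching of the
  sums.\<close>

lemma vf_span_eq_combinations:
  assumes B: "finite B" "B \<subseteq> {combination a \<kappa> \<alpha> | \<alpha>. \<forall>i<17. P i \<longrightarrow> \<alpha> i = 0}"
    and F: "\<And>i. i < 17 \<Longrightarrow> \<not> P i \<Longrightarrow> field a \<kappa> i \<in> vf_span B"
  shows "vf_span B = {combination a \<kappa> \<alpha> | \<alpha>. \<forall>i<17. P i \<longrightarrow> \<alpha> i = 0}"
proof (intro subset_antisym vf_span_least subspace_combinations B(2) subsetI)
  fix X assume "X \<in> {combination a \<kappa> \<alpha> | \<alpha>. \<forall>i<17. P i \<longrightarrow> \<alpha> i = 0}"
  then obtain \<alpha> where X: "X = combination a \<kappa> \<alpha>" and \<alpha>: "\<forall>i<17. P i \<longrightarrow> \<alpha> i = 0" by blast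
  have "vf_scale (cst (\<alpha> i)) (field a \<kappa> i) \<in> vf_span B" if "i < 17" for i
    using that \<alpha> F [of i] vf_subspace_vf_span [of B] by (cases "P i") (auto simp: vf_subspace_def)
  then show "X \<in> vf_span B"
    unfolding X combination_def by (intro vf_subspace_sum vf_subspace_vf_span) simp
qed

lemma vf_span_u_fields:
  "vf_span (u_fields a \<kappa>) = {combination a \<kappa> \<alpha> | \<alpha>. \<forall>i<17. 9 \<le> i \<longrightarrow> \<alpha> i = 0}"
proof (rule vf_span_eq_combinations)
  have F: "field a \<kappa> i \<in> {combination a \<kappa> \<alpha> | \<alpha>. \<forall>i<17. 9 \<le> i \<longrightarrow> \<alpha> i = 0}" if "i < 9" for i
    using that by (intro CollectI exI [of _ "\<lambda>j. if i = j then 1 else 0"]) (simp add: field_combination)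
  moreover have "u3p a \<kappa> \<in> {combination a \<kappa> \<alpha> | \<alpha>. \<forall>i<17. 9 \<le> i \<longrightarrow> \<alpha> i = 0}"
    unfolding u3p_eq using F [of 8] subspace_combinations [of "\<lambda>i. 9 \<le> i"]
    unfolding vf_subspace_def by simp
  ultimately show "u_fields a \<kappa> \<subseteq> {combination a \<kappa> \<alpha> | \<alpha>. \<forall>i<17. 9 \<le> i \<longrightarrow> \<alpha> i = 0}"
    unfolding u_fields_def field_eqs [where a = a and \<kappa> = \<kappa>] insert_subset by simp
  show fin: "finite (u_fields a \<kappa>)" by (simp add: u_fields_def)
  \<comment> \<open>Field 8 is recovered from \<open>u3p\<close> by dividing by a(\<kappa> + 1),
    which is nonzero.\<close>
  have "vf_scale (cst (inverse (a * (\<kappa> + 1)))) (u3p a \<kappa>) \<in> vf_span (u_fields a \<kappa>)"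
    using vf_span_superset [OF fin] vf_subspace_vf_span [of "u_fields a \<kappa>"]
    by (auto simp: vf_subspace_def u_fields_def)
  then have "field a \<kappa> 8 \<in> vf_span (u_fields a \<kappa>)" by (simp only: field_8)
  moreover have "field a \<kappa> i \<in> u_fields a \<kappa>" if "i < 8" for i
    using that less_17_cases [of i] unfolding u_fields_def field_eqs [where a = a and \<kappa> = \<kappa>] by auto
  ultimately show "field a \<kappa> i \<in> vf_span (u_fields a \<kappa>)" if "i < 17" "\<not> 9 \<le> i" for i
    using that vf_span_superset [OF fin] by (cases "i = 8") auto
qed

lemma vf_span_v_fields:
  "vf_span (v_fields a \<kappa>) = {combination a \<kappa> \<alpha> | \<alpha>. \<forall>i<17. i < 9 \<longrightarrow> \<alpha> i = 0}"
proof (rule vf_span_eq_combinations)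
  have F: "field a \<kappa> i \<in> {combination a \<kappa> \<alpha> | \<alpha>. \<forall>i<17. i < 9 \<longrightarrow> \<alpha> i = 0}" if "9 \<le> i" "i < 17" for i
    using that by (intro CollectI exI [of _ "\<lambda>j. if i = j then 1 else 0"]) (simp add: field_combination)
  then show "v_fields a \<kappa> \<subseteq> {combination a \<kappa> \<alpha> | \<alpha>. \<forall>i<17. i < 9 \<longrightarrow> \<alpha> i = 0}"
    unfolding v_fields_def field_eqs [where a = a and \<kappa> = \<kappa>] insert_subset by simp
  show fin: "finite (v_fields a \<kappa>)" by (simp add: v_fields_def)
  have "field a \<kappa> i \<in> v_fields a \<kappa>" if "9 \<le> i" "i < 17" for i
    using that less_17_cases [of i] unfolding v_fields_def field_eqs [where a = a and \<kappa> = \<kappa>] by auto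
  then show "field a \<kappa> i \<in> vf_span (v_fields a \<kappa>)" if "i < 17" "\<not> i < 9" for i
    using that vf_span_superset [OF fin] by auto
qed

lemma realization_even: "realization a \<kappa> ` even_part (D21 b) = vf_span (u_fields a \<kappa>)"
  unfolding vf_span_u_fields
proof (intro subset_antisym subsetI)
  fix X assume "X \<in> realization a \<kappa> ` even_part (D21 b)"
  then obtain A where "X = combination a \<kappa> (gam_coeffs a \<kappa> (A, 0))"
    by (auto simp: D21_def \<Gamma>_superalg_def realization_def)
  then show "X \<in> {combination a \<kappa> \<alpha> | \<alpha>. \<forall>i<17. 9 \<le> i \<longrightarrow> \<alpha> i = 0}"
    using gam_coeffs_even by blast
next
  fix X assume "X \<in> {combination a \<kappa> \<alpha> | \<alpha>. \<forall>i<17. 9 \<le> i \<longrightarrow> \<alpha> i = 0}"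
  then obtain \<alpha> where "X = combination a \<kappa> \<alpha>" "\<forall>i<17. 9 \<le> i \<longrightarrow> \<alpha> i = 0" by blast
  then have "X = realization a \<kappa> (even_preimage a \<kappa> \<alpha>, 0)"
    unfolding realization_def
    by (auto intro!: combination_cong simp: gam_coeffs_even_preimage [OF nz])
  then show "X \<in> realization a \<kappa> ` even_part (D21 b)"
    by (auto simp: D21_def \<Gamma>_superalg_def trace_even_preimage)
qed

lemma realization_odd: "realization a \<kappa> ` odd_part (D21 b) = vf_span (v_fields a \<kappa>)"
  unfolding vf_span_v_fields
proof (intro subset_antisym subsetI)
  fix X assume "X \<in> realization a \<kappa> ` odd_part (D21 b)"
  then obtain t where "X = combination a \<kappa> (gam_coeffs a \<kappa> (0, t))"
    by (auto simp: D21_def \<Gamma>_superalg_def realization_def)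
  then show "X \<in> {combination a \<kappa> \<alpha> | \<alpha>. \<forall>i<17. i < 9 \<longrightarrow> \<alpha> i = 0}"
    using gam_coeffs_odd by blast
next
  fix X assume "X \<in> {combination a \<kappa> \<alpha> | \<alpha>. \<forall>i<17. i < 9 \<longrightarrow> \<alpha> i = 0}"
  then obtain \<alpha> where "X = combination a \<kappa> \<alpha>" "\<forall>i<17. i < 9 \<longrightarrow> \<alpha> i = 0" by blast
  then have "X = realization a \<kappa> (0, odd_preimage a \<alpha>)"
    unfolding realization_def
    by (auto intro!: combination_cong simp: gam_coeffs_odd_preimage [OF nz(2)])
  then show "X \<in> realization a \<kappa> ` odd_part (D21 b)"
    by (auto simp: D21_def \<Gamma>_superalg_def)
qed

lemma carrier_D21: "sa_carrier (D21 b) = {(A, t) | A t. \<forall>r. trace (A $ r) = 0}"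
  by (auto simp: sa_carrier_def D21_def \<Gamma>_superalg_def)

lemma traceless: "(A, t) \<in> sa_carrier (D21 b) \<Longrightarrow> A $ r $ 2 $ 2 = - A $ r $ 1 $ 1"
  by (simp add: carrier_D21 trace_mat2 add_eq_0_iff2)

lemma realization_bracket:
  assumes b: "b = (a * \<kappa> - 1) / (a + 1)" and z: "z \<in> sa_carrier (D21 b)" "w \<in> sa_carrier (D21 b)"
  shows "realization a \<kappa> (brk (D21 b) z w) = vf_bracket (realization a \<kappa> z) (realization a \<kappa> w)"
proof -
  obtain A t B u where zw: "z = (A, t)" "w = (B, u)" by (cases z; cases w)
  show ?thesis
    unfolding realization_def bracket_combination
    using gam_coeffs_bracket [OF nz traceless traceless b] z
    by (intro combination_cong) (simp add: D21_def \<Gamma>_superalg_def zw del: \<Gamma>_bracket.simps)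
qed

lemma realization_inj: "inj_on (realization a \<kappa>) (sa_carrier (D21 b))"
proof (rule inj_onI)
  fix z w assume zw: "z \<in> sa_carrier (D21 b)" "w \<in> sa_carrier (D21 b)" "realization a \<kappa> z = realization a \<kappa> w"
  obtain A t B u where eq: "z = (A, t)" "w = (B, u)" by (cases z; cases w)
  have "\<kappa> \<noteq> -1" using nz(3) by auto
  then have coeffs: "gam_coeffs a \<kappa> (A, t) n = gam_coeffs a \<kappa> (B, u) n" if "n < 17" for n
    using combination_inject [OF nz(1) _ _ that] zw(3) by (simp add: realization_def eq)
  show "z = w"
    using gam_coeffs_inject [OF nz traceless [OF zw(1) [unfolded eq]] traceless [OF zw(2) [unfolded eq]] coeffs]
    by (simp only: eq)
qed

lemma realization_iso:
  assumes "b = (a * \<kappa> - 1) / (a + 1)"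
  shows "superalg_iso (realization a \<kappa>) (D21 b)
    (vf_superalg (vf_span (u_fields a \<kappa>)) (vf_span (v_fields a \<kappa>)))" (is "superalg_iso _ _ ?M")
proof -
  \<comment> \<open>The carriers are by definition sets of sums of even and odd elements, so
    surjectivity reduces to the two parts.\<close>
  have sums: "realization a \<kappa> ` {x + y | x y. x \<in> E \<and> y \<in> F} =
      {X + Y | X Y. X \<in> realization a \<kappa> ` E \<and> Y \<in> realization a \<kappa> ` F}" for E F
  proof (intro set_eqI iffI)
    fix Z assume "Z \<in> realization a \<kappa> ` {x + y | x y. x \<in> E \<and> y \<in> F}"
    then obtain x y where "x \<in> E" "y \<in> F" "Z = realization a \<kappa> x + realization a \<kappa> y"
      using realization_add by blast
    then show "Z \<in> {X + Y | X Y. X \<in> realization a \<kappa> ` E \<and> Y \<in> realization a \<kappa> ` F}" by blast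
  next
    fix Z assume "Z \<in> {X + Y | X Y. X \<in> realization a \<kappa> ` E \<and> Y \<in> realization a \<kappa> ` F}"
    then obtain x y where "x \<in> E" "y \<in> F" "Z = realization a \<kappa> (x + y)"
      unfolding realization_add by blast
    then show "Z \<in> realization a \<kappa> ` {x + y | x y. x \<in> E \<and> y \<in> F}" by blast
  qed
  have M: "even_part ?M = vf_span (u_fields a \<kappa>)" "odd_part ?M = vf_span (v_fields a \<kappa>)"
    "scal ?M = (\<lambda>c. vf_scale (cst c))" "brk ?M = vf_bracket" "scal (D21 b) = \<Gamma>_scale"
    by (simp_all add: vf_superalg_def D21_def \<Gamma>_superalg_def)
  show ?thesis
    unfolding superalg_iso_def bij_betw_def M
    by (intro conjI ballI allI realization_inj realization_even realization_odd realization_add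
        realization_scale realization_bracket [OF assms])
      (simp_all only: sa_carrier_def sums M realization_even realization_odd)
qed

text \<open>Both spans are images of the graded parts of D(2,1;b). There the bracket visibly
  respects the grading, commutators and odd brackets being traceless, and the realization carries
  this over.\<close>

lemma lie_superalgebra:
  assumes "u_fields a \<kappa> \<subseteq> homogeneous_vector_fields False" "v_fields a \<kappa> \<subseteq> homogeneous_vector_fields True"
  shows "lie_superalgebra_of_vector_fields (vf_span (u_fields a \<kappa>)) (vf_span (v_fields a \<kappa>))"
proof -
  define b where "b = (a * \<kappa> - 1) / (a + 1)"
  let ?E = "even_part (D21 b)" and ?O = "odd_part (D21 b)"
  have car: "z \<in> sa_carrier (D21 b)" if "z \<in> ?E \<or> z \<in> ?O" for z
    using that unfolding carrier_D21 by (auto simp: D21_def \<Gamma>_superalg_def trace_mat2)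
  have br: "vf_bracket (realization a \<kappa> z) (realization a \<kappa> w) = realization a \<kappa> (brk (D21 b) z w)"
    if "z \<in> ?E \<or> z \<in> ?O" "w \<in> ?E \<or> w \<in> ?O" for z w
    by (rule realization_bracket [OF b_def car [OF that(1)] car [OF that(2)], symmetric])
  have parts: "?E = {(A, 0) | A. \<forall>r. trace (A $ r) = 0}" "?O = {(0, t) | t. True}"
    "brk (D21 b) = \<Gamma>_bracket (-1 - b) 1 b"
    by (simp_all add: D21_def \<Gamma>_superalg_def)
  have ee: "brk (D21 b) z w \<in> ?E" if zw: "z \<in> ?E" "w \<in> ?E" for z w
  proof -
    obtain A B where "z = (A, 0)" "w = (B, 0)" using zw unfolding parts by blast
    moreover have "trace (A $ r ** B $ r - B $ r ** A $ r) = 0" for r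
      using trace_mul_sym [of "A $ r" "B $ r"] by (simp only: trace_sub diff_self)
    ultimately show ?thesis
      unfolding parts by (simp only: \<Gamma>_bracket_graded) simp
  qed
  have eo: "brk (D21 b) z w \<in> ?O \<and> brk (D21 b) w z \<in> ?O" if zw: "z \<in> ?E" "w \<in> ?O" for z w
  proof -
    obtain A u where "z = (A, 0)" "w = (0, u)" using zw unfolding parts by blast
    then show ?thesis unfolding parts by (simp only: \<Gamma>_bracket_graded) simp
  qed
  have oo: "brk (D21 b) z w \<in> ?E" if zw: "z \<in> ?O" "w \<in> ?O" for z w
  proof -
    obtain t u where "z = (0, t)" "w = (0, u)" using zw unfolding parts by blast
    then show ?thesis
      unfolding parts by (simp only: \<Gamma>_bracket_graded) (simp add: trace_odd_bracket)
  qed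
  let ?\<phi> = "realization a \<kappa>"
  have "vf_bracket X Y \<in> ?\<phi> ` ?E" if "X \<in> ?\<phi> ` ?E" "Y \<in> ?\<phi> ` ?E" for X Y
    using that ee br by (elim imageE) (simp only: simp_thms, blast)
  moreover have "vf_bracket X Y \<in> ?\<phi> ` ?O \<and> vf_bracket Y X \<in> ?\<phi> ` ?O" if "X \<in> ?\<phi> ` ?E" "Y \<in> ?\<phi> ` ?O" for X Y
    using that eo br by (elim imageE) (simp only: simp_thms, blast)
  moreover have "vf_bracket X Y \<in> ?\<phi> ` ?E" if "X \<in> ?\<phi> ` ?O" "Y \<in> ?\<phi> ` ?O" for X Y
    using that oo br by (elim imageE) (simp only: simp_thms, blast)
  ultimately show ?thesis
    unfolding lie_superalgebra_of_vector_fields_def realization_even realization_odd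
    using vf_span_least [OF vf_subspace_homogeneous assms(1)] vf_span_least [OF vf_subspace_homogeneous assms(2)]
      vf_subspace_vf_span by blast
qed

end

theorem theorem4p23:
  fixes a \<kappa> :: complex
  assumes "a \<noteq> 0" and "a \<noteq> -1" and "\<kappa> \<noteq> -1" and "a * \<kappa> \<noteq> 1"
  shows "u_fields a \<kappa> \<subseteq> homogeneous_vector_fields False \<and>
    v_fields a \<kappa> \<subseteq> homogeneous_vector_fields True \<and>
    lie_superalgebra_of_vector_fields (vf_span (u_fields a \<kappa>)) (vf_span (v_fields a \<kappa>)) \<and>
    superalg_isomorphic (D21 ((a * \<kappa> - 1) / (a + 1)))
      (vf_superalg (vf_span (u_fields a \<kappa>)) (vf_span (v_fields a \<kappa>))) \<and>
    splits_into_two_even_and_one_odd_line D1 D2 (D3 \<kappa>) \<and>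
    vf_span (u_fields a \<kappa> \<union> v_fields a \<kappa>) \<subseteq> split_symmetries D1 D2 (D3 \<kappa>)"
proof -
  have nz: "a \<noteq> 0" "a + 1 \<noteq> 0" "\<kappa> + 1 \<noteq> 0"
    using assms by (auto simp: add_eq_0_iff2)
  have even: "field a \<kappa> i \<in> homogeneous_vector_fields False" if "i < 9" for i
    using field_homogeneous [of i a \<kappa>] that by (simp add: linorder_not_le [symmetric])
  have odd: "field a \<kappa> i \<in> homogeneous_vector_fields True" if "9 \<le> i" "i < 17" for i
    using field_homogeneous [of i a \<kappa>] that by simp
  \<comment> \<open>The only listed field that is a proper multiple of its polynomial form; stated
    for any subspace, since it serves both homogeneity and symmetry.\<close>
  have u3p: "u3p a \<kappa> \<in> A" if "vf_subspace A" "field a \<kappa> 8 \<in> A" for A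
    using that unfolding u3p_eq vf_subspace_def by simp
  have u: "u_fields a \<kappa> \<subseteq> homogeneous_vector_fields False"
    using u3p [OF vf_subspace_homogeneous, of False] even
    by (simp add: u_fields_def field_eqs [where a = a and \<kappa> = \<kappa>])
  have v: "v_fields a \<kappa> \<subseteq> homogeneous_vector_fields True"
    using odd by (simp add: v_fields_def field_eqs [where a = a and \<kappa> = \<kappa>])
  have D: "D1 \<in> vector_fields" "D2 \<in> vector_fields" "D3 \<kappa> \<in> vector_fields"
    using distribution_splits [of \<kappa>]
    by (simp_all add: splits_into_two_even_and_one_odd_line_def homogeneous_vector_fields_def)
  have "u_fields a \<kappa> \<union> v_fields a \<kappa> \<subseteq> split_symmetries D1 D2 (D3 \<kappa>)"
    using u3p [OF split_symmetries_subspace [OF D]] field_split_symmetry [of _ a \<kappa>]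
    by (simp add: u_fields_def v_fields_def field_eqs [where a = a and \<kappa> = \<kappa>])
  then have "vf_span (u_fields a \<kappa> \<union> v_fields a \<kappa>) \<subseteq> split_symmetries D1 D2 (D3 \<kappa>)"
    by (rule vf_span_least [OF split_symmetries_subspace [OF D]])
  moreover have "superalg_isomorphic (D21 ((a * \<kappa> - 1) / (a + 1)))
      (vf_superalg (vf_span (u_fields a \<kappa>)) (vf_span (v_fields a \<kappa>)))"
    unfolding superalg_isomorphic_def using realization_iso [OF nz refl] by blast
  ultimately show ?thesis
    using u v lie_superalgebra [OF nz u v] distribution_splits by blast
qed

end
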